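(* Let $(\mathcal{T}(n))_{n\ge1}$ be the delayed attachment tree process with $\beta\in[0,1)$ and attachment function $f(k)=k+\alpha$ ($k\ge1$) for a constant $\alpha>-1$. Assume the delay distribution $\mu$ satisfies $$\lim_{n\to\infty}\mathbb{E}\Big[\frac{n^\beta\xi\,\mathbf 1\{n-n^\beta\xi\ge1\}}{\lfloor n-n^\beta\xi\rfloor_+}\Big]=0\quad\text{and}\quad\sum_{n=1}^\infty\frac1n\,\mathbb{E}\Big[\frac{n^\beta\xi\,\mathbf 1\{n-n^\beta\xi\ge1\}}{\lfloor n-n^\beta\xi\rfloor_+}\Big]<\infty.$$ Let $X:=\xi^{1/(1-\beta)}$, $\theta:=1/(2+\alpha)$, and $M(\rho,n):=\deg(v_1,n)$ be the root degree. (i) If $\mathbb{E}[X^{1-\theta}]<\infty$, then there is a finite non-negative random variable $W_\infty$ (depending on $\alpha,\beta,\mu$) with $\mathbb{P}(W_\infty>0)>0$ such that $M(\rho,n)/n^\theta\to W_\infty$ almost surely and in $L^2$. (ii) If $\mathbb{E}[X]=\infty$, then for every $\varepsilon>0$, $$\lim_{n\to\infty}\mathbb{P}\big(M(\rho,n)\ge(1-\varepsilon)\,\mathbb{E}[X\wedge n]\big)=1.$$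
   Context: Model. Fix $\beta\in[0,1)$, a probability distribution $\mu$ on $[0,\infty)$ (the delay distribution) and a function $f:\{1,2,\dots\}\to(0,\infty)$ (the attachment function); $\xi$ denotes a generic random variable with law $\mu$. For $x\in\mathbb{R}$ let $\lfloor x\rfloor_+:=\max\{\lfloor x\rfloor,1\}$. A sequence of random rooted trees $(\mathcal{T}(n))_{n\ge1}$ is grown as follows; $\mathcal{T}(n)$ has vertex set $\{v_1,\dots,v_n\}$ and root $\rho=v_1$. - $\mathcal{T}(1)$ consists of $v_1$ alone, and $\mathcal{T}(2)$ consists of $v_1,v_2$ with $v_1$ the parent of $v_2$. - For $j\ge i$, $\deg(v_i,j)$ is the number of children of $v_i$ in $\mathcal{T}(j)$ plus one (so $\deg(v_i,i)=1$), and $\deg(v_i,j):=0$ for $j<i$. - For $n\ge2$, given $\mathcal{T}(1),\dots,\mathcal{T}(n)$, draw $\xi_{n+1}\sim\mu$ independently of everything before and put $m:=\lfloor n-n^{\beta}\xi_{n+1}\rfloor_+$. The new vertex $v_{n+1}$ chooses its parent $v\in\mathcal{T}(m)$ with probability $f(\deg(v,m))/\sum_{u\in\mathcal{T}(m)}f(\deg(u,m))$, and $\mathcal{T}(n+1)$ is $\mathcal{T}(n)$ together with this new vertex and edge. - $\mathcal{F}_n$ denotes the $\sigma$-field generated by $\mathcal{T}(1),\dots,\mathcal{T}(n)$ and $\xi_2,\dots,\xi_n$. *)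

theory Defs
  imports "HOL-Probability.Probability"
begin

text \<open>Vertices v_1, v_2, ... are represented by their indices 1, 2, ....
  A tree on {v_1..v_n} is represented by a parent function p, where p k is the
  index of the parent of v_k (2 <= k <= n); values outside this range are irrelevant.\<close>

definition deg :: "(nat \<Rightarrow> nat) \<Rightarrow> nat \<Rightarrow> nat \<Rightarrow> nat" where
  "deg p i j = (if j < i then 0 else Suc (card {k \<in> {i<..j}. p k = i}))"

definition floor_plus :: "real \<Rightarrow> nat" where
  "floor_plus x = nat (max \<lfloor>x\<rfloor> 1)"

text \<open>Sampling a vertex v in {1..m} with probability w v / (sum of w over {1..m})
  from a uniform variable u in [0,1] (inverse transform sampling).
  The fallback case u = 1 (probability zero) returns m.\<close>
definition pick :: "(nat \<Rightarrow> real) \<Rightarrow> nat \<Rightarrow> real \<Rightarrow> nat" where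
  "pick w m u =
     (if \<exists>v\<in>{1..m}. u * (\<Sum>k=1..m. w k) < (\<Sum>k=1..v. w k)
      then (LEAST v. v \<in> {1..m} \<and> u * (\<Sum>k=1..m. w k) < (\<Sum>k=1..v. w k))
      else m)"

text \<open>The delayed attachment tree process, driven by the delays xi and independent
  uniform variables U.  dat_parent f beta xi U n is the parent function of T(n).\<close>
fun dat_parent :: "(nat \<Rightarrow> real) \<Rightarrow> real \<Rightarrow> (nat \<Rightarrow> real) \<Rightarrow> (nat \<Rightarrow> real) \<Rightarrow> nat \<Rightarrow> (nat \<Rightarrow> nat)" where
  "dat_parent f \<beta> \<xi> U 0 = (\<lambda>_. 0)"
| "dat_parent f \<beta> \<xi> U (Suc n) =
     (let p = dat_parent f \<beta> \<xi> U n in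
      if n < 2 then p(Suc n := (if n = 1 then 1 else 0))
      else (let m = floor_plus (real n - real n powr \<beta> * \<xi> (Suc n))
            in p(Suc n := pick (\<lambda>v. f (deg p v m)) m (U (Suc n)))))"

definition dat_space :: "real measure \<Rightarrow> (nat \<Rightarrow> real \<times> real) measure" where
  "dat_space \<mu> = (\<Pi>\<^sub>M k\<in>UNIV. (\<mu> \<Otimes>\<^sub>M uniform_measure lborel {0..1::real}))"

definition root_deg :: "(nat \<Rightarrow> real) \<Rightarrow> real \<Rightarrow> nat \<Rightarrow> (nat \<Rightarrow> real \<times> real) \<Rightarrow> nat" where
  "root_deg f \<beta> n \<omega> = deg (dat_parent f \<beta> (\<lambda>k. fst (\<omega> k)) (\<lambda>k. snd (\<omega> k)) n) 1 n"

definition delay_quantity :: "real measure \<Rightarrow> real \<Rightarrow> nat \<Rightarrow> real" where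
  "delay_quantity \<mu> \<beta> n = (\<integral>x. (if real n - real n powr \<beta> * x \<ge> 1
        then real n powr \<beta> * x / real (floor_plus (real n - real n powr \<beta> * x)) else 0) \<partial>\<mu>)"

end

theory Submission
  imports Defs
begin

text \<open>Write \<open>N n\<close> for the root degree plus \<open>\<alpha>\<close> and \<open>wt m = (2 + \<alpha>) m - 1\<close> for the total weight of \<open>T(m)\<close>.
  A vertex that looks at \<open>T(m)\<close> attaches to the root with probability \<open>N m / wt m\<close>.

  (i) Compared with the undelayed rate \<open>N n / wt n\<close>, the conditional rate exceeds it by at most a
  relative error of the order of the delay quantity plus the probability \<open>q n\<close> of \<open>m = 1\<close>, and both
  are summable after normalisation by \<open>b n \<sim> \<Gamma>(1 - \<theta>) n powr \<theta>\<close>. Hence \<open>Y = N / b\<close> is bounded in \<open>L\<^sup>2\<close>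
  and equals a martingale plus a summable increasing process \<open>U\<close> minus an increasing process \<open>V\<close>.
  Since \<open>Y \<ge> 0\<close>, \<open>V\<close> is dominated by the martingale plus \<open>U\<close>, so it converges almost surely and in
  \<open>L\<^sup>2\<close>; no lower bound on the drift is needed. The mean of \<open>Y\<close> never drops below \<open>1 + \<alpha>\<close>, so the limit
  is not almost surely zero.

  (ii) Whenever \<open>X > n\<close>, the attachment time is \<open>m = 1\<close> and the new vertex is forced onto the root.
  These events are independent and their expected number up to time \<open>n\<close> is at least \<open>E (min X n)\<close>
  up to the initial degree, so Chebyshev's inequality applies.\<close>

section \<open>The tree process\<close>

text \<open>The increment at step n depends on the root degree at a random earlier time, so the root
  degree is not Markov. What links the two times is the monotonicity \<open>N m \<le> N n\<close>,
  which bounds the drift of the normalised process from above; the matching control has to come from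
  its positivity. The time m = 1 is split off because delays with
  \<open>n - n powr \<beta> * x < 1\<close> fall outside the indicator in the delay quantity. The
  moment condition pays for it: up to a constant factor in X, \<open>q n\<close> is P(X > n), and
  E[X^(1 - \<theta>)] is comparable with the sum of P(X > n) / n^\<theta>. Conditioning on the past
  is expressed on the product space: conditional means are integrals over the single coordinate that
  a step reads, and adaptedness is invariance under overwriting later coordinates.\<close>

lemma dat_parent_stable: "k \<le> m \<Longrightarrow> m \<le> n \<Longrightarrow> dat_parent f \<beta> \<xi> U n k = dat_parent f \<beta> \<xi> U m k"
proof (induction n)
  case (Suc n)
  show ?case
  proof (cases "m = Suc n")
    case False
    then have "dat_parent f \<beta> \<xi> U (Suc n) k = dat_parent f \<beta> \<xi> U n k"
      using Suc.prems by (simp add: Let_def)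
    then show ?thesis using Suc False by simp
  qed simp
qed simp

lemma deg_cong: "(\<And>k. k \<le> j \<Longrightarrow> p k = q k) \<Longrightarrow> deg p i j = deg q i j"
  unfolding deg_def by (auto intro!: arg_cong[where f = card])

lemma deg_dat_parent_stable:
  "m \<le> n \<Longrightarrow> deg (dat_parent f \<beta> \<xi> U n) i m = deg (dat_parent f \<beta> \<xi> U m) i m"
  by (intro deg_cong dat_parent_stable)

lemma deg_Suc: "i \<le> j \<Longrightarrow> deg p i (Suc j) = deg p i j + (if p (Suc j) = i then 1 else 0)"
proof -
  assume "i \<le> j"
  then have "{k \<in> {i<..Suc j}. p k = i} =
      (if p (Suc j) = i then insert (Suc j) {k \<in> {i<..j}. p k = i} else {k \<in> {i<..j}. p k = i})"
    by (auto simp: le_Suc_eq)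
  then show ?thesis using \<open>i \<le> j\<close> by (simp add: deg_def)
qed

lemma deg_self [simp]: "deg p i i = 1"
  by (simp add: deg_def)

text \<open>Whatever parent a new vertex chooses, it adds \<open>1 + \<alpha>\<close> for itself and
  1 for that parent, so the total weight is deterministic. This makes the root degree a closed
  process.\<close>

lemma sum_deg_affine:
  assumes "1 \<le> m" "\<And>k. 2 \<le> k \<Longrightarrow> k \<le> m \<Longrightarrow> p k \<in> {1..<k}"
  shows "(\<Sum>v=1..m. real (deg p v m) + \<alpha>) = (2 + \<alpha>) * real m - 1"
  using assms
proof (induction m rule: dec_induct)
  case (step m)
  have IH: "(\<Sum>v=1..m. real (deg p v m) + \<alpha>) = (2 + \<alpha>) * real m - 1"
    by (rule step.IH) (use step.prems in auto)
  have "(\<Sum>v=1..m. real (deg p v (Suc m)) + \<alpha>)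
      = (\<Sum>v=1..m. (real (deg p v m) + \<alpha>) + (if v = p (Suc m) then 1 else 0))"
    by (intro sum.cong refl) (auto simp: deg_Suc)
  also have "\<dots> = (2 + \<alpha>) * real m - 1 + (\<Sum>v=1..m. if v = p (Suc m) then 1 else 0)"
    unfolding sum.distrib IH[unfolded sum.distrib] ..
  also have "(\<Sum>v=1..m. if v = p (Suc m) then 1 else (0::real)) = 1"
    using step.prems[of "Suc m"] step.hyps by (subst sum.delta) auto
  finally show ?case by (simp add: algebra_simps)
qed simp

lemma pick_mem: "1 \<le> m \<Longrightarrow> pick w m u \<in> {1..m}"
proof (cases "\<exists>v\<in>{1..m}. u * (\<Sum>k=1..m. w k) < (\<Sum>k=1..v. w k)")
  case True
  then obtain v where "v \<in> {1..m} \<and> u * (\<Sum>k=1..m. w k) < (\<Sum>k=1..v. w k)" by blast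
  from LeastI[of "\<lambda>v. v \<in> {1..m} \<and> u * (\<Sum>k=1..m. w k) < (\<Sum>k=1..v. w k)", OF this]
  show ?thesis using True by (simp add: pick_def)
next
  case False
  then show "1 \<le> m \<Longrightarrow> ?thesis" by (simp add: pick_def)
qed

text \<open>Inverse transform sampling tests vertex 1 first, so only the total of the other weights
  matters. For m = 1 even the fallback value is the root, hence the separate disjunct.\<close>

lemma pick_eq_1_iff:
  assumes "1 \<le> m"
  shows "pick w m u = 1 \<longleftrightarrow> m = 1 \<or> u * (\<Sum>k=1..m. w k) < w 1"
proof -
  let ?P = "\<lambda>v. v \<in> {1..m} \<and> u * (\<Sum>k=1..m. w k) < (\<Sum>k=1..v. w k)"
  consider "m = 1" | "m > 1" "?P 1" | "m > 1" "\<not> ?P 1" using assms by linarith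
  then show ?thesis
  proof cases
    case 1
    then show ?thesis using pick_mem[of m w u] by auto
  next
    case 2
    then have "(LEAST v. ?P v) = 1" by (intro Least_equality) auto
    moreover have "\<exists>v\<in>{1..m}. u * (\<Sum>k=1..m. w k) < (\<Sum>k=1..v. w k)" using 2 by blast
    ultimately show ?thesis using 2 by (simp add: pick_def)
  next
    case 3
    show ?thesis
    proof (cases "\<exists>v. ?P v")
      case True
      then have "?P (LEAST v. ?P v)" by (rule LeastI_ex)
      then have "(LEAST v. ?P v) \<noteq> 1" using 3 by metis
      then show ?thesis using 3 True by (auto simp: pick_def)
    next
      case False
      then have "pick w m u = m" by (auto simp: pick_def)
      then show ?thesis using 3 by auto
    qed
  qed
qed

lemma floor_plus_ge_1: "1 \<le> floor_plus x"
  by (simp add: floor_plus_def)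

lemma floor_plus_le: "x \<le> real n \<Longrightarrow> 1 \<le> n \<Longrightarrow> floor_plus x \<le> n"
  by (simp add: floor_plus_def floor_le_iff nat_le_iff)

lemma dat_parent_mem:
  assumes "\<And>k. 0 \<le> \<xi> k" "2 \<le> k" "k \<le> n"
  shows "dat_parent f \<beta> \<xi> U n k \<in> {1..<k}"
proof -
  obtain j where j: "k = Suc j" "1 \<le> j" using assms(2) by (cases k) auto
  have "floor_plus (real j - real j powr \<beta> * \<xi> (Suc j)) \<le> j"
    using assms(1) j by (intro floor_plus_le) auto
  moreover have "dat_parent f \<beta> \<xi> U n k = dat_parent f \<beta> \<xi> U (Suc j) (Suc j)"
    using dat_parent_stable[of k "Suc j" n f] assms j by simp
  ultimately show ?thesis
    using j pick_mem[OF floor_plus_ge_1, of "\<lambda>v. f (deg (dat_parent f \<beta> \<xi> U j) v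
        (floor_plus (real j - real j powr \<beta> * \<xi> (Suc j))))" "real j - real j powr \<beta> * \<xi> (Suc j)" "U (Suc j)"]
    by (auto simp: Let_def)
qed

section \<open>Measurability of the tree process\<close>

lemma measurable_dat_parent:
  fixes \<mu> :: "real measure" and f :: "nat \<Rightarrow> real"
  assumes [measurable_cong]: "sets \<mu> = sets borel"
  shows "(\<lambda>\<omega>. dat_parent f \<beta> (\<lambda>k. fst (\<omega> k)) (\<lambda>k. snd (\<omega> k)) n k)
    \<in> measurable (dat_space \<mu>) (count_space UNIV)"
proof (induction n arbitrary: k)
  case (Suc n)
  have sp: "(\<lambda>\<omega>. \<omega> i) \<in> measurable (dat_space \<mu>) (\<mu> \<Otimes>\<^sub>M uniform_measure lborel {0..1::real})" for i
    unfolding dat_space_def by measurable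
  have [measurable]: "(\<lambda>\<omega>. fst (\<omega> i)) \<in> borel_measurable (dat_space \<mu>)" for i
    using measurable_compose[OF sp measurable_fst] assms by (simp cong: measurable_cong_sets)
  have [measurable]: "(\<lambda>\<omega>. snd (\<omega> i)) \<in> borel_measurable (dat_space \<mu>)" for i
    using measurable_compose[OF sp measurable_snd] assms by (simp cong: measurable_cong_sets)
  note [measurable] = Suc.IH
  have [measurable]: "(\<lambda>\<omega>. deg (dat_parent f \<beta> (\<lambda>k. fst (\<omega> k)) (\<lambda>k. snd (\<omega> k)) n) i j)
     \<in> measurable (dat_space \<mu>) (count_space UNIV)" for i j
    unfolding deg_def by measurable
  have [measurable]: "(\<lambda>\<omega>. floor_plus (real n - real n powr \<beta> * fst (\<omega> (Suc n))))
     \<in> measurable (dat_space \<mu>) (count_space UNIV)"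
    unfolding floor_plus_def by measurable
  have [measurable]: "(\<lambda>\<omega>. pick (\<lambda>v. f (deg (dat_parent f \<beta> (\<lambda>k. fst (\<omega> k)) (\<lambda>k. snd (\<omega> k)) n) v m)) m (snd (\<omega> (Suc n))))
     \<in> measurable (dat_space \<mu>) (count_space UNIV)" for m
    unfolding pick_def by measurable
  \<comment> \<open>The look-back time is random but integer valued: measurability for each fixed m,
    shown just above, is combined over countably many m.\<close>
  have [measurable]: "(\<lambda>\<omega>. pick (\<lambda>v. f (deg (dat_parent f \<beta> (\<lambda>k. fst (\<omega> k)) (\<lambda>k. snd (\<omega> k)) n) v
        (floor_plus (real n - real n powr \<beta> * fst (\<omega> (Suc n))))))
        (floor_plus (real n - real n powr \<beta> * fst (\<omega> (Suc n)))) (snd (\<omega> (Suc n))))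
     \<in> measurable (dat_space \<mu>) (count_space UNIV)"
    by (rule measurable_compose_countable[where g = "\<lambda>\<omega>. floor_plus (real n - real n powr \<beta> * fst (\<omega> (Suc n)))"
      and f = "\<lambda>m \<omega>. pick (\<lambda>v. f (deg (dat_parent f \<beta> (\<lambda>k. fst (\<omega> k)) (\<lambda>k. snd (\<omega> k)) n) v m)) m (snd (\<omega> (Suc n)))"]) measurable
  show ?case
  proof (cases "k = Suc n")
    case True
    then show ?thesis by (cases "n < 2"; cases "n = 1") (simp_all add: Let_def)
  next
    case False
    then show ?thesis by (cases "n < 2"; cases "n = 1") (simp_all add: Let_def)
  qed
qed simp

lemma measurable_root_deg:
  fixes \<mu> :: "real measure" and f :: "nat \<Rightarrow> real"
  assumes "sets \<mu> = sets borel"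
  shows "root_deg f \<beta> n \<in> measurable (dat_space \<mu>) (count_space UNIV)"
proof -
  note [measurable] = measurable_dat_parent[OF assms]
  show ?thesis unfolding root_deg_def deg_def by measurable
qed

text \<open>Overwriting coordinate i by an independent draw leaves the product law unchanged. The
  inner integral is the conditional expectation given all other coordinates and serves in its place
  throughout.\<close>

lemma integral_PiM_fresh_coordinate:
  fixes F :: "('i \<Rightarrow> 'a) \<Rightarrow> real"
  assumes K: "prob_space K" and F: "F \<in> borel_measurable (PiM UNIV (\<lambda>_. K))"
    and bdd: "\<And>w. \<bar>F w\<bar> \<le> B"
  shows "(\<integral>w. F w \<partial>PiM UNIV (\<lambda>_. K)) = (\<integral>w. (\<integral>z. F (w(i := z)) \<partial>K) \<partial>PiM UNIV (\<lambda>_. K))"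
proof -
  let ?M = "PiM UNIV (\<lambda>_::'i. K)"
  interpret K: prob_space K by fact
  interpret M: prob_space ?M by (intro prob_space_PiM) (rule K)
  interpret P: pair_prob_space K ?M ..
  have upd: "(\<lambda>(x, X). X(i := x)) \<in> measurable (K \<Otimes>\<^sub>M ?M) ?M"
    by (rule measurable_split_conv[THEN iffD2], rule measurable_fun_upd[where J = UNIV]) measurable
  have "integral\<^sup>L ?M F = integral\<^sup>L (distr (K \<Otimes>\<^sub>M ?M) ?M (\<lambda>(x, X). X(i := x))) F"
    using distr_pair_PiM_eq_PiM[of UNIV "\<lambda>_. K" i] K by simp
  also have "\<dots> = (\<integral>zw. F ((snd zw)(i := fst zw)) \<partial>(K \<Otimes>\<^sub>M ?M))"
    by (subst integral_distr[OF upd F]) (simp add: case_prod_unfold)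
  also have "\<dots> = integral\<^sup>L (K \<Otimes>\<^sub>M ?M) (case_prod (\<lambda>z w. F (w(i := z))))"
    by (simp add: case_prod_unfold)
  also have "\<dots> = (\<integral>w. (\<integral>z. F (w(i := z)) \<partial>K) \<partial>?M)"
  proof (rule P.integral_snd[symmetric])
    have "(\<lambda>zw. F ((snd zw)(i := fst zw))) \<in> borel_measurable (K \<Otimes>\<^sub>M ?M)"
      using measurable_compose[OF upd F] by (simp add: case_prod_unfold)
    then show "integrable (K \<Otimes>\<^sub>M ?M) (case_prod (\<lambda>z w. F (w(i := z))))"
      using bdd by (intro P.integrable_const_bound[where B = B]) (auto simp: case_prod_unfold)
  qed
  finally show ?thesis .
qed

section \<open>Functions of a fresh coordinate\<close>

text \<open>The factor \<open>G\<close> does not see coordinate i, so it leaves the inner integral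
  and only the conditional mean \<open>P\<close> of \<open>D\<close> survives.\<close>

lemma integral_PiM_fresh_mult:
  fixes D G :: "('i \<Rightarrow> 'a) \<Rightarrow> real"
  assumes K: "prob_space K"
    and meas [measurable]: "D \<in> borel_measurable (PiM UNIV (\<lambda>_. K))" "G \<in> borel_measurable (PiM UNIV (\<lambda>_. K))"
    and bdd: "\<And>w. \<bar>D w\<bar> \<le> B" "\<And>w. \<bar>G w\<bar> \<le> C"
    and G: "\<And>w z. G (w(i := z)) = G w"
    and P: "\<And>w. (\<integral>z. D (w(i := z)) \<partial>K) = P w"
  shows "(\<integral>w. D w * G w \<partial>PiM UNIV (\<lambda>_. K)) = (\<integral>w. P w * G w \<partial>PiM UNIV (\<lambda>_. K))"
proof -
  have "\<bar>D w * G w\<bar> \<le> B * C" for w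
    using bdd[of w] by (simp add: abs_mult mult_mono)
  then have "(\<integral>w. D w * G w \<partial>PiM UNIV (\<lambda>_. K))
      = (\<integral>w. (\<integral>z. D (w(i := z)) * G w \<partial>K) \<partial>PiM UNIV (\<lambda>_. K))"
    by (subst integral_PiM_fresh_coordinate[OF K, where i = i]) (auto simp: G)
  then show ?thesis by (simp add: P)
qed

text \<open>Orthogonality of martingale differences: for j < k the earlier factor ignores coordinate
  \<open>Suc k\<close>, over which \<open>D k\<close> has mean zero, so every mixed product
  integrates to zero. It is applied to \<open>d\<close> and to the centred forced
  attachments.\<close>

lemma integral_square_sum_fresh:
  fixes D :: "nat \<Rightarrow> (nat \<Rightarrow> 'a) \<Rightarrow> real"
  assumes K: "prob_space K"
    and meas [measurable]: "\<And>k. D k \<in> borel_measurable (PiM UNIV (\<lambda>_. K))"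
    and bdd: "\<And>k w. k \<in> A \<Longrightarrow> \<bar>D k w\<bar> \<le> B k"
    and past: "\<And>j k w z. j \<in> A \<Longrightarrow> k \<in> A \<Longrightarrow> j < k \<Longrightarrow> D j (w(Suc k := z)) = D j w"
    and mean0: "\<And>k w. k \<in> A \<Longrightarrow> (\<integral>z. D k (w(Suc k := z)) \<partial>K) = 0"
    and A: "finite A"
  shows "(\<integral>w. (\<Sum>k\<in>A. c k * D k w)\<^sup>2 \<partial>PiM UNIV (\<lambda>_. K)) = (\<Sum>k\<in>A. (c k)\<^sup>2 * (\<integral>w. (D k w)\<^sup>2 \<partial>PiM UNIV (\<lambda>_. K)))"
proof -
  let ?M = "PiM UNIV (\<lambda>_::nat. K)"
  interpret M: prob_space ?M by (intro prob_space_PiM) (rule K)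
  have int: "integrable ?M (\<lambda>w. D j w * D k w)" if "j \<in> A" "k \<in> A" for j k
    using bdd[OF that(1)] bdd[OF that(2)]
    by (intro M.integrable_const_bound[where B = "B j * B k"])
       (auto simp: abs_mult intro!: AE_I2 mult_mono order_trans[OF abs_ge_zero])
  have orth_less: "(\<integral>w. D k w * D j w \<partial>?M) = 0" if "j < k" "j \<in> A" "k \<in> A" for j k
    using integral_PiM_fresh_mult[OF K meas[of k] meas[of j] bdd[OF that(3)] bdd[OF that(2)] past[OF that(2,3,1)] mean0[OF that(3)]]
    by simp
  have orth: "(\<integral>w. D j w * D k w \<partial>?M) = (if j = k then (\<integral>w. (D k w)\<^sup>2 \<partial>?M) else 0)"
    if "j \<in> A" "k \<in> A" for j k
    using orth_less[of j k] orth_less[of k j] that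
    by (cases j k rule: linorder_cases) (auto simp: mult.commute power2_eq_square)
  have "(\<integral>w. (\<Sum>k\<in>A. c k * D k w)\<^sup>2 \<partial>?M) = (\<integral>w. (\<Sum>j\<in>A. \<Sum>k\<in>A. (c j * c k) * (D j w * D k w)) \<partial>?M)"
    by (simp add: power2_eq_square sum_product mult_ac)
  also have "\<dots> = (\<Sum>j\<in>A. \<Sum>k\<in>A. (c j * c k) * (\<integral>w. D j w * D k w \<partial>?M))"
    using int by (subst Bochner_Integration.integral_sum, force)+
      (simp add: Bochner_Integration.integral_sum int)
  also have "\<dots> = (\<Sum>j\<in>A. \<Sum>k\<in>A. if j = k then (c k)\<^sup>2 * (\<integral>w. (D k w)\<^sup>2 \<partial>?M) else 0)"
    by (intro sum.cong refl) (auto simp: orth power2_eq_square[of "c _"])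
  also have "\<dots> = (\<Sum>k\<in>A. (c k)\<^sup>2 * (\<integral>w. (D k w)\<^sup>2 \<partial>?M))"
    using A by (intro sum.cong refl) (simp add: sum.delta)
  finally show ?thesis .
qed

section \<open>The root degree as a process of its own\<close>

locale delayed_attachment =
  fixes \<alpha> \<beta> :: real and \<mu> :: "real measure"
  assumes beta: "0 \<le> \<beta>" "\<beta> < 1"
    and alpha: "\<alpha> > -1"
    and mu_prob: "prob_space \<mu>"
    and mu_sets [measurable_cong]: "sets \<mu> = sets borel"
    and mu_nonneg: "measure \<mu> {0..} = 1"
begin

definition \<theta> :: real where "\<theta> = 1 / (2 + \<alpha>)"

definition wt :: "nat \<Rightarrow> real" where "wt j = (2 + \<alpha>) * real j - 1"

definition att :: "nat \<Rightarrow> real \<Rightarrow> nat" where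
  "att n x = min n (floor_plus (real n - real n powr \<beta> * x))"

text \<open>Only the root degree has to be tracked, because the total weight of \<open>T(m)\<close> is always \<open>wt m\<close>.
  Clipping the attachment time at \<open>n\<close> makes the recursion well founded; it has no effect on
  nonnegative delays.\<close>

function rdeg :: "nat \<Rightarrow> (nat \<Rightarrow> real \<times> real) \<Rightarrow> nat" where
  "rdeg 0 \<omega> = 0"
| "rdeg (Suc n) \<omega> = (if n = 0 then 1 else
     rdeg n \<omega> + (let m = att n (fst (\<omega> (Suc n))) in
       if m = 1 \<or> snd (\<omega> (Suc n)) * wt m < real (rdeg m \<omega>) + \<alpha> then 1 else 0))"
  by pat_completeness auto
termination by (relation "Wellfounded.measure fst") (auto simp: att_def)

declare rdeg.simps [simp del]

definition N :: "nat \<Rightarrow> (nat \<Rightarrow> real \<times> real) \<Rightarrow> real" where "N n \<omega> = real (rdeg n \<omega>) + \<alpha>"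

definition hit :: "nat \<Rightarrow> (nat \<Rightarrow> real \<times> real) \<Rightarrow> real \<times> real \<Rightarrow> real" where
  "hit n \<omega> z = (let m = att n (fst z) in if m = 1 \<or> snd z * wt m < N m \<omega> then 1 else 0)"

definition pr :: "nat \<Rightarrow> nat \<Rightarrow> real" where "pr n j = measure \<mu> {x. att n x = j}"

text \<open>Conditional probability, given the past, that vertex n + 1 attaches to the root. The
  forced case j = 1 fits the formula because both \<open>N 1\<close> and \<open>wt 1\<close> equal
  \<open>1 + \<alpha>\<close>.\<close>

definition p :: "nat \<Rightarrow> (nat \<Rightarrow> real \<times> real) \<Rightarrow> real" where
  "p n \<omega> = (\<Sum>j=1..n. pr n j * (N j \<omega> / wt j))"

text \<open>Martingale difference of the root degree; it reads coordinate \<open>Suc n\<close>,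
  where the delay and the uniform variable of vertex n + 1 are stored.\<close>

definition d :: "nat \<Rightarrow> (nat \<Rightarrow> real \<times> real) \<Rightarrow> real" where
  "d n \<omega> = hit n \<omega> (\<omega> (Suc n)) - p n \<omega>"

abbreviation K :: "(real \<times> real) measure" where
  "K \<equiv> \<mu> \<Otimes>\<^sub>M uniform_measure lborel {0..1::real}"

abbreviation M :: "(nat \<Rightarrow> real \<times> real) measure" where "M \<equiv> dat_space \<mu>"

lemma M_def: "M = PiM UNIV (\<lambda>_. K)" by (simp add: dat_space_def)

lemma theta_pos: "0 < \<theta>" and theta_less_1: "\<theta> < 1" and wt_theta: "wt j = (real j - \<theta>) / \<theta>"
  using alpha by (auto simp: \<theta>_def wt_def field_simps)

lemma wt_ge: "1 \<le> j \<Longrightarrow> (1 + \<alpha>) * real j \<le> wt j"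
  by (simp add: wt_def algebra_simps)

lemma wt_pos: "1 \<le> j \<Longrightarrow> 0 < wt j"
  using wt_ge[of j] alpha by (smt (verit) mult_pos_pos of_nat_1 of_nat_mono)

lemma att_le: "att n x \<le> n" by (simp add: att_def)

lemma att_ge: "1 \<le> n \<Longrightarrow> 1 \<le> att n x" using floor_plus_ge_1 by (simp add: att_def)

lemma rdeg_1: "rdeg (Suc 0) \<omega> = 1" by (simp add: rdeg.simps)

lemma N_1: "N (Suc 0) \<omega> = 1 + \<alpha>" by (simp add: N_def rdeg_1)

lemma N_Suc: "1 \<le> n \<Longrightarrow> N (Suc n) \<omega> = N n \<omega> + hit n \<omega> (\<omega> (Suc n))"
  by (simp add: N_def hit_def rdeg.simps Let_def)

lemma hit_bounds: "0 \<le> hit n \<omega> z" "hit n \<omega> z \<le> 1"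
  by (auto simp: hit_def Let_def)

lemma N_Suc_ge: "N n \<omega> \<le> N (Suc n) \<omega>"
  by (cases n) (auto simp: N_def rdeg.simps)

lemma N_mono: "m \<le> n \<Longrightarrow> N m \<omega> \<le> N n \<omega>"
  using N_Suc_ge by (rule lift_Suc_mono_le[of "\<lambda>n. N n \<omega>"])

lemma N_pos: "1 \<le> n \<Longrightarrow> 0 < N n \<omega>"
  using N_mono[of 1 n \<omega>] N_1 alpha by simp

lemma N_le: "1 \<le> n \<Longrightarrow> N n \<omega> \<le> real n + \<alpha>"
proof (induction n rule: dec_induct)
  case (step n)
  then show ?case using N_Suc[of n \<omega>] hit_bounds[of n \<omega> "\<omega> (Suc n)"] by auto
qed (simp add: N_1)

lemma N_le_wt: "1 \<le> n \<Longrightarrow> N n \<omega> \<le> wt n"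
proof -
  assume n: "1 \<le> n"
  have "0 \<le> (1 + \<alpha>) * (real n - 1)" using alpha n by simp
  then show ?thesis using N_le[OF n, of \<omega>] by (simp add: wt_def algebra_simps)
qed

text \<open>Adaptedness in coordinate form: the root degree at time n reads only coordinates up to
  n, because look-back times never exceed the current time.\<close>

lemma rdeg_update: "n < i \<Longrightarrow> rdeg n (w(i := z)) = rdeg n w"
proof (induction n w rule: rdeg.induct)
  case (2 n w)
  then have "rdeg (att n (fst (w (Suc n)))) (w(i := z)) = rdeg (att n (fst (w (Suc n)))) w" if "n \<noteq> 0"
    using att_le[of n "fst (w (Suc n))"] that by (intro "2.IH"(2)[OF that refl]) auto
  moreover have "rdeg n (w(i := z)) = rdeg n w" if "n \<noteq> 0"
    by (intro "2.IH"(1)) (use that 2(3) in auto)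
  moreover have "(w(i := z)) (Suc n) = w (Suc n)" using 2(3) by simp
  ultimately show ?case by (cases "n = 0") (simp_all only: rdeg.simps(2) Let_def simp_thms if_True if_False)
qed (simp add: rdeg.simps)

lemma N_update: "n < i \<Longrightarrow> N n (w(i := z)) = N n w"
  by (simp add: N_def rdeg_update)

lemma p_update: "n < i \<Longrightarrow> p n (w(i := z)) = p n w"
  by (simp add: p_def N_update)

lemma hit_update: "1 \<le> n \<Longrightarrow> n < i \<Longrightarrow> hit n (w(i := z)) y = hit n w y"
  using att_le[of n "fst y"] by (simp add: hit_def Let_def N_update)

lemma d_update: "1 \<le> n \<Longrightarrow> Suc n < i \<Longrightarrow> d n (w(i := z)) = d n w"
  by (simp add: d_def hit_update p_update)

section \<open>Probability space and measurability\<close>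

lemma prob_space_uniform: "prob_space (uniform_measure lborel {0..1::real})"
  by (rule prob_space_uniform_measure) auto

lemma prob_space_K: "prob_space K"
proof -
  interpret \<mu>: prob_space \<mu> by (rule mu_prob)
  interpret U: prob_space "uniform_measure lborel {0..1::real}" by (rule prob_space_uniform)
  interpret pair_prob_space \<mu> "uniform_measure lborel {0..1::real}" ..
  show ?thesis by unfold_locales
qed

lemma prob_space_M: "prob_space M"
  unfolding M_def by (intro prob_space_PiM prob_space_K)

lemma measurable_component: "(\<lambda>\<omega>. \<omega> i) \<in> measurable M K"
  unfolding M_def by measurable

lemma measurable_fst_component [measurable]: "(\<lambda>\<omega>. fst (\<omega> i)) \<in> borel_measurable M"
  using measurable_compose[OF measurable_component measurable_fst] mu_sets by (simp cong: measurable_cong_sets)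

lemma measurable_snd_component [measurable]: "(\<lambda>\<omega>. snd (\<omega> i)) \<in> borel_measurable M"
  using measurable_compose[OF measurable_component measurable_snd] by (simp cong: measurable_cong_sets)

lemma measurable_att [measurable]: "att n \<in> measurable borel (count_space UNIV)"
  unfolding att_def floor_plus_def by measurable

lemma measurable_wt [measurable]: "wt \<in> borel_measurable (count_space UNIV)"
  by simp

lemma measurable_rdeg [measurable]: "rdeg n \<in> measurable M (count_space UNIV)"
proof (induction n rule: less_induct)
  case (less n)
  show ?case
  proof (cases n)
    case 0
    then show ?thesis by (simp add: rdeg.simps cong: measurable_cong)
  next
    case (Suc k)
    have [measurable]: "rdeg j \<in> measurable M (count_space UNIV)" if "j \<le> k" for j
      using less that Suc by auto
    \<comment> \<open>The induction hypothesis covers only times below n; \<open>min k j\<close>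
      keeps every member of the countable family in that range, and \<open>att_le\<close> removes
      the minimum afterwards.\<close>
    have *: "(\<lambda>\<omega>. rdeg (min k j) \<omega>) \<in> measurable M (count_space UNIV)" for j
      by (rule less) (simp add: Suc)
    have "(\<lambda>\<omega>. rdeg (min k (att k (fst (\<omega> (Suc k))))) \<omega>) \<in> measurable M (count_space UNIV)"
      by (rule measurable_compose_countable[where g = "\<lambda>\<omega>. att k (fst (\<omega> (Suc k)))" and f = "\<lambda>j \<omega>. rdeg (min k j) \<omega>", OF *])
        measurable
    moreover have "min k (att k x) = att k x" for x using att_le[of k x] by simp
    ultimately have [measurable]: "(\<lambda>\<omega>. rdeg (att k (fst (\<omega> (Suc k)))) \<omega>) \<in> measurable M (count_space UNIV)"
      by simp
    have "rdeg n = (\<lambda>\<omega>. if k = 0 then 1 else rdeg k \<omega> + (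
       if att k (fst (\<omega> (Suc k))) = 1 \<or> snd (\<omega> (Suc k)) * wt (att k (fst (\<omega> (Suc k)))) < real (rdeg (att k (fst (\<omega> (Suc k)))) \<omega>) + \<alpha> then 1 else 0))"
      by (auto simp: Suc rdeg.simps(2) Let_def fun_eq_iff)
    also have "\<dots> \<in> measurable M (count_space UNIV)"
    proof (cases "k = 0")
      case False
      have "Measurable.pred M (\<lambda>\<omega>. att k (fst (\<omega> (Suc k))) = 1 \<or> snd (\<omega> (Suc k)) * wt (att k (fst (\<omega> (Suc k)))) < real (rdeg (att k (fst (\<omega> (Suc k)))) \<omega>) + \<alpha>)"
        by (intro pred_intros_logic) measurable
      note [measurable] = this
      define b :: "(nat \<Rightarrow> real \<times> real) \<Rightarrow> nat" where "b \<omega> = (if att k (fst (\<omega> (Suc k))) = 1 \<or> snd (\<omega> (Suc k)) * wt (att k (fst (\<omega> (Suc k)))) < real (rdeg (att k (fst (\<omega> (Suc k)))) \<omega>) + \<alpha> then 1 else 0)" for \<omega>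
      have [measurable]: "b \<in> measurable M (count_space UNIV)"
        unfolding b_def by measurable
      have [measurable]: "rdeg k \<in> measurable M (count_space UNIV)" by (rule less) (simp add: Suc)
      show ?thesis unfolding if_not_P[OF False] b_def[symmetric] by measurable
    qed simp
    finally show ?thesis .
  qed
qed

lemma measurable_N [measurable]: "N n \<in> borel_measurable M"
  unfolding N_def by measurable

lemma measurable_p [measurable]: "p n \<in> borel_measurable M"
  unfolding p_def by measurable

lemma measurable_hit: "1 \<le> n \<Longrightarrow> (\<lambda>\<omega>. hit n \<omega> (\<omega> (Suc n))) \<in> borel_measurable M"
proof -
  assume "1 \<le> n"
  moreover have "(\<lambda>\<omega>. N (Suc n) \<omega> - N n \<omega>) \<in> borel_measurable M" by measurable
  ultimately show ?thesis by (simp add: N_Suc)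
qed

lemma measurable_d: "1 \<le> n \<Longrightarrow> d n \<in> borel_measurable M"
  unfolding d_def using measurable_hit by measurable

section \<open>Conditional attachment probability and moment recursions\<close>

lemma pr_nonneg: "0 \<le> pr n j" by (simp add: pr_def)

lemma sum_pr: "1 \<le> n \<Longrightarrow> (\<Sum>j=1..n. pr n j) = 1"
proof -
  assume n: "1 \<le> n"
  interpret \<mu>: prob_space \<mu> by (rule mu_prob)
  have "(\<Sum>j=1..n. pr n j) = measure \<mu> (\<Union>j\<in>{1..n}. {x. att n x = j})"
    unfolding pr_def
    by (rule \<mu>.finite_measure_finite_Union[symmetric]) (auto simp: disjoint_family_on_def mu_sets)
  also have "(\<Union>j\<in>{1..n}. {x. att n x = j}) = space \<mu>"
    using att_le[of n] att_ge[OF n] sets_eq_imp_space_eq[OF mu_sets] by auto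
  finally show ?thesis by (simp add: \<mu>.prob_space)
qed

lemma p_nonneg: "0 \<le> p n \<omega>"
  unfolding p_def using N_pos wt_pos by (intro sum_nonneg mult_nonneg_nonneg pr_nonneg divide_nonneg_nonneg) (auto intro: less_imp_le)

lemma p_le_1: "1 \<le> n \<Longrightarrow> p n \<omega> \<le> 1"
proof -
  assume n: "1 \<le> n"
  have "p n \<omega> \<le> (\<Sum>j=1..n. pr n j * 1)"
    unfolding p_def using N_le_wt wt_pos by (intro sum_mono mult_left_mono pr_nonneg) auto
  then show ?thesis using sum_pr[OF n] by simp
qed

lemma d_bound: "1 \<le> n \<Longrightarrow> \<bar>d n \<omega>\<bar> \<le> 1"
  using hit_bounds[of n \<omega> "\<omega> (Suc n)"] p_nonneg[of n \<omega>] p_le_1[of n \<omega>] by (auto simp: d_def)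

text \<open>Split by the attachment time j: the delay and the uniform variable are independent, and
  given j the root is hit when the uniform variable lies below \<open>N j w / wt j\<close>, which is
  in [0,1] by \<open>N_le_wt\<close>. For j = 1 the hit is certain and the ratio is 1.\<close>

lemma integral_hit: "1 \<le> n \<Longrightarrow> (\<integral>z. hit n w z \<partial>K) = p n w"
proof -
  assume n: "1 \<le> n"
  let ?U = "uniform_measure lborel {0..1::real}"
  interpret \<mu>: prob_space \<mu> by (rule mu_prob)
  interpret U: prob_space ?U by (rule prob_space_uniform)
  interpret P: pair_prob_space \<mu> ?U ..
  define A where "A j = {x. att n x = j}" for j
  define B where "B j = {u. j = 1 \<or> u * wt j < N j w}" for j
  have sp: "space \<mu> = UNIV" using sets_eq_imp_space_eq[OF mu_sets] by simp
  have int_lessThan: "{0..1} \<inter> {..<c} = {0..<c}" if "c \<le> 1" for c :: real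
    using that by auto
  have B_borel: "B j \<in> sets borel" for j by (simp add: B_def)
  have AB [measurable]: "A j \<in> sets \<mu>" "B j \<in> sets ?U" for j by (auto simp: A_def B_def mu_sets)
  have "measure K (A j \<times> B j) = pr n j * (N j w / wt j)" if j: "j \<in> {1..n}" for j
  proof -
    have w: "0 < wt j" "0 < N j w" "N j w \<le> wt j" using j wt_pos N_pos N_le_wt by auto
    have "measure ?U (B j) = N j w / wt j"
    proof (cases "j = 1")
      case True
      have "measure ?U UNIV = 1" using U.prob_space by simp
      moreover have "N j w / wt j = 1" using True alpha by (simp add: N_1 wt_def)
      moreover have "B j = UNIV" using True by (simp add: B_def)
      ultimately show ?thesis by simp
    next
      case False
      have "B j = {..< N j w / wt j}" using w False by (auto simp: B_def field_simps)
      moreover have "N j w / wt j \<le> 1" using w by simp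
      ultimately have "{0..1} \<inter> B j = {0..< N j w / wt j}"
        by (simp only: int_lessThan)
      moreover have "0 \<le> N j w / wt j" using w by simp
      ultimately show ?thesis by (subst measure_uniform_measure) (simp_all add: measure_uniform_measure B_borel)
    qed
    moreover have "measure K (A j \<times> B j) = measure \<mu> (A j) * measure ?U (B j)"
      by (simp add: measure_def U.emeasure_pair_measure_Times[OF AB] enn2real_mult)
    ultimately show ?thesis by (simp add: pr_def A_def)
  qed
  moreover have "(\<integral>z. hit n w z \<partial>K) = (\<integral>z. (\<Sum>j=1..n. indicator (A j \<times> B j) z) \<partial>K)"
  proof (rule Bochner_Integration.integral_cong)
    fix z
    have "(\<Sum>j=1..n. indicator (A j \<times> B j) z)
       = (\<Sum>j=1..n. if j = att n (fst z) then (indicator (B j) (snd z) :: real) else 0)"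
    proof (rule sum.cong[OF refl])
      fix j
      show "indicator (A j \<times> B j) z = (if j = att n (fst z) then (indicator (B j) (snd z) :: real) else 0)"
        by (cases "att n (fst z) = j") (simp_all only: indicator_times, simp_all add: A_def)
    qed
    also have "\<dots> = indicator (B (att n (fst z))) (snd z)"
      using att_le[of n "fst z"] att_ge[OF n, of "fst z"] by (subst sum.delta) auto
    also have "\<dots> = hit n w z"
      unfolding hit_def Let_def B_def indicator_def mem_Collect_eq of_bool_def ..
    finally show "hit n w z = (\<Sum>j=1..n. indicator (A j \<times> B j) z)" ..
  qed simp
  moreover have "(\<integral>z. (\<Sum>j=1..n. indicator (A j \<times> B j) z) \<partial>K) = (\<Sum>j=1..n. measure K (A j \<times> B j))"
  proof -
    have "A j \<times> B j \<in> sets K" for j by (intro pair_measureI AB)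
    then have "integrable K (indicat_real (A j \<times> B j))" "A j \<times> B j \<inter> space K = A j \<times> B j" for j
      using sets.sets_into_space[of "A j \<times> B j" K] by (auto simp: P.P.emeasure_eq_measure)
    then show ?thesis by (subst Bochner_Integration.integral_sum) auto
  qed
  ultimately show ?thesis by (simp add: p_def)
qed

lemma integral_d_fresh: "1 \<le> n \<Longrightarrow> (\<integral>z. d n (w(Suc n := z)) \<partial>K) = 0"
proof -
  assume n: "1 \<le> n"
  interpret K: prob_space K by (rule prob_space_K)
  have *: "integrable K (hit n w)"
  proof -
    have [measurable]: "(\<lambda>z. att n (fst z)) \<in> measurable K (count_space UNIV)"
      using measurable_compose[OF measurable_fst measurable_att] mu_sets by (simp cong: measurable_cong_sets)
    have "hit n w = (\<lambda>z. if att n (fst z) = 1 \<or> snd z * wt (att n (fst z)) < N (att n (fst z)) w then 1 else 0)"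
      by (auto simp: hit_def Let_def)
    also have "\<dots> \<in> borel_measurable K" by measurable
    finally show ?thesis
      using hit_bounds by (intro K.integrable_const_bound[where B = 1]) auto
  qed
  have "(\<integral>z. d n (w(Suc n := z)) \<partial>K) = (\<integral>z. hit n w z - p n w \<partial>K)"
    using n by (simp add: d_def hit_update p_update)
  also have "\<dots> = 0" using * integral_hit[OF n] by (simp add: K.prob_space)
  finally show ?thesis .
qed

lemma integral_d_mult:
  assumes n: "1 \<le> n" and "G \<in> borel_measurable M" "\<And>w. \<bar>G w\<bar> \<le> C" "\<And>w z. G (w(Suc n := z)) = G w"
  shows "(\<integral>w. d n w * G w \<partial>M) = 0"
  using integral_PiM_fresh_mult[OF prob_space_K measurable_d[OF n, unfolded M_def] assms(2)[unfolded M_def]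
      d_bound[OF n] assms(3,4) integral_d_fresh[OF n]]
  by (simp add: M_def)

lemma integral_square_sum_d:
  assumes "finite A" "A \<subseteq> {1..}"
  shows "(\<integral>w. (\<Sum>k\<in>A. c k * d k w)\<^sup>2 \<partial>M) = (\<Sum>k\<in>A. (c k)\<^sup>2 * (\<integral>w. (d k w)\<^sup>2 \<partial>M))"
proof -
  have A: "1 \<le> k" if "k \<in> A" for k using assms that by auto
  \<comment> \<open>The orthogonality lemma asks for measurability at every index, including k = 0,
    so \<open>d\<close> is replaced by 0 there; on \<open>A\<close> nothing changes.\<close>
  have "(\<integral>w. (\<Sum>k\<in>A. c k * (if 1 \<le> k then d k w else 0))\<^sup>2 \<partial>M)
      = (\<Sum>k\<in>A. (c k)\<^sup>2 * (\<integral>w. (if 1 \<le> k then d k w else 0)\<^sup>2 \<partial>M))"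
    unfolding M_def
  proof (rule integral_square_sum_fresh[OF prob_space_K, where B = "\<lambda>_. 1"])
    show "(\<lambda>w. if 1 \<le> k then d k w else 0) \<in> borel_measurable (PiM UNIV (\<lambda>_. K))" for k
      using measurable_d[of k, unfolded M_def] by (cases "1 \<le> k") auto
  qed (use A assms d_bound d_update integral_d_fresh in auto)
  then show ?thesis using A by simp
qed

lemma integrable_bounded:
  fixes G :: "_ \<Rightarrow> real"
  assumes "G \<in> borel_measurable M" "\<And>w. \<bar>G w\<bar> \<le> C" shows "integrable M G"
proof -
  interpret prob_space M by (rule prob_space_M)
  show ?thesis using assms by (intro integrable_const_bound[where B = C]) auto
qed

lemma abs_N: "1 \<le> n \<Longrightarrow> \<bar>N n w\<bar> \<le> wt n"
  using N_pos[of n w] N_le_wt[of n w] by simp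

lemma abs_p: "1 \<le> n \<Longrightarrow> \<bar>p n w\<bar> \<le> 1"
  using p_nonneg p_le_1 by simp

lemma integrable_N: "1 \<le> n \<Longrightarrow> integrable M (N n)"
  using abs_N by (intro integrable_bounded) auto

lemma integrable_N2: "1 \<le> n \<Longrightarrow> integrable M (\<lambda>w. (N n w)\<^sup>2)"
  using N_pos N_le_wt by (intro integrable_bounded[where C = "(wt n)\<^sup>2"]) (auto intro!: power_mono simp: less_imp_le)

lemma integrable_p: "1 \<le> n \<Longrightarrow> integrable M (p n)"
  using abs_p by (intro integrable_bounded) auto

lemma integrable_N_p: "1 \<le> n \<Longrightarrow> integrable M (\<lambda>w. N n w * p n w)"
proof (rule integrable_bounded[where C = "wt n * 1"])
  show "1 \<le> n \<Longrightarrow> \<bar>N n w * p n w\<bar> \<le> wt n * 1" for w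
    unfolding abs_mult using abs_p[of n w] abs_N[of n w] wt_pos[of n] by (intro mult_mono) auto
qed measurable

lemma integrable_d_mult:
  assumes n: "1 \<le> n" and "G \<in> borel_measurable M" "\<And>w. \<bar>G w\<bar> \<le> C"
  shows "integrable M (\<lambda>w. d n w * G w)"
proof (rule integrable_bounded[where C = "1 * C"])
  show "(\<lambda>w. d n w * G w) \<in> borel_measurable M" using measurable_d[OF n] assms by measurable
  show "\<bar>d n w * G w\<bar> \<le> 1 * C" for w
    using d_bound[OF n, of w] assms(3)[of w] unfolding abs_mult by (intro mult_mono) auto
qed

lemma expectation_N_Suc:
  assumes n: "1 \<le> n"
  shows "(\<integral>w. N (Suc n) w \<partial>M) = (\<integral>w. N n w \<partial>M) + (\<integral>w. p n w \<partial>M)"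
proof -
  have *: "integrable M (d n)" "(\<integral>w. d n w \<partial>M) = 0"
    using integral_d_mult[OF n, of "\<lambda>_. 1" 1] integrable_d_mult[OF n, of "\<lambda>_. 1" 1] by auto
  have "(\<integral>w. N (Suc n) w \<partial>M) = (\<integral>w. N n w + (p n w + d n w) \<partial>M)"
    using n by (simp add: N_Suc d_def)
  also have "\<dots> = (\<integral>w. N n w \<partial>M) + (\<integral>w. p n w \<partial>M)"
    using * integrable_N[OF n] integrable_p[OF n] by simp
  finally show ?thesis .
qed

lemma expectation_p: "(\<integral>w. p n w \<partial>M) = (\<Sum>j=1..n. pr n j * ((\<integral>w. N j w \<partial>M) / wt j))"
  unfolding p_def using integrable_N by (subst Bochner_Integration.integral_sum) auto

lemma hit_square: "(hit n w z)\<^sup>2 = hit n w z"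
  by (auto simp: hit_def Let_def)

text \<open>Since \<open>hit\<close> is 0 or 1 it equals its square, and \<open>hit = p + d\<close>.
  The square of \<open>N + hit\<close> becomes a function of the past plus \<open>d\<close> times a
  function of the past, and the latter has mean zero.\<close>

lemma expectation_N2_Suc:
  assumes n: "1 \<le> n"
  shows "(\<integral>w. (N (Suc n) w)\<^sup>2 \<partial>M) = (\<integral>w. (N n w)\<^sup>2 \<partial>M) + 2 * (\<integral>w. N n w * p n w \<partial>M) + (\<integral>w. p n w \<partial>M)"
proof -
  have *: "integrable M (\<lambda>w. d n w * (2 * N n w + 1))" "(\<integral>w. d n w * (2 * N n w + 1) \<partial>M) = 0"
  proof -
    have b: "\<bar>2 * N n w + 1\<bar> \<le> 2 * wt n + 1" for w using abs_N[OF n, of w] by linarith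
    show "integrable M (\<lambda>w. d n w * (2 * N n w + 1))" by (rule integrable_d_mult[OF n _ b]) measurable
    show "(\<integral>w. d n w * (2 * N n w + 1) \<partial>M) = 0"
      by (rule integral_d_mult[OF n _ b]) (measurable, simp add: N_update)
  qed
  have "(N (Suc n) w)\<^sup>2 = (N n w)\<^sup>2 + (2 * (N n w * p n w) + (p n w + d n w * (2 * N n w + 1)))" for w
  proof -
    have "(N (Suc n) w)\<^sup>2 = (N n w)\<^sup>2 + 2 * N n w * hit n w (w (Suc n)) + (hit n w (w (Suc n)))\<^sup>2"
      using n by (simp add: N_Suc power2_eq_square algebra_simps)
    then show ?thesis unfolding hit_square by (simp add: d_def algebra_simps)
  qed
  then show ?thesis
    using * integrable_N2[OF n] integrable_p[OF n] integrable_N_p[OF n] by simp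
qed

text \<open>The conditional variance of an indicator with conditional mean \<open>p n w\<close> is
  \<open>p n w - (p n w)\<^sup>2\<close>.\<close>

lemma expectation_d2_le:
  assumes n: "1 \<le> n"
  shows "(\<integral>w. (d n w)\<^sup>2 \<partial>M) \<le> (\<integral>w. p n w \<partial>M)"
proof -
  have *: "integrable M (\<lambda>w. d n w * (1 - 2 * p n w))" "(\<integral>w. d n w * (1 - 2 * p n w) \<partial>M) = 0"
  proof -
    have b: "\<bar>1 - 2 * p n w\<bar> \<le> 3" for w using abs_p[OF n, of w] by linarith
    show "integrable M (\<lambda>w. d n w * (1 - 2 * p n w))" by (rule integrable_d_mult[OF n _ b]) measurable
    show "(\<integral>w. d n w * (1 - 2 * p n w) \<partial>M) = 0"
      by (rule integral_d_mult[OF n _ b]) (measurable, simp add: p_update)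
  qed
  have "(d n w)\<^sup>2 \<le> p n w + d n w * (1 - 2 * p n w)" for w
  proof -
    have "(d n w)\<^sup>2 = hit n w (w (Suc n)) - 2 * p n w * hit n w (w (Suc n)) + (p n w)\<^sup>2"
      using hit_square[of n w "w (Suc n)"] by (simp add: d_def power2_eq_square algebra_simps)
    also have "\<dots> = p n w + d n w * (1 - 2 * p n w) - (p n w)\<^sup>2"
      by (simp add: d_def power2_eq_square algebra_simps)
    finally show ?thesis by simp
  qed
  moreover have "integrable M (\<lambda>w. (d n w)\<^sup>2)"
    using integrable_d_mult[OF n measurable_d[OF n] d_bound[OF n]] by (simp add: power2_eq_square)
  ultimately have "(\<integral>w. (d n w)\<^sup>2 \<partial>M) \<le> (\<integral>w. p n w + d n w * (1 - 2 * p n w) \<partial>M)"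
    using * integrable_p[OF n] by (intro integral_mono) auto
  then show ?thesis using * integrable_p[OF n] by simp
qed

text \<open>By induction the tree gives the root weight \<open>N m w\<close> out of the constant
  total \<open>wt m\<close>, so both processes apply the same test to the same uniform variable.
  Nonnegative delays make the clipping in \<open>att\<close> harmless.\<close>

lemma rdeg_eq_root_deg:
  assumes pos: "\<And>k. 0 \<le> fst (w k)"
  shows "root_deg (\<lambda>k. real k + \<alpha>) \<beta> n w = (if n = 0 then 0 else rdeg n w)"
proof (induction n rule: less_induct)
  case (less n)
  let ?P = "dat_parent (\<lambda>k. real k + \<alpha>) \<beta> (\<lambda>k. fst (w k)) (\<lambda>k. snd (w k))"
  consider "n = 0" | "n = 1" | "n = 2" | k where "n = Suc k" "2 \<le> k"
    by (metis One_nat_def Suc_1 less_2_cases not_less_eq_eq old.nat.exhaust linorder_not_le)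
  then show ?case
  proof cases
    case 1 then show ?thesis by (simp add: root_deg_def deg_def)
  next
    case 2 then show ?thesis by (simp add: root_deg_def rdeg_1)
  next
    case 3
    \<comment> \<open>\<open>T(2)\<close> is prescribed rather than sampled; the recursion
      reproduces it because the only attachment time available at n = 1 is 1.\<close>
    have "att (Suc 0) x = Suc 0" for x using att_ge[of 1 x] att_le[of 1 x] by simp
    moreover have "deg (?P 2) 1 2 = 2"
      using deg_Suc[of 1 1 "?P 2"] by (simp add: numeral_2_eq_2)
    ultimately show ?thesis using 3
      by (simp add: root_deg_def numeral_2_eq_2 rdeg.simps(2)[of "Suc 0"] rdeg_1)
  next
    case (4 k)
    define m where "m = floor_plus (real k - real k powr \<beta> * fst (w (Suc k)))"
    have m: "1 \<le> m" "m \<le> k" using 4 pos[of "Suc k"] unfolding m_def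
      by (auto intro!: floor_plus_ge_1[unfolded One_nat_def] floor_plus_le)
    then have att: "att k (fst (w (Suc k))) = m" by (simp add: att_def m_def[symmetric])
    have deg_m: "deg (?P k) 1 m = rdeg m w"
      using less[of m] m 4 deg_dat_parent_stable[of m k] by (simp add: root_deg_def)
    have tot: "(\<Sum>v=1..m. real (deg (?P k) v m) + \<alpha>) = wt m"
      unfolding wt_def using m(1)
    proof (rule sum_deg_affine)
      show "?P k i \<in> {1..<i}" if "2 \<le> i" "i \<le> m" for i
        by (rule dat_parent_mem) (use pos that m in auto)
    qed
    have "?P (Suc k) (Suc k) = pick (\<lambda>v. real (deg (?P k) v m) + \<alpha>) m (snd (w (Suc k)))"
      using 4 by (simp add: Let_def m_def)
    then have "?P (Suc k) (Suc k) = 1 \<longleftrightarrow> m = 1 \<or> snd (w (Suc k)) * wt m < real (rdeg m w) + \<alpha>"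
      using pick_eq_1_iff[OF m(1), of "\<lambda>v. real (deg (?P k) v m) + \<alpha>"] by (simp only: tot deg_m)
    moreover have "root_deg (\<lambda>k. real k + \<alpha>) \<beta> n w
        = rdeg k w + (if ?P (Suc k) (Suc k) = 1 then 1 else 0)"
    proof -
      have "root_deg (\<lambda>k. real k + \<alpha>) \<beta> n w = deg (?P (Suc k)) 1 (Suc k)"
        using 4 by (simp add: root_deg_def)
      also have "\<dots> = deg (?P (Suc k)) 1 k + (if ?P (Suc k) (Suc k) = 1 then 1 else 0)"
        using 4 by (subst deg_Suc) auto
      also have "deg (?P (Suc k)) 1 k = rdeg k w"
        using less[of k] 4 deg_dat_parent_stable[of k "Suc k"] by (simp add: root_deg_def del: dat_parent.simps)
      finally show ?thesis .
    qed
    ultimately show ?thesis using 4 by (simp add: rdeg.simps(2) Let_def att)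
  qed
qed

text \<open>The processes agree on nonnegative delays, and almost surely none of the countably many
  coordinates carries a negative one.\<close>

lemma AE_root_deg: "AE w in M. \<forall>n\<ge>1. root_deg (\<lambda>k. real k + \<alpha>) \<beta> n w = rdeg n w"
proof -
  interpret \<mu>: prob_space \<mu> by (rule mu_prob)
  have "AE x in \<mu>. 0 \<le> x"
    using mu_nonneg \<mu>.AE_prob_1[of "{0..}"] by auto
  then have "AE z in K. 0 \<le> fst z"
  proof -
    interpret U: prob_space "uniform_measure lborel {0..1::real}" by (rule prob_space_uniform)
    interpret P: pair_prob_space \<mu> "uniform_measure lborel {0..1::real}" ..
    assume "AE x in \<mu>. 0 \<le> x"
    moreover have [measurable]: "fst \<in> borel_measurable K"
      using measurable_fst[of \<mu> "uniform_measure lborel {0..1::real}"] mu_sets by (simp cong: measurable_cong_sets)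
    have "{z \<in> space K. 0 \<le> fst z} \<in> sets K" by measurable
    ultimately show ?thesis by (intro P.AE_pair_measure) auto
  qed
  then have "AE w in M. 0 \<le> fst (w k)" for k
    unfolding M_def by (intro AE_PiM_component[where M = "\<lambda>_. K"] prob_space_K) auto
  then have "AE w in M. \<forall>k. 0 \<le> fst (w k)" by (simp add: AE_all_countable)
  then show ?thesis by eventually_elim (simp add: rdeg_eq_root_deg)
qed

end

section \<open>Drift, normalisation and forced attachments\<close>

text \<open>Tangent inequality for the concave function \<open>x powr s\<close>: weighted AM-GM for
  \<open>(n - 1) / n\<close> and 1 with weights s and 1 - s gives
  \<open>((n - 1) / n) powr s \<le> 1 - s / n\<close>.\<close>

lemma powr_diff_ge_derivative:
  fixes s :: real
  assumes "0 < s" "s < 1" "1 \<le> n"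
  shows "real n powr (s - 1) \<le> (real n powr s - (real n - 1) powr s) / s"
proof (cases "n = 1")
  case True
  then show ?thesis using assms by simp
next
  case False
  then have n: "1 < real n" using assms by simp
  have "((real n - 1) / real n) powr s * 1 powr (1 - s) \<le> s * ((real n - 1) / real n) + (1 - s) * 1"
    using assms n by (intro Youngs_inequality_0) auto
  then have "(real n - 1) powr s / real n powr s \<le> 1 - s / real n"
    using n by (simp add: powr_divide field_simps)
  then have "(real n - 1) powr s \<le> (1 - s / real n) * real n powr s"
    using n by (simp add: pos_divide_le_eq)
  also have "\<dots> = real n powr s - s * real n powr (s - 1)"
    using n by (simp add: powr_diff algebra_simps)
  finally show ?thesis using assms by (simp add: field_simps)
qed

text \<open>Comparison with the integral of \<open>x powr (s - 1)\<close> up to z, by telescoping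
  the preceding inequality.\<close>

lemma sum_powr_below_le:
  fixes s z :: real
  assumes "0 < s" "s < 1" "0 \<le> z"
  shows "(\<Sum>n=1..m. if real n < z then real n powr (s - 1) else 0) \<le> z powr s / s"
proof -
  \<comment> \<open>The bound with \<open>min m z\<close> is the inductive one: it grows by the
    tangent inequality while n < z and absorbs a zero term afterwards.\<close>
  have "(\<Sum>n=1..m. if real n < z then real n powr (s - 1) else 0) \<le> min (real m) z powr s / s"
  proof (induction m)
    case (Suc m)
    show ?case
    proof (cases "real (Suc m) < z")
      case True
      then have "(\<Sum>n=1..Suc m. if real n < z then real n powr (s - 1) else 0)
          \<le> real m powr s / s + real (Suc m) powr (s - 1)"
        using Suc.IH by simp
      also have "\<dots> \<le> real (Suc m) powr s / s"
        using powr_diff_ge_derivative[OF assms(1,2), of "Suc m"] by (simp add: diff_divide_distrib)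
      finally show ?thesis using True by simp
    next
      case False
      have "min (real m) z powr s / s \<le> min (real (Suc m)) z powr s / s"
        using assms by (intro divide_right_mono powr_mono2) auto
      then show ?thesis using Suc.IH False by simp
    qed
  qed (use assms in simp)
  also have "\<dots> \<le> z powr s / s"
    using assms by (intro divide_right_mono powr_mono2) auto
  finally show ?thesis .
qed

context delayed_attachment
begin

section \<open>Attachment rate compared with the undelayed rate\<close>

definition q :: "nat \<Rightarrow> real" where "q n = pr n 1"

text \<open>\<open>D n\<close> is the mean relative lag \<open>(n - m) / m\<close> of the attachment time \<open>m\<close> on \<open>m \<ge> 2\<close>, and \<open>C\<close> is
  the constant in \<open>1 / wt m \<le> (1 + C * (n - m) / m) / wt n\<close>.\<close>

definition D :: "nat \<Rightarrow> real" where
  "D n = (\<Sum>j=2..n. pr n j * ((real n - real j) / real j))"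

definition C :: real where "C = (2 + \<alpha>) / (1 + \<alpha>)"

text \<open>Mean growth of the undelayed root weight. As
  \<open>1 + 1 / wt k = k / (k - \<theta>)\<close>, for n \<ge> 1 it is the factorial of n - 1
  divided by \<open>pochhammer (1 - \<theta>) (n - 1)\<close>.\<close>

definition b :: "nat \<Rightarrow> real" where "b n = (\<Prod>k=1..<n. 1 + 1 / wt k)"

lemma q_bounds: "0 \<le> q n" "q n \<le> 1"
proof -
  interpret \<mu>: prob_space \<mu> by (rule mu_prob)
  show "0 \<le> q n" "q n \<le> 1" by (simp_all add: q_def pr_def)
qed

lemma D_nonneg: "0 \<le> D n"
  unfolding D_def by (intro sum_nonneg mult_nonneg_nonneg pr_nonneg) auto

lemma C_pos: "0 < C" using alpha by (simp add: C_def)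

lemma AE_mu_nonneg: "AE x in \<mu>. 0 \<le> x"
proof -
  interpret \<mu>: prob_space \<mu> by (rule mu_prob)
  show ?thesis using mu_nonneg \<mu>.AE_prob_1[of "{0..}"] by auto
qed

lemma sum_pr_mult:
  assumes "finite J"
  shows "integrable \<mu> (\<lambda>x. \<Sum>j\<in>J. c j * indicator {x. att n x = j} x)"
    and "(\<integral>x. (\<Sum>j\<in>J. c j * indicator {x. att n x = j} x) \<partial>\<mu>) = (\<Sum>j\<in>J. pr n j * c j)"
proof -
  interpret \<mu>: prob_space \<mu> by (rule mu_prob)
  have A: "{x. att n x = j} \<in> sets \<mu>" for j by (simp add: mu_sets)
  have "space \<mu> = UNIV" using sets_eq_imp_space_eq[OF mu_sets] by simp
  then show "(\<integral>x. (\<Sum>j\<in>J. c j * indicator {x. att n x = j} x) \<partial>\<mu>) = (\<Sum>j\<in>J. pr n j * c j)"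
    by (subst Bochner_Integration.integral_sum) (auto simp: A pr_def mult.commute \<mu>.emeasure_eq_measure)
  show "integrable \<mu> (\<lambda>x. \<Sum>j\<in>J. c j * indicator {x. att n x = j} x)"
    by (auto simp: A \<mu>.emeasure_eq_measure)
qed

text \<open>Taking the floor costs at most one unit:
  \<open>n - m \<le> n powr \<beta> * x + 1\<close>. The lag reduced by one is thus bounded
  pointwise by the integrand of the delay quantity, and the price of the missing unit, the mean of 1
  / m on m \<ge> 2, is absorbed into \<open>D n\<close> itself.\<close>

lemma D_le_delay:
  assumes n: "2 \<le> n"
  shows "D n \<le> 2 * delay_quantity \<mu> \<beta> n + 2 / real n"
proof -
  interpret \<mu>: prob_space \<mu> by (rule mu_prob)
  define g where "g x = (if real n - real n powr \<beta> * x \<ge> 1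
        then real n powr \<beta> * x / real (floor_plus (real n - real n powr \<beta> * x)) else 0)" for x
  define h where "h x = (\<Sum>j=2..n. ((real n - 1 - real j) / real j) * indicator {x. att n x = j} x)" for x
  have [measurable]: "g \<in> borel_measurable borel"
    unfolding g_def floor_plus_def by measurable
  have fp: "1 \<le> real (floor_plus y)" "0 < real (floor_plus y)" for y using floor_plus_ge_1[of y] by auto
  have g_bounds: "0 \<le> g x" "g x \<le> real n" if "0 \<le> x" for x
  proof -
    show "0 \<le> g x" using that by (simp add: g_def)
    have "real n powr \<beta> * x / real (floor_plus (real n - real n powr \<beta> * x)) \<le> real n powr \<beta> * x / 1"
      using that by (intro divide_left_mono fp mult_pos_pos zero_less_one) auto
    then show "g x \<le> real n" by (auto simp: g_def)
  qed
  have "integrable \<mu> g"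
    using AE_mu_nonneg g_bounds
    by (intro \<mu>.integrable_const_bound[where B = "real n"]) (auto simp: mu_sets cong: measurable_cong_sets)
  moreover have "AE x in \<mu>. h x \<le> g x"
    using AE_mu_nonneg
  proof eventually_elim
    case (elim x)
    define y where "y = real n - real n powr \<beta> * x"
    have fy: "floor_plus y \<le> n" using elim n by (intro floor_plus_le) (auto simp: y_def)
    then have att: "att n x = floor_plus y" by (simp add: att_def y_def)
    have h: "h x = (if 2 \<le> att n x then (real n - 1 - real (att n x)) / real (att n x) else 0)"
    proof -
      have "h x = (\<Sum>j=2..n. if j = att n x then (real n - 1 - real j) / real j else 0)"
        unfolding h_def by (intro sum.cong) auto
      then show ?thesis using att_le[of n x] by (simp add: sum.delta)
    qed
    show ?case
    proof (cases "2 \<le> att n x")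
      case True
      then have "2 \<le> \<lfloor>y\<rfloor>" "real (floor_plus y) = of_int \<lfloor>y\<rfloor>" unfolding att by (unfold floor_plus_def, linarith+)
      then have "1 \<le> y" "y < real (floor_plus y) + 1" by linarith+
      then have "real n - 1 - real (att n x) \<le> real n powr \<beta> * x" by (simp add: att y_def)
      then show ?thesis using \<open>1 \<le> y\<close> True
        by (simp add: h g_def y_def[symmetric] att divide_right_mono)
    next
      case False
      then show ?thesis using g_bounds(1)[OF elim] by (simp add: h)
    qed
  qed
  ultimately have "integral\<^sup>L \<mu> h \<le> integral\<^sup>L \<mu> g"
    unfolding h_def by (intro integral_mono_AE sum_pr_mult) auto
  then have 1: "(\<Sum>j=2..n. pr n j * ((real n - 1 - real j) / real j)) \<le> delay_quantity \<mu> \<beta> n"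
    unfolding h_def g_def delay_quantity_def by (subst (asm) sum_pr_mult) auto
  define E where "E = (\<Sum>j=2..n. pr n j * (1 / real j))"
  have "D n = (\<Sum>j=2..n. pr n j * ((real n - 1 - real j) / real j)) + E"
    unfolding D_def E_def sum.distrib[symmetric]
    by (intro sum.cong refl) (auto simp: field_simps)
  with 1 have 2: "D n \<le> delay_quantity \<mu> \<beta> n + E" by simp
  \<comment> \<open>Uses \<open>1 / j = (1 + (n - j) / j) / n\<close>, which turns the remainder
    into at most 1 / n plus a fraction of \<open>D n\<close>.\<close>
  have "E = (\<Sum>j=2..n. pr n j * (1 / real n) + pr n j * ((real n - real j) / real j) / real n)"
    unfolding E_def using n by (intro sum.cong refl) (auto simp: field_simps)
  also have "\<dots> = (\<Sum>j=2..n. pr n j) / real n + D n / real n"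
    by (simp add: sum.distrib D_def sum_divide_distrib)
  also have "(\<Sum>j=2..n. pr n j) \<le> (\<Sum>j=1..n. pr n j)"
    by (intro sum_mono2) (auto simp: pr_nonneg)
  finally have "E \<le> 1 / real n + D n / real n"
    using n sum_pr[of n] by (simp add: divide_right_mono)
  \<comment> \<open>With n \<ge> 2 at most half of \<open>D n\<close> returns on the right; moving
    it to the left produces the two factors 2.\<close>
  moreover have "D n / real n \<le> D n / 2"
    using n D_nonneg by (intro divide_left_mono) auto
  ultimately show ?thesis using 2 by (simp add: field_simps)
qed

text \<open>For j \<ge> 2 the numerator grows to \<open>N n w\<close> by monotonicity, and changing
  the denominator costs the factor with constant \<open>C\<close>. The term j = 1 is kept as
  \<open>q n\<close>, since its lag n - 1 is not controlled by the delay quantity.\<close>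

lemma p_le:
  assumes n: "1 \<le> n"
  shows "p n w \<le> N n w / wt n * (1 + C * D n) + q n"
proof -
  have term_le: "N j w / wt j \<le> N n w / wt n * (1 + C * ((real n - real j) / real j))"
    if j: "2 \<le> j" "j \<le> n" for j
  proof -
    have w: "0 < wt j" "0 < wt n" "(1 + \<alpha>) * real j \<le> wt j" using j wt_pos wt_ge by auto
    have "0 < (1 + \<alpha>) * real j" using alpha j by simp
    moreover have "wt n - wt j = (2 + \<alpha>) * (real n - real j)" by (simp add: wt_def algebra_simps)
    moreover have "0 \<le> (2 + \<alpha>) * (real n - real j)" using alpha j by simp
    ultimately have "(wt n - wt j) / wt j \<le> (2 + \<alpha>) * (real n - real j) / ((1 + \<alpha>) * real j)"
      using w alpha j by (simp only:) (intro divide_left_mono mult_pos_pos; simp)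
    also have "\<dots> = C * ((real n - real j) / real j)" by (simp add: C_def)
    finally have *: "(wt n - wt j) / wt j \<le> C * ((real n - real j) / real j)" .
    have "N j w / wt j \<le> N n w / wt j"
      using N_mono[OF j(2)] w by (simp add: divide_right_mono)
    also have "\<dots> = N n w / wt n * (1 + (wt n - wt j) / wt j)"
      using w by (simp add: field_simps)
    also have "\<dots> \<le> N n w / wt n * (1 + C * ((real n - real j) / real j))"
      using N_pos[OF n, of w] w * by (intro mult_left_mono add_left_mono) auto
    finally show ?thesis .
  qed
  have "p n w = q n * (N 1 w / wt 1) + (\<Sum>j=2..n. pr n j * (N j w / wt j))"
    unfolding p_def q_def using n by (subst sum.atLeast_Suc_atMost) (auto simp: numeral_2_eq_2)
  also have "N 1 w / wt 1 = 1" using alpha by (simp add: N_1 wt_def)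
  also have "(\<Sum>j=2..n. pr n j * (N j w / wt j))
      \<le> (\<Sum>j=2..n. pr n j * (N n w / wt n * (1 + C * ((real n - real j) / real j))))"
    by (intro sum_mono mult_left_mono pr_nonneg term_le) auto
  also have "\<dots> = N n w / wt n * ((\<Sum>j=2..n. pr n j) + C * D n)"
    by (simp add: D_def sum_distrib_left sum.distrib algebra_simps)
  also have "\<dots> \<le> N n w / wt n * (1 + C * D n)"
  proof -
    have "(\<Sum>j=2..n. pr n j) \<le> (\<Sum>j=1..n. pr n j)"
      by (intro sum_mono2) (auto simp: pr_nonneg)
    then show ?thesis using sum_pr[OF n] N_pos[OF n] wt_pos[OF n]
      by (intro mult_left_mono) (auto simp: less_imp_le)
  qed
  finally show ?thesis by simp
qed

section \<open>The normalising sequence\<close>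

lemma b_1: "b (Suc 0) = 1" by (simp add: b_def)

lemma b_Suc: "1 \<le> n \<Longrightarrow> b (Suc n) = b n * (1 + 1 / wt n)"
  by (simp add: b_def)

lemma b_pos: "0 < b n"
  unfolding b_def using wt_pos by (intro prod_pos) (auto intro!: add_pos_pos)

lemma b_mono: "m \<le> n \<Longrightarrow> b m \<le> b n"
proof (rule lift_Suc_mono_le[of b])
  show "b n \<le> b (Suc n)" for n
    using b_Suc[of n] b_pos[of n] wt_pos[of n] by (cases "n = 0") (auto simp: b_def field_simps)
qed

text \<open>Comparison factor by factor:
  \<open>(1 + 1 / n) powr \<theta> \<le> 1 + \<theta> / n\<close> by weighted AM-GM, and
  \<open>wt n = (n - \<theta>) / \<theta> \<le> n / \<theta>\<close>.\<close>

lemma b_ge_powr: "1 \<le> n \<Longrightarrow> real n powr \<theta> \<le> b n"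
proof (induction n rule: dec_induct)
  case (step n)
  have n: "1 \<le> real n" using step by simp
  have "1 + \<theta> / real n \<le> 1 + 1 / wt n"
    using n theta_pos theta_less_1 by (simp add: wt_theta frac_le)
  have "real (Suc n) = real n * (1 + 1 / real n)" using n by (simp add: field_simps)
  then have "real (Suc n) powr \<theta> = real n powr \<theta> * (1 + 1 / real n) powr \<theta>"
    by (simp only: powr_mult)
  also have "(1 + 1 / real n) powr \<theta> * 1 powr (1 - \<theta>) \<le> \<theta> * (1 + 1 / real n) + (1 - \<theta>) * 1"
    using n theta_pos theta_less_1 by (intro Youngs_inequality_0) (auto intro: add_pos_pos)
  then have "(1 + 1 / real n) powr \<theta> \<le> 1 + 1 / wt n"
    using \<open>1 + \<theta> / real n \<le> 1 + 1 / wt n\<close> by (simp add: algebra_simps)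
  then have "real n powr \<theta> * (1 + 1 / real n) powr \<theta> \<le> b n * (1 + 1 / wt n)"
    using step.IH b_pos[of n] by (intro mult_mono) (auto simp: less_imp_le)
  finally show ?case using step by (simp add: b_Suc)
qed (simp add: b_1)

lemma b_ge_1: "1 \<le> n \<Longrightarrow> 1 \<le> b n"
  using b_mono[of 1 n] b_1 by simp

text \<open>Euler's limit for the Gamma function at \<open>1 - \<theta>\<close>; the product
  \<open>b n\<close> lacks only the last pochhammer factor n - \<theta>, whose ratio to n tends to
  1.\<close>

lemma b_asymp: "(\<lambda>n. b n / real n powr \<theta>) \<longlonglongrightarrow> Gamma (1 - \<theta>)"
proof -
  have th: "0 < 1 - \<theta>" using theta_less_1 by simp
  have eq: "fact (n - 1) / pochhammer (1 - \<theta>) n = b n / (real n - \<theta>)" if "1 \<le> n" for n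
    using that
  proof (induction n rule: dec_induct)
    case (step n)
    obtain m where m: "n = Suc m" using step by (cases n) auto
    have pos: "pochhammer (1 - \<theta>) n \<noteq> 0" "real n - \<theta> \<noteq> 0" "real n + 1 - \<theta> \<noteq> 0"
      using pochhammer_pos[OF th, of n] theta_less_1 step.hyps by auto
    have "fact (Suc n - 1) / pochhammer (1 - \<theta>) (Suc n)
        = (fact (n - 1) / pochhammer (1 - \<theta>) n) * (real n / (real n + 1 - \<theta>))"
      using m by (simp add: pochhammer_Suc algebra_simps)
    also have "\<dots> = b n * (real n / (real n - \<theta>)) / (real (Suc n) - \<theta>)"
      unfolding step.IH using pos by (simp add: field_simps)
    also have "real n / (real n - \<theta>) = 1 + 1 / wt n"
      using pos theta_pos by (simp add: wt_theta field_simps)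
    finally show ?case using step by (simp add: b_Suc)
  qed (simp add: b_1)
  have "(\<lambda>n. Gamma_series' (1 - \<theta>) n * ((real n - \<theta>) / real n)) \<longlonglongrightarrow> Gamma (1 - \<theta>) * 1"
  proof (intro tendsto_mult Gamma_series'_LIMSEQ)
    have "(\<lambda>n. 1 - \<theta> * inverse (real n)) \<longlonglongrightarrow> 1 - \<theta> * 0"
      by (intro tendsto_intros LIMSEQ_inverse_real_of_nat lim_inverse_n)
    moreover have "eventually (\<lambda>n. 1 - \<theta> * inverse (real n) = (real n - \<theta>) / real n) sequentially"
      using eventually_gt_at_top[of 0] by eventually_elim (simp add: field_simps)
    ultimately show "(\<lambda>n. (real n - \<theta>) / real n) \<longlonglongrightarrow> 1"
      by (simp add: Lim_transform_eventually)
  qed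
  moreover have "eventually (\<lambda>n. Gamma_series' (1 - \<theta>) n * ((real n - \<theta>) / real n) = b n / real n powr \<theta>) sequentially"
    using eventually_ge_at_top[of 1]
  proof eventually_elim
    case (elim n)
    have pos: "real n - \<theta> \<noteq> 0" "0 < real n" using theta_less_1 elim by auto
    have "Gamma_series' (1 - \<theta>) n = (fact (n - 1) / pochhammer (1 - \<theta>) n) * real n powr (1 - \<theta>)"
      using elim by (simp add: Gamma_series'_def powr_def)
    also have "\<dots> = b n / (real n - \<theta>) * (real n / real n powr \<theta>)"
      unfolding eq[OF elim] using elim by (simp add: powr_diff)
    finally show ?case using pos by simp
  qed
  ultimately show ?thesis by (simp add: Lim_transform_eventually)
qed

text \<open>The step ratio is \<open>(wt n + 1) / wt (Suc n)\<close>, and \<open>wt\<close>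
  increases by \<open>2 + \<alpha> > 1\<close>.\<close>

lemma b_div_wt_antimono: "i \<le> j \<Longrightarrow> 1 \<le> i \<Longrightarrow> b j / wt j \<le> b i / wt i"
proof (induction j rule: dec_induct)
  case (step n)
  then have n: "1 \<le> n" by simp
  note w = wt_pos[OF n] wt_pos[of "Suc n"] b_pos[of n]
  have "b (Suc n) / wt (Suc n) = b n / wt n * ((wt n + 1) / wt (Suc n))"
    using w by (simp add: b_Suc[OF n] field_simps)
  also have "\<dots> \<le> b n / wt n * 1"
  proof (rule mult_left_mono)
    have "wt n + 1 \<le> wt (Suc n)" using alpha by (simp add: wt_def algebra_simps)
    then show "(wt n + 1) / wt (Suc n) \<le> 1" using w by simp
  qed (use w in simp)
  finally show ?case using step by simp
qed simp

text \<open>Delays only help the root in the mean: \<open>b\<close> solves the undelayed recursion, and \<open>b j / wt j\<close> is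
  decreasing, so looking back in time does not decrease the attachment rate.\<close>

lemma expectation_N_ge: "1 \<le> n \<Longrightarrow> (1 + \<alpha>) * b n \<le> (\<integral>w. N n w \<partial>M)"
proof (induction n rule: less_induct)
  case (less n)
  interpret prob_space M by (rule prob_space_M)
  show ?case
  proof (cases "n = 1")
    case True
    then show ?thesis by (simp add: b_1 N_1 prob_space)
  next
    case False
    then obtain k where k: "n = Suc k" "1 \<le> k" using less.prems by (cases n) auto
    \<comment> \<open>The look-back probabilities sum to one, so the undelayed growth of
      \<open>b\<close> can be spread over all times j and compared term by term.\<close>
    have "(\<Sum>j=1..k. pr k j * c) = c" for c
      using k sum_pr[of k] by (simp only: sum_distrib_right[symmetric] mult_1_left)
    then have "(1 + \<alpha>) * b n = (1 + \<alpha>) * b k + (\<Sum>j=1..k. pr k j * ((1 + \<alpha>) * (b k / wt k)))"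
      using k by (simp only: b_Suc) (simp add: algebra_simps)
    also have "\<dots> \<le> (\<integral>w. N k w \<partial>M) + (\<Sum>j=1..k. pr k j * ((\<integral>w. N j w \<partial>M) / wt j))"
    proof (intro add_mono sum_mono mult_left_mono pr_nonneg)
      show "(1 + \<alpha>) * b k \<le> (\<integral>w. N k w \<partial>M)" using less k by simp
      fix j assume j: "j \<in> {1..k}"
      have "(1 + \<alpha>) * (b k / wt k) \<le> (1 + \<alpha>) * (b j / wt j)"
        using b_div_wt_antimono[of j k] j alpha by (intro mult_left_mono) auto
      also have "\<dots> = ((1 + \<alpha>) * b j) / wt j" by simp
      also have "\<dots> \<le> (\<integral>w. N j w \<partial>M) / wt j"
        using less.IH[of j] j k wt_pos[of j] by (intro divide_right_mono) auto
      finally show "(1 + \<alpha>) * (b k / wt k) \<le> (\<integral>w. N j w \<partial>M) / wt j" .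
    qed
    also have "\<dots> = (\<integral>w. N n w \<partial>M)"
      using k by (simp add: expectation_N_Suc expectation_p)
    finally show ?thesis .
  qed
qed

text \<open>Attachment time 1 means \<open>n - n powr \<beta> * x < 2\<close>; for n \<ge> 4 the 2
  is at most n / 2, so \<open>n < n powr \<beta> * (2 * x)\<close>. Up to the factor 2 this is the
  converse of \<open>att_eq_1I\<close>.\<close>

lemma att_eq_1D:
  assumes "att n x = 1" "4 \<le> n" "0 \<le> x"
  shows "real n < (2 * x) powr (1 / (1 - \<beta>))"
proof -
  have "floor_plus (real n - real n powr \<beta> * x) = 1"
    using assms unfolding att_def by linarith
  then have "\<lfloor>real n - real n powr \<beta> * x\<rfloor> \<le> 1" unfolding floor_plus_def by linarith
  then have "real n < real n powr \<beta> * (2 * x)" using assms(2) by linarith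
  then have "real n powr (1 - \<beta>) < 2 * x"
    using assms(2) by (simp add: powr_diff field_simps)
  then have "(real n powr (1 - \<beta>)) powr (1 / (1 - \<beta>)) < (2 * x) powr (1 / (1 - \<beta>))"
    using beta by (intro powr_less_mono2) auto
  then show ?thesis using beta assms(2) by (simp add: powr_powr)
qed

lemma att_eq_1I:
  assumes "real n < x powr (1 / (1 - \<beta>))" "1 \<le> n" "0 \<le> x"
  shows "att n x = 1"
proof -
  have "real n powr (1 - \<beta>) < (x powr (1 / (1 - \<beta>))) powr (1 - \<beta>)"
    using assms beta by (intro powr_less_mono2) auto
  also have "\<dots> = x" using beta assms by (simp add: powr_powr)
  finally have "real n < real n powr \<beta> * x"
    using assms(2) by (simp add: powr_diff field_simps)
  then have "floor_plus (real n - real n powr \<beta> * x) = 1"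
    by (simp add: floor_plus_def max_def)
  then show ?thesis using assms by (simp add: att_def)
qed

text \<open>After exchanging sum and integral, attachment time 1 occurs only for n < Z, and the sum
  of \<open>n powr - \<theta>\<close> over these n is at most
  \<open>Z powr (1 - \<theta>) / (1 - \<theta>)\<close>, a constant multiple of the moment
  integrand. The shift by 4 comes from \<open>att_eq_1D\<close>.\<close>

lemma summable_q:
  assumes "(\<integral>\<^sup>+ x. ennreal ((x powr (1 / (1 - \<beta>))) powr (1 - \<theta>)) \<partial>\<mu>) < \<infinity>"
  shows "summable (\<lambda>n. q n / real n powr \<theta>)"
proof -
  interpret \<mu>: prob_space \<mu> by (rule mu_prob)
  define s where "s = 1 - \<theta>"
  have s: "0 < s" "s < 1" using theta_pos theta_less_1 by (auto simp: s_def)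
  define Z where "Z x = (2 * x) powr (1 / (1 - \<beta>))" for x :: real
  have "integrable \<mu> (\<lambda>x. (x powr (1 / (1 - \<beta>))) powr s)"
    using assms mu_sets by (intro integrableI_nonneg) (auto simp: s_def cong: measurable_cong_sets)
  then have I: "integrable \<mu> (\<lambda>x. (2 powr (1 / (1 - \<beta>))) powr s * (x powr (1 / (1 - \<beta>))) powr s)"
    by simp
  have int: "integrable \<mu> (\<lambda>x. Z x powr s / s)"
    unfolding Z_def
  proof (intro integrable_divide, rule integrable_cong_AE_imp[OF I])
    show "(\<lambda>x. ((2 * x) powr (1 / (1 - \<beta>))) powr s) \<in> borel_measurable \<mu>"
      using mu_sets by (auto cong: measurable_cong_sets)
    show "AE x in \<mu>. (2 powr (1 / (1 - \<beta>))) powr s * (x powr (1 / (1 - \<beta>))) powr s = ((2 * x) powr (1 / (1 - \<beta>))) powr s"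
      using AE_mu_nonneg by eventually_elim (simp add: powr_mult)
  qed
  have "(\<Sum>i<m. q (i + 4) / real (i + 4) powr \<theta>) \<le> (\<integral>x. Z x powr s / s \<partial>\<mu>)" for m
  proof -
    define c where "c x = (\<Sum>i<m. 1 / real (i + 4) powr \<theta> * indicator {x. att (i + 4) x = 1} x)" for x
    have A: "{x. att n x = j} \<in> sets \<mu>" for j n by (simp add: mu_sets)
    have "space \<mu> = UNIV" using sets_eq_imp_space_eq[OF mu_sets] by simp
    then have "(\<Sum>i<m. q (i + 4) / real (i + 4) powr \<theta>) = integral\<^sup>L \<mu> c"
      unfolding c_def
      by (subst Bochner_Integration.integral_sum) (auto simp: A q_def pr_def \<mu>.emeasure_eq_measure)
    also have "\<dots> \<le> (\<integral>x. Z x powr s / s \<partial>\<mu>)"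
    proof (intro integral_mono_AE int)
      show "integrable \<mu> c" unfolding c_def by (auto simp: A \<mu>.emeasure_eq_measure)
      show "AE x in \<mu>. c x \<le> Z x powr s / s"
        using AE_mu_nonneg
      proof eventually_elim
        case (elim x)
        have "c x \<le> (\<Sum>i<m. if real (i + 4) < Z x then real (i + 4) powr (s - 1) else 0)"
          unfolding c_def
        proof (rule sum_mono)
          fix i
          show "1 / real (i + 4) powr \<theta> * indicator {x. att (i + 4) x = 1} x
              \<le> (if real (i + 4) < Z x then real (i + 4) powr (s - 1) else 0)"
            using att_eq_1D[of "i + 4" x] elim
            by (cases "att (i + 4) x = 1") (simp_all add: s_def Z_def powr_minus_divide)
        qed
        also have "\<dots> = (\<Sum>n=4..<m+4. if real n < Z x then real n powr (s - 1) else 0)"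
          by (rule sum.reindex_bij_witness[where i = "\<lambda>n. n - 4" and j = "\<lambda>i. i + 4"]) auto
        also have "\<dots> \<le> (\<Sum>n=1..m+4. if real n < Z x then real n powr (s - 1) else 0)"
          by (intro sum_mono2) auto
        also have "\<dots> \<le> Z x powr s / s"
          by (intro sum_powr_below_le s) (simp add: Z_def)
        finally show ?case .
      qed
    qed
    finally show ?thesis .
  qed
  then have "summable (\<lambda>i. q (i + 4) / real (i + 4) powr \<theta>)"
    by (intro summableI_nonneg_bounded) (auto simp: q_bounds)
  then show ?thesis using summable_iff_shift[of "\<lambda>n. q n / real n powr \<theta>" 4] by blast
qed

lemma summable_D:
  assumes "summable (\<lambda>n. delay_quantity \<mu> \<beta> n / real n)"
  shows "summable (\<lambda>n. D n / real n)"
proof (rule summable_comparison_test'[where N = 2])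
  have "summable (\<lambda>n. 1 / real n ^ 2)"
    using inverse_power_summable[of 2, where 'a = real] by (simp add: inverse_eq_divide)
  then show "summable (\<lambda>n. 2 * (delay_quantity \<mu> \<beta> n / real n) + 2 * (1 / real n ^ 2))"
    by (intro summable_add summable_mult assms) auto
  show "norm (D n / real n) \<le> 2 * (delay_quantity \<mu> \<beta> n / real n) + 2 * (1 / real n ^ 2)" if "2 \<le> n" for n
  proof -
    have "D n / real n \<le> (2 * delay_quantity \<mu> \<beta> n + 2 / real n) / real n"
      using D_le_delay[OF that] by (intro divide_right_mono) auto
    then show ?thesis using D_nonneg[of n] by (simp add: power2_eq_square add_divide_distrib)
  qed
qed

section \<open>Forced attachments and the case of infinite mean\<close>

definition forced :: "nat \<Rightarrow> (nat \<Rightarrow> real \<times> real) \<Rightarrow> real" where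
  "forced k w = (if att k (fst (w (Suc k))) = 1 then 1 else 0)"

lemma measurable_forced [measurable]: "forced k \<in> borel_measurable M"
  unfolding forced_def by measurable

lemma rdeg_ge_forced: "1 \<le> n \<Longrightarrow> 1 + (\<Sum>k=1..<n. forced k w) \<le> real (rdeg n w)"
proof (induction n rule: dec_induct)
  case (step n)
  then have "forced n w \<le> hit n w (w (Suc n))" by (simp add: forced_def hit_def Let_def)
  moreover have "real (rdeg (Suc n) w) = real (rdeg n w) + hit n w (w (Suc n))"
    using N_Suc[of n w] step by (simp add: N_def)
  ultimately show ?case using step by simp
qed (simp add: rdeg_1)

lemma integral_forced_fresh: "(\<integral>z. forced k (w(Suc k := z)) - q k \<partial>K) = 0"
proof -
  let ?U = "uniform_measure lborel {0..1::real}"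
  interpret \<mu>: prob_space \<mu> by (rule mu_prob)
  interpret U: prob_space ?U by (rule prob_space_uniform)
  interpret P: pair_prob_space \<mu> ?U ..
  have sp: "space \<mu> = UNIV" using sets_eq_imp_space_eq[OF mu_sets] by simp
  have A: "{x. att k x = 1} \<in> sets \<mu>" "UNIV \<in> sets ?U" by (simp_all add: mu_sets)
  have R: "{x. att k x = 1} \<times> UNIV \<in> sets K" by (intro pair_measureI A)
  have "emeasure ?U UNIV = 1" using U.emeasure_space_1 by simp
  then have m: "measure K ({x. att k x = 1} \<times> UNIV) = q k"
    using U.emeasure_pair_measure_Times[OF A] by (simp add: measure_def q_def pr_def)
  have "(\<integral>z. forced k (w(Suc k := z)) - q k \<partial>K) = (\<integral>z. indicator ({x. att k x = 1} \<times> UNIV) z - q k \<partial>K)"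
    by (intro Bochner_Integration.integral_cong) (auto simp: forced_def indicator_def)
  also have "\<dots> = 0"
    using R m sets.sets_into_space[OF R] by (simp add: P.P.prob_space P.P.emeasure_eq_measure Int_absorb2)
  finally show ?thesis .
qed

text \<open>The centred indicators are orthogonal, each with variance
  \<open>q k * (1 - q k)\<close>.\<close>

lemma variance_forced:
  "(\<integral>w. (\<Sum>k=1..<n. forced k w - q k)\<^sup>2 \<partial>M) \<le> (\<Sum>k=1..<n. q k)"
proof -
  interpret prob_space M by (rule prob_space_M)
  have bnd: "\<bar>forced k w - q k\<bar> \<le> 1" for k w using q_bounds[of k] by (auto simp: forced_def)
  have int: "integrable M (forced k)" for k
    by (rule integrable_bounded[where C = 1]) (auto simp: forced_def)
  have "(\<integral>w. (\<Sum>k=1..<n. 1 * (forced k w - q k))\<^sup>2 \<partial>M) = (\<Sum>k=1..<n. 1\<^sup>2 * (\<integral>w. (forced k w - q k)\<^sup>2 \<partial>M))"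
    unfolding M_def
  proof (rule integral_square_sum_fresh[OF prob_space_K, where B = "\<lambda>_. 1"])
    show "(\<lambda>w. forced k w - q k) \<in> borel_measurable (PiM UNIV (\<lambda>_. K))" for k
      using measurable_forced[of k, unfolded M_def] by auto
    show "(\<integral>z. forced k (w(Suc k := z)) - q k \<partial>K) = 0" for k w by (rule integral_forced_fresh)
  qed (use bnd in \<open>auto simp: forced_def\<close>)
  also have "\<dots> \<le> (\<Sum>k=1..<n. q k)"
  proof (rule sum_mono)
    fix k
    have "(\<integral>w. (forced k w - q k) * 1 \<partial>M) = (\<integral>w. 0 * 1 \<partial>M)"
      unfolding M_def
      by (rule integral_PiM_fresh_mult[OF prob_space_K, where i = "Suc k" and B = 1 and C = 1])
        (use measurable_forced[of k, unfolded M_def] bnd integral_forced_fresh in auto)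
    then have E: "(\<integral>w. forced k w \<partial>M) = q k" using int by (simp add: prob_space)
    have "(\<lambda>w. (forced k w - q k)\<^sup>2) = (\<lambda>w. forced k w * (1 - 2 * q k) + (q k)\<^sup>2)"
      by (auto simp: forced_def fun_eq_iff power2_eq_square algebra_simps)
    then have "(\<integral>w. (forced k w - q k)\<^sup>2 \<partial>M) = q k * (1 - 2 * q k) + (q k)\<^sup>2"
      using int E by (simp add: prob_space)
    also have "\<dots> \<le> q k" using q_bounds[of k] by (simp add: power2_eq_square algebra_simps)
    finally show "1\<^sup>2 * (\<integral>w. (forced k w - q k)\<^sup>2 \<partial>M) \<le> q k" by simp
  qed
  finally show ?thesis by simp
qed

text \<open>Pointwise, the minimum of X and n is at most 1 plus the number of k in {1..<n} with k <
  X, and each such k forces attachment time 1.\<close>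

lemma truncated_mean_le:
  assumes n: "1 \<le> n"
  shows "(\<integral>x. min (x powr (1 / (1 - \<beta>))) (real n) \<partial>\<mu>) \<le> 1 + (\<Sum>k=1..<n. q k)"
proof -
  interpret \<mu>: prob_space \<mu> by (rule mu_prob)
  have A: "{x. att k x = j} \<in> sets \<mu>" for j k by (simp add: mu_sets)
  have sp: "space \<mu> = UNIV" using sets_eq_imp_space_eq[OF mu_sets] by simp
  have "(\<integral>x. min (x powr (1 / (1 - \<beta>))) (real n) \<partial>\<mu>)
      \<le> (\<integral>x. 1 + (\<Sum>k=1..<n. indicator {x. att k x = 1} x) \<partial>\<mu>)"
  proof (rule integral_mono_AE)
    show "integrable \<mu> (\<lambda>x. min (x powr (1 / (1 - \<beta>))) (real n))"
      using mu_sets by (intro \<mu>.integrable_const_bound[where B = "real n"]) (auto cong: measurable_cong_sets)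
    show "integrable \<mu> (\<lambda>x. 1 + (\<Sum>k=1..<n. indicator {x. att k x = 1} x) :: real)"
      by (auto simp: A \<mu>.emeasure_eq_measure)
    show "AE x in \<mu>. min (x powr (1 / (1 - \<beta>))) (real n) \<le> 1 + (\<Sum>k=1..<n. indicator {x. att k x = 1} x)"
      using AE_mu_nonneg
    proof eventually_elim
      case (elim x)
      have "min (x powr (1 / (1 - \<beta>))) (real n) \<le> 1 + (\<Sum>k=1..<n. if real k < x powr (1 / (1 - \<beta>)) then 1 else 0)"
        using n
      proof (induction n rule: dec_induct)
        case (step n)
        then show ?case by (auto simp: min_def split: if_splits)
      qed auto
      also have "\<dots> \<le> 1 + (\<Sum>k=1..<n. indicator {x. att k x = 1} x)"
        using att_eq_1I elim by (intro add_left_mono sum_mono) (auto simp: indicator_def)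
      finally show ?case .
    qed
  qed
  also have "\<dots> = 1 + (\<Sum>k=1..<n. q k)"
    using sp \<mu>.prob_space by (simp add: A \<mu>.emeasure_eq_measure q_def pr_def)
  finally show ?thesis .
qed

lemma truncated_mean_at_top:
  assumes "(\<integral>\<^sup>+ x. ennreal (x powr (1 / (1 - \<beta>))) \<partial>\<mu>) = \<infinity>"
  shows "filterlim (\<lambda>n. \<integral>x. min (x powr (1 / (1 - \<beta>))) (real n) \<partial>\<mu>) at_top sequentially"
proof -
  interpret \<mu>: prob_space \<mu> by (rule mu_prob)
  let ?X = "\<lambda>x::real. x powr (1 / (1 - \<beta>))"
  have [measurable]: "?X \<in> borel_measurable \<mu>" using mu_sets by (auto cong: measurable_cong_sets)
  have "(\<lambda>n. \<integral>\<^sup>+ x. ennreal (min (?X x) (real n)) \<partial>\<mu>) \<longlonglongrightarrow> (\<integral>\<^sup>+ x. ennreal (?X x) \<partial>\<mu>)"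
  proof (rule nn_integral_LIMSEQ)
    show "incseq (\<lambda>n x. ennreal (min (?X x) (real n)))"
      by (auto simp: incseq_def le_fun_def intro!: ennreal_leI min.mono)
    show "(\<lambda>n. ennreal (min (?X x) (real n))) \<longlonglongrightarrow> ennreal (?X x)" for x
    proof (rule tendsto_eventually)
      obtain m where "?X x \<le> real m" using real_arch_simple by blast
      then show "eventually (\<lambda>n. ennreal (min (?X x) (real n)) = ennreal (?X x)) sequentially"
        by (intro eventually_sequentiallyI[of m]) (simp add: min_absorb1 order_trans)
    qed
  qed measurable
  moreover have "(\<integral>\<^sup>+ x. ennreal (min (?X x) (real n)) \<partial>\<mu>) = ennreal (\<integral>x. min (?X x) (real n) \<partial>\<mu>)" for n
    by (intro nn_integral_eq_integral \<mu>.integrable_const_bound[where B = "real n"]) auto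
  ultimately have "(\<lambda>n. ennreal (\<integral>x. min (?X x) (real n) \<partial>\<mu>)) \<longlonglongrightarrow> \<infinity>" using assms by simp
  then show ?thesis
    by (simp add: ennreal_tendsto_top_eq_at_top)
qed

text \<open>The centred count \<open>S\<close> has second moment at most \<open>s n\<close>, so a
  relative deviation e has probability at most \<open>1 / (e^2 * s n)\<close>, and
  \<open>s n\<close> dominates the diverging truncated mean.\<close>

lemma root_degree_lower_bound:
  assumes inf: "(\<integral>\<^sup>+ x. ennreal (x powr (1 / (1 - \<beta>))) \<partial>\<mu>) = \<infinity>" and e: "0 < e"
  shows "(\<lambda>n. measure M {w \<in> space M. (1 - e) * (\<integral>x. min (x powr (1 / (1 - \<beta>))) (real n) \<partial>\<mu>) \<le> real (rdeg n w)}) \<longlonglongrightarrow> 1"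
proof -
  interpret prob_space M by (rule prob_space_M)
  define m where "m n = (\<integral>x. min (x powr (1 / (1 - \<beta>))) (real n) \<partial>\<mu>)" for n :: nat
  define s where "s n = 1 + (\<Sum>k=1..<n. q k)" for n
  define S where "S n w = (\<Sum>k=1..<n. forced k w - q k)" for n w
  have m: "0 \<le> m n" for n unfolding m_def by simp
  have ms: "m n \<le> s n" if "1 \<le> n" for n using truncated_mean_le[OF that] by (simp add: m_def s_def)
  have m_top: "filterlim m at_top sequentially" unfolding m_def by (rule truncated_mean_at_top[OF inf])
  have [measurable]: "S n \<in> borel_measurable M" for n unfolding S_def by measurable
  have bnd: "\<bar>forced k w - q k\<bar> \<le> 1" for k w using q_bounds[of k] by (auto simp: forced_def)
  have S_int: "integrable M (\<lambda>w. (S n w)\<^sup>2)" for n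
  proof -
    have "\<bar>S n w\<bar> \<le> real n" for w
    proof -
      have "\<bar>S n w\<bar> \<le> (\<Sum>k=1..<n. 1)" unfolding S_def
        using bnd by (intro order_trans[OF sum_abs] sum_mono) auto
      then show ?thesis by simp
    qed
    then have "\<bar>(S n w)\<^sup>2\<bar> \<le> (real n)\<^sup>2" for w
      using abs_le_square_iff[of "S n w" "real n"] by simp
    then show ?thesis by (intro integrable_bounded[where C = "(real n)\<^sup>2"]) auto
  qed
  have lower: "1 - 1 / (e\<^sup>2 * m n) \<le> measure M {w \<in> space M. (1 - e) * m n \<le> real (rdeg n w)}"
    if n: "1 \<le> n" "0 < m n" for n
  proof -
    have sn: "0 < s n" using ms[OF n(1)] n by simp
    have "{w \<in> space M. \<not> (1 - e) * m n \<le> real (rdeg n w)} \<subseteq> {w \<in> space M. (e * s n)\<^sup>2 \<le> (S n w)\<^sup>2}"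
    proof safe
      fix w assume *: "\<not> (1 - e) * m n \<le> real (rdeg n w)"
      \<comment> \<open>For e > 1 the bound is not positive and cannot fail; for e \<le> 1 the
        factor 1 - e is nonnegative, so \<open>m n\<close> may be replaced by the larger
        \<open>s n\<close>.\<close>
      then have "e \<le> 1" using m[of n] by (smt (verit) mult_nonpos_nonneg of_nat_0_le_iff)
      then have "real (rdeg n w) < (1 - e) * s n"
        using * ms[OF n(1)] by (smt (verit) mult_left_mono)
      moreover have "s n + S n w \<le> real (rdeg n w)"
        using rdeg_ge_forced[OF n(1), of w] by (simp add: s_def S_def sum_subtractf)
      ultimately have "e * s n \<le> \<bar>S n w\<bar>" by (simp add: algebra_simps)
      then show "(e * s n)\<^sup>2 \<le> (S n w)\<^sup>2"
        using e sn abs_le_square_iff[of "e * s n" "S n w"] by simp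
    qed
    then have "measure M {w \<in> space M. \<not> (1 - e) * m n \<le> real (rdeg n w)} \<le> measure M {w \<in> space M. (e * s n)\<^sup>2 \<le> (S n w)\<^sup>2}"
      by (intro finite_measure_mono) auto
    also have "\<dots> \<le> (\<integral>w. (S n w)\<^sup>2 \<partial>M) / (e * s n)\<^sup>2"
      using S_int e sn by (intro integral_Markov_inequality_measure[where A = "{}"]) auto
    also have "\<dots> \<le> s n / (e * s n)\<^sup>2"
      using variance_forced[of n] by (intro divide_right_mono) (auto simp: S_def s_def)
    also have "\<dots> = 1 / (e\<^sup>2 * s n)"
      using sn by (simp only: power2_eq_square divide_simps) simp
    also have "\<dots> \<le> 1 / (e\<^sup>2 * m n)"
      using ms[OF n(1)] n e sn by (intro divide_left_mono mult_left_mono mult_pos_pos zero_less_power) auto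
    finally show ?thesis
      using prob_neg[of "\<lambda>w. (1 - e) * m n \<le> real (rdeg n w)"] by simp
  qed
  have A: "(\<lambda>n. 1 - 1 / (e\<^sup>2 * m n)) \<longlonglongrightarrow> 1 - 0"
    using e by (intro tendsto_intros tendsto_divide_0[OF tendsto_const] filterlim_at_top_imp_at_infinity
        filterlim_tendsto_pos_mult_at_top[OF tendsto_const _ m_top]) auto
  have B: "eventually (\<lambda>n. 1 - 1 / (e\<^sup>2 * m n) \<le> measure M {w \<in> space M. (1 - e) * m n \<le> real (rdeg n w)}) sequentially"
    using eventually_ge_at_top[of 1] filterlim_at_top_dense[THEN iffD1, OF m_top, rule_format, of 0]
    by eventually_elim (rule lower)
  have "eventually (\<lambda>n. measure M {w \<in> space M. (1 - e) * m n \<le> real (rdeg n w)} \<le> 1) sequentially"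
    by simp
  then show ?thesis unfolding m_def[symmetric]
    using tendsto_sandwich[OF B _ A[unfolded diff_zero] tendsto_const] by blast
qed

end

section \<open>Convergence tools\<close>

lemma AE_summable:
  fixes f :: "nat \<Rightarrow> 'a \<Rightarrow> real"
  assumes int: "\<And>k. integrable M (f k)" and nonneg: "\<And>k x. 0 \<le> f k x"
    and sum: "summable (\<lambda>k. \<integral>x. f k x \<partial>M)"
  shows "AE x in M. summable (\<lambda>k. f k x)"
proof -
  have [measurable]: "f k \<in> borel_measurable M" for k using int by auto
  have "(\<integral>\<^sup>+ x. (\<Sum>k. ennreal (f k x)) \<partial>M) = (\<Sum>k. \<integral>\<^sup>+ x. ennreal (f k x) \<partial>M)"
    by (intro nn_integral_suminf) measurable
  also have "\<dots> = (\<Sum>k. ennreal (\<integral>x. f k x \<partial>M))"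
    using int nonneg by (simp add: nn_integral_eq_integral)
  also have "\<dots> = ennreal (\<Sum>k. \<integral>x. f k x \<partial>M)"
    using sum nonneg by (intro suminf_ennreal2) auto
  finally have "(\<integral>\<^sup>+ x. (\<Sum>k. ennreal (f k x)) \<partial>M) \<noteq> \<infinity>" by simp
  then have "AE x in M. (\<Sum>k. ennreal (f k x)) \<noteq> \<infinity>"
    by (intro nn_integral_PInf_AE) measurable
  then show ?thesis
  proof eventually_elim
    case (elim x)
    then show ?case using nonneg by (intro summable_suminf_not_top) auto
  qed
qed

lemma Fatou_square:
  fixes X :: "nat \<Rightarrow> 'a \<Rightarrow> real"
  assumes [measurable]: "\<And>n. X n \<in> borel_measurable M" "Z \<in> borel_measurable M"
    and lim: "AE x in M. (\<lambda>n. X n x) \<longlonglongrightarrow> Z x"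
    and int: "\<And>n. integrable M (\<lambda>x. (X n x)\<^sup>2)"
    and bound: "\<And>n. (\<integral>x. (X n x)\<^sup>2 \<partial>M) \<le> B"
  shows "integrable M (\<lambda>x. (Z x)\<^sup>2)" "(\<integral>x. (Z x)\<^sup>2 \<partial>M) \<le> B"
proof -
  have B: "0 \<le> B" using bound[of 0] by (rule order_trans[rotated]) simp
  have "(\<integral>\<^sup>+ x. ennreal ((Z x)\<^sup>2) \<partial>M) = (\<integral>\<^sup>+ x. liminf (\<lambda>n. ennreal ((X n x)\<^sup>2)) \<partial>M)"
  proof (rule nn_integral_cong_AE)
    show "AE x in M. ennreal ((Z x)\<^sup>2) = liminf (\<lambda>n. ennreal ((X n x)\<^sup>2))"
      using lim
    proof eventually_elim
      case (elim x)
      then have "(\<lambda>n. ennreal ((X n x)\<^sup>2)) \<longlonglongrightarrow> ennreal ((Z x)\<^sup>2)"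
        by (intro tendsto_ennrealI tendsto_intros)
      then show ?case by (rule lim_imp_Liminf[OF trivial_limit_sequentially, symmetric])
    qed
  qed
  also have "\<dots> \<le> liminf (\<lambda>n. \<integral>\<^sup>+ x. ennreal ((X n x)\<^sup>2) \<partial>M)"
    by (rule nn_integral_liminf) measurable
  also have "\<dots> \<le> liminf (\<lambda>n. ennreal B)"
    using bound int by (intro Liminf_mono always_eventually) (auto simp: nn_integral_eq_integral intro!: ennreal_leI)
  also have "\<dots> = ennreal B" by (simp add: Liminf_const)
  finally have *: "(\<integral>\<^sup>+ x. ennreal ((Z x)\<^sup>2) \<partial>M) \<le> ennreal B" .
  then show int: "integrable M (\<lambda>x. (Z x)\<^sup>2)"
    by (intro integrableI_nonneg) (auto simp: le_less_trans[OF _ ennreal_less_top])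
  show "(\<integral>x. (Z x)\<^sup>2 \<partial>M) \<le> B"
    using * B by (simp add: nn_integral_eq_integral[OF int])
qed

text \<open>Partial sums lie between 0 and the full sum, so the square of the full sum dominates all
  squared remainders.\<close>

lemma L2_suminf_dominated:
  fixes f :: "nat \<Rightarrow> 'a \<Rightarrow> real"
  assumes [measurable]: "\<And>k. f k \<in> borel_measurable M"
    and nonneg: "\<And>k x. 0 \<le> f k x"
    and sum: "AE x in M. summable (\<lambda>k. f k x)"
    and int: "integrable M (\<lambda>x. (\<Sum>k. f k x)\<^sup>2)"
  shows "(\<lambda>n. \<integral>x. ((\<Sum>k<n. f k x) - (\<Sum>k. f k x))\<^sup>2 \<partial>M) \<longlonglongrightarrow> 0"
    and "integrable M (\<lambda>x. ((\<Sum>k<n. f k x) - (\<Sum>k. f k x))\<^sup>2)"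
proof -
  have dom: "AE x in M. ((\<Sum>k<n. f k x) - (\<Sum>k. f k x))\<^sup>2 \<le> (\<Sum>k. f k x)\<^sup>2" for n
    using sum
  proof eventually_elim
    case (elim x)
    have "0 \<le> (\<Sum>k<n. f k x)" using nonneg by (intro sum_nonneg) auto
    moreover have "(\<Sum>k<n. f k x) \<le> (\<Sum>k. f k x)" using elim nonneg by (intro sum_le_suminf) auto
    ultimately show ?case by (subst abs_le_square_iff[symmetric]) auto
  qed
  show "integrable M (\<lambda>x. ((\<Sum>k<n. f k x) - (\<Sum>k. f k x))\<^sup>2)"
    using dom by (intro Bochner_Integration.integrable_bound[OF int]) auto
  have "(\<lambda>n. \<integral>x. ((\<Sum>k<n. f k x) - (\<Sum>k. f k x))\<^sup>2 \<partial>M) \<longlonglongrightarrow> (\<integral>x. 0 \<partial>M)"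
  proof (rule integral_dominated_convergence[OF _ _ int])
    show "AE x in M. (\<lambda>n. ((\<Sum>k<n. f k x) - (\<Sum>k. f k x))\<^sup>2) \<longlonglongrightarrow> 0"
      using sum
    proof eventually_elim
      case (elim x)
      have "(\<lambda>n. ((\<Sum>k<n. f k x) - (\<Sum>k. f k x))\<^sup>2) \<longlonglongrightarrow> ((\<Sum>k. f k x) - (\<Sum>k. f k x))\<^sup>2"
        by (intro tendsto_intros summable_LIMSEQ elim)
      then show ?case by simp
    qed
  qed (use dom in auto)
  then show "(\<lambda>n. \<integral>x. ((\<Sum>k<n. f k x) - (\<Sum>k. f k x))\<^sup>2 \<partial>M) \<longlonglongrightarrow> 0" by simp
qed

text \<open>For g k \<le> n \<le> g (k + 1), monotonicity puts the ratio between
  \<open>N (g k) / b (g (Suc k))\<close> and \<open>N (g (Suc k)) / b (g k)\<close>, and slow growth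
  of \<open>b\<close> along \<open>g\<close> gives both bounds the limit L.\<close>

lemma tendsto_ratio_of_subsequence:
  fixes N b :: "nat \<Rightarrow> real" and g :: "nat \<Rightarrow> nat"
  assumes N: "\<And>m n. m \<le> n \<Longrightarrow> N m \<le> N n" "\<And>n. 1 \<le> n \<Longrightarrow> 0 \<le> N n"
    and b: "\<And>m n. m \<le> n \<Longrightarrow> b m \<le> b n" "\<And>n. 0 < b n"
    and g: "strict_mono g" "1 \<le> g 0"
    and ratio: "(\<lambda>k. b (g (Suc k)) / b (g k)) \<longlonglongrightarrow> 1"
    and lim: "(\<lambda>k. N (g k) / b (g k)) \<longlonglongrightarrow> L"
  shows "(\<lambda>n. N n / b n) \<longlonglongrightarrow> L"
proof (rule LIMSEQ_I)
  fix e :: real assume e: "0 < e"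
  have "(\<lambda>k. N (g k) / b (g k) / (b (g (Suc k)) / b (g k))) \<longlonglongrightarrow> L / 1"
    by (intro tendsto_divide lim ratio) auto
  then have "(\<lambda>k. N (g k) / b (g (Suc k))) \<longlonglongrightarrow> L"
    using b(2) by (simp add: less_imp_neq[THEN not_sym])
  moreover have "(\<lambda>k. N (g (Suc k)) / b (g (Suc k)) * (b (g (Suc k)) / b (g k))) \<longlonglongrightarrow> L * 1"
    by (intro tendsto_mult LIMSEQ_Suc lim ratio)
  then have "(\<lambda>k. N (g (Suc k)) / b (g k)) \<longlonglongrightarrow> L"
    using b(2) by (simp add: less_imp_neq[THEN not_sym])
  ultimately have "eventually (\<lambda>k. dist (N (g k) / b (g (Suc k))) L < e \<and> dist (N (g (Suc k)) / b (g k)) L < e) sequentially"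
    using e by (intro eventually_conj tendstoD)
  then obtain k0 where k0: "\<And>k. k0 \<le> k \<Longrightarrow> \<bar>N (g k) / b (g (Suc k)) - L\<bar> < e \<and> \<bar>N (g (Suc k)) / b (g k) - L\<bar> < e"
    by (auto simp: eventually_sequentially dist_real_def)
  show "\<exists>n0. \<forall>n\<ge>n0. norm (N n / b n - L) < e"
  proof (intro exI allI impI)
    fix n assume n: "g k0 \<le> n"
    define j where "j = (LEAST k. n < g k)"
    have "n < g (Suc n)" using strict_mono_imp_increasing[OF g(1), of "Suc n"] by simp
    then have j: "n < g j" unfolding j_def by (rule LeastI)
    then have "k0 < j" using n strict_mono_less[OF g(1), of k0 j] by simp
    then obtain k where k: "j = Suc k" "k0 \<le> k" by (cases j) auto
    then have gk: "g k \<le> n" using not_less_Least[of k "\<lambda>k. n < g k"] by (simp add: j_def)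
    have "g 0 \<le> g k" using strict_mono_less_eq[OF g(1)] by simp
    then have pos: "0 \<le> N (g k)" "0 \<le> N n" "0 \<le> N (g (Suc k))"
      using N(2)[of "g k"] N(2)[of n] N(2)[of "g (Suc k)"] g(2) gk j k by auto
    have nk: "n \<le> g (Suc k)" using j k by simp
    have "N (g k) / b (g (Suc k)) \<le> N n / b n"
      by (intro frac_le pos N(1) gk b nk)
    moreover have "N n / b n \<le> N (g (Suc k)) / b (g k)"
      by (intro frac_le pos N(1) gk b nk)
    ultimately show "norm (N n / b n - L) < e" using k0[OF k(2)] by (simp add: abs_less_iff)
  qed
qed

lemma weighted_sum_square_le:
  fixes a z :: "nat \<Rightarrow> real"
  assumes "\<And>k. k \<in> A \<Longrightarrow> 0 \<le> a k"
  shows "(\<Sum>k\<in>A. a k * z k)\<^sup>2 \<le> (\<Sum>k\<in>A. a k) * (\<Sum>k\<in>A. a k * (z k)\<^sup>2)"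
proof -
  have "(\<Sum>k\<in>A. a k * z k)\<^sup>2 = (\<Sum>k\<in>A. sqrt (a k) * (sqrt (a k) * z k))\<^sup>2"
    using assms by (intro arg_cong[where f = "\<lambda>x. x\<^sup>2"] sum.cong) (auto simp flip: mult.assoc)
  also have "\<dots> \<le> (\<Sum>k\<in>A. (sqrt (a k))\<^sup>2) * (\<Sum>k\<in>A. (sqrt (a k) * z k)\<^sup>2)"
    by (rule Cauchy_Schwarz_ineq_sum)
  also have "\<dots> = (\<Sum>k\<in>A. a k) * (\<Sum>k\<in>A. a k * (z k)\<^sup>2)"
    using assms by (intro arg_cong2[where f = "(*)"] sum.cong) (auto simp: power_mult_distrib)
  finally show ?thesis .
qed

lemma square_add3_le: "(x + y + z)\<^sup>2 \<le> 3 * (x\<^sup>2 + y\<^sup>2 + z\<^sup>2)" for x y z :: real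
proof -
  have "0 \<le> (x - y)\<^sup>2 + (y - z)\<^sup>2 + (x - z)\<^sup>2" by simp
  then show ?thesis by (simp add: power2_eq_square algebra_simps)
qed

section \<open>Convergence of the normalised root degree\<close>

locale regular_delays = delayed_attachment +
  assumes delay_summable: "summable (\<lambda>n. delay_quantity \<mu> \<beta> n / real n)"
    and moment: "(\<integral>\<^sup>+ x. ennreal ((x powr (1 / (1 - \<beta>))) powr (1 - \<theta>)) \<partial>\<mu>) < \<infinity>"
begin

lemmas q_summable = summable_q[OF moment]
lemmas D_summable = summable_D[OF delay_summable]

definition Y :: "nat \<Rightarrow> (nat \<Rightarrow> real \<times> real) \<Rightarrow> real" where "Y n w = N n w / b n"

text \<open>By \<open>p_le\<close>, the excess of \<open>p n\<close> over the undelayed rate,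
  divided by \<open>b n\<close>, is at most \<open>c n * Y n + r n\<close>: a relative part from the
  lag and an absolute part from the forced attachments.\<close>

definition c :: "nat \<Rightarrow> real" where "c n = C * D n / wt n"

definition r :: "nat \<Rightarrow> real" where "r n = q n / b n"

lemma measurable_Y [measurable]: "Y n \<in> borel_measurable M"
  unfolding Y_def by measurable

lemma Y_nonneg: "1 \<le> n \<Longrightarrow> 0 \<le> Y n w"
  using N_pos[of n w] b_pos[of n] by (simp add: Y_def)

lemma Y_bound: "1 \<le> n \<Longrightarrow> \<bar>Y n w\<bar> \<le> wt n"
proof -
  assume n: "1 \<le> n"
  have "N n w / b n \<le> wt n / 1"
    using N_le_wt[OF n, of w] b_ge_1[OF n] N_pos[OF n, of w] by (intro frac_le) auto
  then show ?thesis using Y_nonneg[OF n, of w] by (simp add: Y_def)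
qed

lemma integrable_Y: "1 \<le> n \<Longrightarrow> integrable M (Y n)"
  using Y_bound by (intro integrable_bounded) auto

lemma integrable_Y2: "1 \<le> n \<Longrightarrow> integrable M (\<lambda>w. (Y n w)\<^sup>2)"
  unfolding Y_def power_divide using integrable_N2 by (intro integrable_divide)

lemma c_nonneg: "0 \<le> c n"
proof (cases "n = 0")
  case True
  then show ?thesis by (simp add: c_def D_def)
next
  case False
  then show ?thesis using C_pos D_nonneg[of n] wt_pos[of n] by (simp add: c_def)
qed

lemma r_nonneg: "0 \<le> r n"
  using q_bounds[of n] b_pos[of n] by (simp add: r_def)

lemma summable_c: "summable c"
proof (rule summable_comparison_test'[where N = 1])
  show "summable (\<lambda>n. C / (1 + \<alpha>) * (D n / real n))" by (intro summable_mult D_summable)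
  show "norm (c n) \<le> C / (1 + \<alpha>) * (D n / real n)" if n: "1 \<le> n" for n
  proof -
    have "C * D n / wt n \<le> C * D n / ((1 + \<alpha>) * real n)"
      using n wt_ge[OF n] wt_pos[OF n] alpha C_pos D_nonneg[of n] by (intro divide_left_mono mult_pos_pos mult_nonneg_nonneg) auto
    then show ?thesis using c_nonneg[of n] by (simp add: c_def)
  qed
qed

lemma summable_r: "summable r"
proof (rule summable_comparison_test'[OF q_summable, where N = 1])
  show "norm (r n) \<le> q n / real n powr \<theta>" if n: "1 \<le> n" for n
  proof -
    have "q n / b n \<le> q n / real n powr \<theta>"
      using n b_ge_powr[OF n] b_pos[of n] q_bounds[of n] by (intro divide_left_mono mult_pos_pos) auto
    then show ?thesis using r_nonneg[of n] by (simp add: r_def)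
  qed
qed

section \<open>Uniform second moment bound\<close>

lemma inverse_wt_b_le:
  assumes n: "1 \<le> n"
  shows "1 / (wt n * b n) \<le> 1 / (1 + \<alpha>) * real n powr (- 1 - \<theta>)"
proof -
  have "(1 + \<alpha>) * real n * real n powr \<theta> \<le> wt n * b n"
    using n wt_ge[OF n] b_ge_powr[OF n] alpha wt_pos[OF n] by (intro mult_mono) auto
  then have "1 / (wt n * b n) \<le> 1 / ((1 + \<alpha>) * real n * real n powr \<theta>)"
    using n alpha by (intro divide_left_mono) (auto intro!: mult_pos_pos wt_pos b_pos)
  also have "\<dots> = 1 / (1 + \<alpha>) * real n powr (- 1 - \<theta>)"
    using n by (simp add: powr_diff powr_minus_divide)
  finally show ?thesis .
qed

text \<open>Relative error of one second moment step: \<open>2 * c n\<close> is the lag part of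
  \<open>2 * N * p\<close>, the last summand comes from the expectation of \<open>p\<close> without
  forced hits, and forced hits give \<open>3 * r n\<close>, two from \<open>2 * N * p\<close> and
  one from the expectation of \<open>p\<close>.\<close>

definition eps :: "nat \<Rightarrow> real" where
  "eps n = 2 * c n + 3 * r n + (1 + C * D n) / (wt n * b n)"

lemma eps_nonneg: "1 \<le> n \<Longrightarrow> 0 \<le> eps n"
  unfolding eps_def using c_nonneg[of n] r_nonneg[of n] wt_pos[of n] b_pos[of n] C_pos D_nonneg[of n]
  by (intro add_nonneg_nonneg divide_nonneg_nonneg mult_nonneg_nonneg) auto

lemma summable_eps: "summable eps"
proof (rule summable_comparison_test'[where N = 1])
  show "summable (\<lambda>n. 3 * c n + 3 * r n + 1 / (1 + \<alpha>) * real n powr (- 1 - \<theta>))"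
    using theta_pos by (intro summable_add summable_mult summable_c summable_r) (simp add: summable_real_powr_iff)
  show "norm (eps n) \<le> 3 * c n + 3 * r n + 1 / (1 + \<alpha>) * real n powr (- 1 - \<theta>)" if n: "1 \<le> n" for n
  proof -
    have "C * D n / (wt n * b n) \<le> C * D n / (wt n * 1)"
      using b_ge_1[OF n] wt_pos[OF n] C_pos D_nonneg[of n]
      by (intro divide_left_mono mult_left_mono mult_nonneg_nonneg) (auto intro!: mult_pos_pos b_pos)
    then have "(1 + C * D n) / (wt n * b n) \<le> c n + 1 / (1 + \<alpha>) * real n powr (- 1 - \<theta>)"
      using inverse_wt_b_le[OF n] by (simp add: c_def add_divide_distrib)
    then show ?thesis using eps_nonneg[OF n] by (simp add: eps_def)
  qed
qed

text \<open>Eliminates the first moment, so that the recursion closes in the single quantity one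
  plus the second moment.\<close>

lemma expectation_Y_le: "1 \<le> n \<Longrightarrow> (\<integral>w. Y n w \<partial>M) \<le> 1 + (\<integral>w. (Y n w)\<^sup>2 \<partial>M)"
proof -
  assume n: "1 \<le> n"
  interpret prob_space M by (rule prob_space_M)
  have "(\<integral>w. Y n w \<partial>M) \<le> (\<integral>w. 1 + (Y n w)\<^sup>2 \<partial>M)"
  proof (intro integral_mono)
    show "Y n w \<le> 1 + (Y n w)\<^sup>2" for w
      using zero_le_power2[of "Y n w - 1 / 2"] by (simp add: power2_eq_square algebra_simps)
  qed (use integrable_Y[OF n] integrable_Y2[OF n] in auto)
  then show ?thesis using integrable_Y2[OF n] by (simp add: prob_space)
qed

lemma expectation_p_le:
  assumes n: "1 \<le> n"
  shows "(\<integral>w. p n w \<partial>M) \<le> b n * (1 + (\<integral>w. (Y n w)\<^sup>2 \<partial>M)) / wt n * (1 + C * D n) + q n"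
proof -
  interpret prob_space M by (rule prob_space_M)
  have "(\<integral>w. p n w \<partial>M) \<le> (\<integral>w. N n w / wt n * (1 + C * D n) + q n \<partial>M)"
    using integrable_p[OF n] integrable_N[OF n] p_le[OF n] by (intro integral_mono) auto
  also have "\<dots> = (\<integral>w. N n w \<partial>M) / wt n * (1 + C * D n) + q n"
    using integrable_N[OF n] by (simp add: prob_space)
  also have "(\<integral>w. N n w \<partial>M) = b n * (\<integral>w. Y n w \<partial>M)"
    using b_pos[of n] by (simp add: Y_def)
  also have "b n * (\<integral>w. Y n w \<partial>M) / wt n * (1 + C * D n) \<le> b n * (1 + (\<integral>w. (Y n w)\<^sup>2 \<partial>M)) / wt n * (1 + C * D n)"
    using b_pos[of n] wt_pos[OF n] C_pos D_nonneg[of n] expectation_Y_le[OF n]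
    by (intro mult_right_mono divide_right_mono mult_left_mono) auto
  finally show ?thesis by simp
qed

text \<open>The main growth factor \<open>1 + 2 / wt n\<close> of the second moment of
  \<open>N\<close> is at most the factor \<open>(1 + 1 / wt n)^2\<close> by which the square of
  \<open>b\<close> grows, so only the errors collected in \<open>eps\<close> remain.\<close>

lemma second_moment_step:
  assumes n: "1 \<le> n"
  shows "1 + (\<integral>w. (Y (Suc n) w)\<^sup>2 \<partial>M) \<le> (1 + (\<integral>w. (Y n w)\<^sup>2 \<partial>M)) * (1 + eps n)"
proof -
  interpret prob_space M by (rule prob_space_M)
  define t where "t = (\<integral>w. (Y n w)\<^sup>2 \<partial>M)"
  define x where "x = 1 / wt n"
  define B where "B = b n"
  define G where "G = C * D n"
  have pos: "0 < x" "1 \<le> B" "0 \<le> G" "0 \<le> q n" "0 \<le> t"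
    using wt_pos[OF n] b_ge_1[OF n] C_pos D_nonneg[of n] q_bounds[of n]
    by (auto simp: x_def B_def G_def t_def)
  have N2: "(\<integral>w. (N n w)\<^sup>2 \<partial>M) = B\<^sup>2 * t"
    using b_pos[of n] by (simp add: t_def Y_def power_divide B_def)
  have y: "(\<integral>w. N n w \<partial>M) \<le> B * (1 + t)"
  proof -
    have "(\<integral>w. N n w \<partial>M) = B * (\<integral>w. Y n w \<partial>M)"
      using b_pos[of n] by (simp add: Y_def B_def)
    then show ?thesis using expectation_Y_le[OF n] pos by (simp add: t_def mult_left_mono)
  qed
  have "(\<integral>w. N n w * p n w \<partial>M) \<le> (\<integral>w. (N n w)\<^sup>2 * (x * (1 + G)) + q n * N n w \<partial>M)"
  proof (rule integral_mono)
    show "N n w * p n w \<le> (N n w)\<^sup>2 * (x * (1 + G)) + q n * N n w" for w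
      using mult_left_mono[OF p_le[OF n, of w], of "N n w"] N_pos[OF n, of w]
      by (simp add: x_def G_def power2_eq_square algebra_simps add_divide_distrib)
  qed (use integrable_N_p[OF n] integrable_N2[OF n] integrable_N[OF n] in auto)
  also have "\<dots> = B\<^sup>2 * t * (x * (1 + G)) + q n * (\<integral>w. N n w \<partial>M)"
    using integrable_N2[OF n] integrable_N[OF n] by (simp add: N2)
  also have "\<dots> \<le> B\<^sup>2 * t * (x * (1 + G)) + q n * (B * (1 + t))"
    using y pos by (intro add_left_mono mult_left_mono) auto
  finally have Np: "(\<integral>w. N n w * p n w \<partial>M) \<le> B\<^sup>2 * t * (x * (1 + G)) + q n * (B * (1 + t))" .
  have Ep: "(\<integral>w. p n w \<partial>M) \<le> B * (1 + t) * x * (1 + G) + q n"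
    using expectation_p_le[OF n] by (simp add: B_def t_def x_def G_def)
  have bS: "b (Suc n) = B * (1 + x)" by (simp add: b_Suc[OF n] B_def x_def)
  have eB: "B\<^sup>2 * eps n = 2 * G * x * B\<^sup>2 + 3 * q n * B + (1 + G) * x * B"
  proof -
    have "eps n = 2 * (G * x) + 3 * (q n / B) + (1 + G) * x / B"
      by (simp add: eps_def c_def r_def x_def G_def B_def)
    moreover have "B\<^sup>2 * (q n / B) = q n * B" "B\<^sup>2 * ((1 + G) * x / B) = (1 + G) * x * B"
      using pos(2) by (simp_all add: power2_eq_square)
    ultimately show ?thesis by (simp add: algebra_simps)
  qed
  have e0: "0 \<le> eps n" by (rule eps_nonneg[OF n])
  have "(\<integral>w. (N (Suc n) w)\<^sup>2 \<partial>M) \<le> B\<^sup>2 * t + 2 * (B\<^sup>2 * t * (x * (1 + G)) + q n * (B * (1 + t))) + (B * (1 + t) * x * (1 + G) + q n)"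
    using Np Ep by (simp add: expectation_N2_Suc[OF n] N2)
  also have "\<dots> \<le> B\<^sup>2 * (1 + 2 * x) * t + (1 + t) * (B\<^sup>2 * eps n)"
  proof -
    have "q n \<le> q n * B * (1 + t)"
      using pos mult_mono[of 1 B 1 "1 + t"] by (simp add: mult.assoc mult_le_cancel_left1)
    moreover have "0 \<le> 2 * G * x * B\<^sup>2" using pos by simp
    ultimately show ?thesis unfolding eB by (simp add: algebra_simps)
  qed
  also have "\<dots> \<le> (B\<^sup>2 * (1 + x)\<^sup>2) * t + (1 + t) * ((B\<^sup>2 * (1 + x)\<^sup>2) * eps n)"
  proof -
    have "1 + 2 * x \<le> (1 + x)\<^sup>2" "1 \<le> (1 + x)\<^sup>2" using pos by (auto simp: power2_eq_square algebra_simps)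
    then have "B\<^sup>2 * (1 + 2 * x) \<le> B\<^sup>2 * (1 + x)\<^sup>2" "B\<^sup>2 * 1 \<le> B\<^sup>2 * (1 + x)\<^sup>2"
      by (intro mult_left_mono; simp)+
    then show ?thesis using pos e0 by (intro add_mono mult_right_mono mult_left_mono) auto
  qed
  also have "\<dots> = (b (Suc n))\<^sup>2 * (t + (1 + t) * eps n)"
    unfolding bS power_mult_distrib by (simp add: distrib_left mult_ac)
  finally have "(\<integral>w. (Y (Suc n) w)\<^sup>2 \<partial>M) \<le> t + (1 + t) * eps n"
    using b_pos[of "Suc n"] by (simp add: Y_def power_divide pos_divide_le_eq mult.commute)
  then show ?thesis by (simp add: t_def algebra_simps)
qed

text \<open>Discrete Gronwall: \<open>1 + eps n \<le> exp (eps n)\<close>, and \<open>eps\<close> is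
  summable.\<close>

lemma second_moment_bounded:
  obtains T where "\<And>n. 1 \<le> n \<Longrightarrow> (\<integral>w. (Y n w)\<^sup>2 \<partial>M) \<le> T" "0 \<le> T"
proof
  let ?t = "\<lambda>n. \<integral>w. (Y n w)\<^sup>2 \<partial>M"
  \<comment> \<open>\<open>eps 0\<close> is negative because \<open>wt 0 = -1\<close>; masking index
    0 makes every partial sum at most the full sum.\<close>
  have eps': "summable (\<lambda>k. if k = 0 then 0 else eps k)"
    by (rule summable_cong[THEN iffD2, OF _ summable_eps]) (rule eventually_sequentiallyI[of 1], simp)
  show "?t n \<le> (1 + ?t 1) * exp (\<Sum>k. if k = 0 then 0 else eps k)" if n: "1 \<le> n" for n
  proof -
    have "1 + ?t n \<le> (1 + ?t 1) * exp (\<Sum>k<n. if k = 0 then 0 else eps k)"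
      using n
    proof (induction n rule: dec_induct)
      case (step n)
      have "1 + ?t (Suc n) \<le> (1 + ?t n) * exp (eps n)"
        using step by (intro order_trans[OF second_moment_step] mult_left_mono exp_ge_add_one_self) (auto intro!: add_nonneg_nonneg)
      also have "\<dots> \<le> (1 + ?t 1) * exp (\<Sum>k<n. if k = 0 then 0 else eps k) * exp (eps n)"
        using step by (intro mult_right_mono) auto
      finally show ?case using step by (simp add: exp_add mult.assoc)
    qed simp
    also have "\<dots> \<le> (1 + ?t 1) * exp (\<Sum>k. if k = 0 then 0 else eps k)"
    proof (rule mult_left_mono)
      have "0 \<le> (if k = 0 then 0 else eps k)" for k using eps_nonneg[of k] by simp
      then show "exp (\<Sum>k<n. if k = 0 then 0 else eps k) \<le> exp (\<Sum>k. if k = 0 then 0 else eps k)"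
        using eps' by (simp add: sum_le_suminf del: if_split)
    qed (auto intro!: add_nonneg_nonneg)
    finally show ?thesis by simp
  qed
  show "0 \<le> (1 + ?t 1) * exp (\<Sum>k. if k = 0 then 0 else eps k)"
    by (intro mult_nonneg_nonneg add_nonneg_nonneg) auto
qed

text \<open>Bounds the variance of the martingale increment \<open>d n / b (Suc n)\<close>; the
  increments start at n = 1.\<close>

definition V :: "nat \<Rightarrow> real" where "V n = (if n = 0 then 0 else (\<integral>w. p n w \<partial>M) / (b (Suc n))\<^sup>2)"

lemma V_nonneg: "0 \<le> V n"
  using p_nonneg by (auto simp: V_def intro!: divide_nonneg_nonneg integral_nonneg)

text \<open>The main part of \<open>V n\<close> is of order \<open>1 / (wt n * b n)\<close>, hence
  at most \<open>n powr (- 1 - \<theta>)\<close> up to constants. Half of the spare exponent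
  \<theta> is spent on the weight and the other half keeps the series convergent; the error parts
  are dominated by \<open>c\<close> and \<open>r\<close>.\<close>

lemma summable_weighted_V: "summable (\<lambda>n. real n powr (\<theta> / 2) * V n)"
proof -
  obtain T where T: "\<And>n. 1 \<le> n \<Longrightarrow> (\<integral>w. (Y n w)\<^sup>2 \<partial>M) \<le> T" "0 \<le> T"
    using second_moment_bounded by blast
  show ?thesis
  proof (rule summable_comparison_test'[where N = 1])
    show "summable (\<lambda>n. (1 + T) * c n + r n + (1 + T) / (1 + \<alpha>) * real n powr (- 1 - \<theta> / 2))"
      using theta_pos by (intro summable_add summable_mult summable_c summable_r) (simp add: summable_real_powr_iff)
    fix n :: nat assume n: "1 \<le> n"
    define h where "h = real n powr (\<theta> / 2)"
    have h: "1 \<le> h" "h * h \<le> b n" "h \<le> b n" "0 < h"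
    proof -
      show "1 \<le> h" unfolding h_def using n theta_pos by (intro ge_one_powr_ge_zero) auto
      have "h * h = real n powr \<theta>" by (simp add: h_def powr_add[symmetric])
      then show hh: "h * h \<le> b n" using b_ge_powr[OF n] by simp
      show "0 < h" using \<open>1 \<le> h\<close> by simp
      have "h * 1 \<le> h * h" using \<open>1 \<le> h\<close> by (intro mult_left_mono) auto
      then show "h \<le> b n" using hh by simp
    qed
    note pos = wt_pos[OF n] b_pos[of n] C_pos D_nonneg[of n] q_bounds[of n]
    have "h * V n \<le> h * ((b n * (1 + T) / wt n * (1 + C * D n) + q n) / (b n)\<^sup>2)"
    proof (intro mult_left_mono)
      have "V n \<le> (\<integral>w. p n w \<partial>M) / (b n)\<^sup>2"
        unfolding V_def using n b_mono[of n "Suc n"] pos p_nonneg b_pos[of "Suc n"]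
        by (auto intro!: divide_left_mono power_mono integral_nonneg mult_pos_pos)
      also have "\<dots> \<le> (b n * (1 + T) / wt n * (1 + C * D n) + q n) / (b n)\<^sup>2"
      proof (intro divide_right_mono order_trans[OF expectation_p_le[OF n]] add_right_mono mult_right_mono mult_left_mono)
        show "1 + (\<integral>w. (Y n w)\<^sup>2 \<partial>M) \<le> 1 + T" using T(1)[OF n] by simp
      qed (use pos in auto)
      finally show "V n \<le> (b n * (1 + T) / wt n * (1 + C * D n) + q n) / (b n)\<^sup>2" .
    qed (use h in auto)
    also have "\<dots> = (1 + T) * (h / b n) / wt n + (1 + T) * (h / b n) * c n + (h / b n) * r n"
      using pos by (simp add: c_def r_def power2_eq_square field_simps)
    also have "\<dots> \<le> (1 + T) * (1 / h) / wt n + (1 + T) * 1 * c n + 1 * r n"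
    proof -
      have "h / b n \<le> 1 / h" "h / b n \<le> 1" using h pos by (auto simp: field_simps)
      then show ?thesis using T(2) pos c_nonneg[of n] r_nonneg[of n]
        by (intro add_mono mult_right_mono divide_right_mono mult_left_mono) auto
    qed
    also have "(1 + T) * (1 / h) / wt n \<le> (1 + T) * (1 / h) / ((1 + \<alpha>) * real n)"
      using wt_ge[OF n] alpha n T(2) h pos by (intro divide_left_mono) (auto intro!: mult_pos_pos)
    also have "(1 + T) * (1 / h) / ((1 + \<alpha>) * real n) = (1 + T) / (1 + \<alpha>) * real n powr (- 1 - \<theta> / 2)"
      using n by (simp add: h_def powr_diff powr_minus_divide)
    finally show "norm (real n powr (\<theta> / 2) * V n) \<le> (1 + T) * c n + r n + (1 + T) / (1 + \<alpha>) * real n powr (- 1 - \<theta> / 2)"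
      using V_nonneg[of n] by (simp add: h_def)
  qed
qed

lemma summable_V: "summable V"
proof (rule summable_comparison_test'[OF summable_weighted_V, where N = 1])
  show "norm (V n) \<le> real n powr (\<theta> / 2) * V n" if "1 \<le> n" for n
    using V_nonneg[of n] that theta_pos mult_right_mono[OF ge_one_powr_ge_zero[of "real n" "\<theta> / 2"], of "V n"] by simp
qed

section \<open>Martingale and decomposition of the normalised root degree\<close>

definition Mart :: "nat \<Rightarrow> (nat \<Rightarrow> real \<times> real) \<Rightarrow> real" where
  "Mart n w = (\<Sum>k=1..<n. 1 / b (Suc k) * d k w)"

text \<open>Doob decomposition: the drift of \<open>Y\<close> is at most \<open>u\<close>, and \<open>v\<close> is the nonnegative slack, so that
  \<open>Y = Y 1 + Mart + sum of u - sum of v\<close> with both sums monotone.\<close>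

definition u :: "nat \<Rightarrow> (nat \<Rightarrow> real \<times> real) \<Rightarrow> real" where
  "u n w = (if n = 0 then 0 else c n * Y n w + r n)"

definition v :: "nat \<Rightarrow> (nat \<Rightarrow> real \<times> real) \<Rightarrow> real" where
  "v n w = (if n = 0 then 0 else u n w - (p n w - N n w / wt n) / b (Suc n))"

lemma measurable_u [measurable]: "u n \<in> borel_measurable M"
  unfolding u_def by (cases "n = 0") simp_all

lemma measurable_v [measurable]: "v n \<in> borel_measurable M"
  unfolding v_def by (cases "n = 0") simp_all

lemma measurable_Mart [measurable]: "Mart n \<in> borel_measurable M"
  unfolding Mart_def using measurable_d by (intro borel_measurable_sum borel_measurable_times) auto

lemma u_nonneg: "0 \<le> u n w"
  using c_nonneg[of n] r_nonneg[of n] Y_nonneg[of n w] by (auto simp: u_def)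

text \<open>This is \<open>p_le\<close> divided by \<open>b (Suc n)\<close>; passing to the smaller
  divisor \<open>b n\<close> enlarges the nonnegative bound and turns it into
  \<open>u n w\<close>.\<close>

lemma v_nonneg: "0 \<le> v n w"
proof (cases "n = 0")
  case False
  then have n: "1 \<le> n" by simp
  define A where "A = N n w / wt n * (C * D n) + q n"
  have A: "0 \<le> A" unfolding A_def
    using N_pos[OF n, of w] wt_pos[OF n] C_pos D_nonneg[of n] q_bounds[of n] by simp
  have "p n w - N n w / wt n \<le> A" using p_le[OF n, of w] by (simp add: A_def algebra_simps add_divide_distrib)
  then have "(p n w - N n w / wt n) / b (Suc n) \<le> A / b (Suc n)"
    using b_pos[of "Suc n"] by (intro divide_right_mono) auto
  also have "\<dots> \<le> A / b n"
    using A b_mono[of n "Suc n"] b_pos by (intro divide_left_mono mult_pos_pos) auto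
  also have "\<dots> = u n w"
    using n by (simp add: u_def A_def c_def r_def Y_def add_divide_distrib)
  finally show ?thesis using n by (simp add: v_def)
qed (simp add: v_def)

lemma Y_decomposition:
  "1 \<le> n \<Longrightarrow> Y n w = (1 + \<alpha>) + Mart n w + (\<Sum>k<n. u k w) - (\<Sum>k<n. v k w)"
proof (induction n rule: dec_induct)
  case base
  then show ?case by (simp add: Y_def N_1 b_1 Mart_def u_def v_def)
next
  case (step n)
  have pos: "0 < b n" "0 < b (Suc n)" "0 < wt n" using b_pos wt_pos step by auto
  \<comment> \<open>The growth of the normalisation compensates exactly the undelayed rate
    \<open>N n w / wt n\<close>, so only the excess of \<open>p\<close> over it drifts.\<close>
  have "N n w / b n = (N n w + N n w / wt n) / b (Suc n)"
  proof -
    have "N n w + N n w / wt n = N n w * (1 + 1 / wt n)" "1 + 1 / wt n \<noteq> 0"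
      using pos by (simp_all add: algebra_simps add_pos_pos less_imp_neq[THEN not_sym])
    then show ?thesis unfolding b_Suc[OF step.hyps(1)] by simp
  qed
  then have "Y (Suc n) w = Y n w + (hit n w (w (Suc n)) - N n w / wt n) / b (Suc n)"
    using step by (simp add: Y_def N_Suc add_divide_distrib diff_divide_distrib)
  also have "\<dots> = Y n w + 1 / b (Suc n) * d n w + u n w - v n w"
    using step by (simp add: v_def d_def diff_divide_distrib)
  finally show ?case using step by (simp add: Mart_def)
qed

lemma Mart_diff: "1 \<le> m \<Longrightarrow> m \<le> n \<Longrightarrow> Mart n w - Mart m w = (\<Sum>k=m..<n. 1 / b (Suc k) * d k w)"
proof -
  assume "1 \<le> m" "m \<le> n"
  then have "(\<Sum>k=1..<n. 1 / b (Suc k) * d k w) = (\<Sum>k=1..<m. 1 / b (Suc k) * d k w) + (\<Sum>k=m..<n. 1 / b (Suc k) * d k w)"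
    by (simp only: sum.atLeastLessThan_concat)
  then show ?thesis by (simp add: Mart_def)
qed

lemma integrable_Mart_diff: "1 \<le> m \<Longrightarrow> m \<le> n \<Longrightarrow> integrable M (\<lambda>w. (Mart n w - Mart m w)\<^sup>2)"
proof (rule integrable_bounded)
  assume mn: "1 \<le> m" "m \<le> n"
  show "\<bar>(Mart n w - Mart m w)\<^sup>2\<bar> \<le> (real (n - m))\<^sup>2" for w
  proof -
    have "\<bar>Mart n w - Mart m w\<bar> \<le> (\<Sum>k=m..<n. 1)"
      unfolding Mart_diff[OF mn]
    proof (intro order_trans[OF sum_abs] sum_mono)
      fix k assume "k \<in> {m..<n}"
      then have k: "1 \<le> k" using mn by simp
      have "\<bar>1 / b (Suc k)\<bar> * \<bar>d k w\<bar> \<le> 1 * 1"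
        using d_bound[OF k, of w] b_ge_1[of "Suc k"] by (intro mult_mono) auto
      then show "\<bar>1 / b (Suc k) * d k w\<bar> \<le> 1" by (simp only: abs_mult)
    qed
    then show ?thesis using abs_le_square_iff[of "Mart n w - Mart m w" "real (n - m)"] by simp
  qed
qed measurable

lemma Mart_diff_second_moment:
  assumes "1 \<le> m" "m \<le> n"
  shows "(\<integral>w. (Mart n w - Mart m w)\<^sup>2 \<partial>M) \<le> (\<Sum>k=m..<n. V k)"
proof -
  have "(\<integral>w. (Mart n w - Mart m w)\<^sup>2 \<partial>M) = (\<Sum>k=m..<n. (1 / b (Suc k))\<^sup>2 * (\<integral>w. (d k w)\<^sup>2 \<partial>M))"
    unfolding Mart_diff[OF assms] using assms by (intro integral_square_sum_d) auto
  also have "\<dots> \<le> (\<Sum>k=m..<n. V k)"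
  proof (rule sum_mono)
    fix k assume "k \<in> {m..<n}"
    then have k: "1 \<le> k" using assms by simp
    then show "(1 / b (Suc k))\<^sup>2 * (\<integral>w. (d k w)\<^sup>2 \<partial>M) \<le> V k"
      using mult_left_mono[OF expectation_d2_le[OF k], of "(1 / b (Suc k))\<^sup>2"]
      by (simp add: V_def power_divide)
  qed
  finally show ?thesis .
qed

text \<open>Along \<open>n = k ^ e\<close> the increments of the martingale are absolutely summable, because its
  variances decay polynomially; monotonicity of the root degree fills the gaps.\<close>

definition e :: nat where "e = nat \<lceil>4 / \<theta>\<rceil>"

definition g :: "nat \<Rightarrow> nat" where "g k = (Suc k) ^ e"

lemma e_ge: "4 / \<theta> \<le> real e" "1 \<le> e"
proof -
  show 1: "4 / \<theta> \<le> real e" unfolding e_def by linarith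
  have "0 < 4 / \<theta>" using theta_pos by simp
  then have "0 < real e" using 1 by linarith
  then show "1 \<le> e" by simp
qed

lemma strict_mono_g: "strict_mono g"
  using e_ge(2) by (intro strict_monoI) (auto simp: g_def intro!: power_strict_mono)

lemma g_ge_1: "1 \<le> g k" by (simp add: g_def)

text \<open>This fixes the exponent: \<open>e \<ge> 4 / \<theta>\<close> gives
  \<open>e * \<theta> / 2 \<ge> 2\<close>, so the weight in \<open>summable_weighted_V\<close>
  dominates the squared block index.\<close>

lemma square_le_powr_g: "g k \<le> n \<Longrightarrow> (real (Suc k))\<^sup>2 \<le> real n powr (\<theta> / 2)"
proof -
  assume gn: "g k \<le> n"
  have "2 \<le> real e * (\<theta> / 2)"
    using e_ge(1) theta_pos by (simp add: field_simps)
  then have "real (Suc k) powr 2 \<le> real (Suc k) powr (real e * (\<theta> / 2))"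
    by (intro powr_mono) auto
  also have "\<dots> = real (g k) powr (\<theta> / 2)"
  proof -
    have "real (g k) = real (Suc k) powr real e"
      by (simp add: g_def powr_realpow del: of_nat_Suc)
    then show ?thesis by (simp only: powr_powr)
  qed
  also have "\<dots> \<le> real n powr (\<theta> / 2)"
    using gn theta_pos by (intro powr_mono2) auto
  finally show ?thesis by (simp add: powr_numeral)
qed

text \<open>Block increments weighted by the squared block index have summable second moments,
  because inside each block that index is dominated by the weight of
  \<open>summable_weighted_V\<close>. AM-GM then turns weighted square summability into absolute
  summability.\<close>

lemma AE_Mart_g_convergent: "AE w in M. convergent (\<lambda>k. Mart (g k) w)"
proof -
  define h where "h k w = (real (Suc k))\<^sup>2 * (Mart (g (Suc k)) w - Mart (g k) w)\<^sup>2" for k w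
  have gg: "g k \<le> g (Suc k)" for k using strict_mono_less_eq[OF strict_mono_g] by simp
  have int: "integrable M (h k)" for k
    unfolding h_def using integrable_Mart_diff[OF g_ge_1 gg] by simp
  have h_le: "(\<integral>w. h k w \<partial>M) \<le> (\<Sum>n=g k..<g (Suc k). real n powr (\<theta> / 2) * V n)" for k
  proof -
    have "(\<integral>w. h k w \<partial>M) \<le> (real (Suc k))\<^sup>2 * (\<Sum>n=g k..<g (Suc k). V n)"
      unfolding h_def using Mart_diff_second_moment[OF g_ge_1 gg, of k] by (simp add: mult_left_mono)
    also have "\<dots> \<le> (\<Sum>n=g k..<g (Suc k). real n powr (\<theta> / 2) * V n)"
      unfolding sum_distrib_left
      using square_le_powr_g V_nonneg by (intro sum_mono mult_right_mono) auto
    finally show ?thesis .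
  qed
  have blocks: "(\<Sum>k<m. \<Sum>n=g k..<g (Suc k). f n) = (\<Sum>n=g 0..<g m. f n :: real)" for f m
  proof (induction m)
    case (Suc m)
    have "g 0 \<le> g m" using strict_mono_less_eq[OF strict_mono_g] by simp
    then show ?case using Suc gg[of m] by (simp add: sum.atLeastLessThan_concat)
  qed simp
  have "summable (\<lambda>k. \<integral>w. h k w \<partial>M)"
  proof (rule summableI_nonneg_bounded)
    show "0 \<le> (\<integral>w. h k w \<partial>M)" for k by (auto simp: h_def intro!: integral_nonneg)
    fix m
    have "(\<Sum>k<m. \<integral>w. h k w \<partial>M) \<le> (\<Sum>n=g 0..<g m. real n powr (\<theta> / 2) * V n)"
      unfolding blocks[symmetric] by (intro sum_mono h_le)
    also have "\<dots> \<le> (\<Sum>n. real n powr (\<theta> / 2) * V n)"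
      using V_nonneg by (intro sum_le_suminf summable_weighted_V) auto
    finally show "(\<Sum>k<m. \<integral>w. h k w \<partial>M) \<le> (\<Sum>n. real n powr (\<theta> / 2) * V n)" .
  qed
  then have "AE w in M. summable (\<lambda>k. h k w)"
    by (intro AE_summable int) (auto simp: h_def)
  then show ?thesis
  proof eventually_elim
    case (elim w)
    define a where "a k = Mart (g (Suc k)) w - Mart (g k) w" for k
    have "summable (\<lambda>k. 1 / (real (Suc k))\<^sup>2)"
      using inverse_power_summable[of 2, where 'a = real] summable_Suc_iff[of "\<lambda>k. 1 / (real k)\<^sup>2"]
      by (simp add: inverse_eq_divide)
    then have "summable (\<lambda>k. 1 / (real (Suc k))\<^sup>2 + h k w)" using elim by (rule summable_add)
    then have "summable a"
    proof (rule summable_comparison_test'[where N = 0])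
      fix k
      define x where "x = real (Suc k)"
      have x: "0 < x" by (simp add: x_def)
      \<comment> \<open>Expanding the square gives
        \<open>2 * |a k| \<le> 1 / x^2 + x^2 * (a k)^2\<close>.\<close>
      have "0 \<le> (1 / x - x * \<bar>a k\<bar>)\<^sup>2" by simp
      also have "\<dots> = 1 / x\<^sup>2 + x\<^sup>2 * (a k)\<^sup>2 - 2 * \<bar>a k\<bar>"
        using x by (simp add: power2_diff power_mult_distrib power_divide)
      finally show "norm (a k) \<le> 1 / (real (Suc k))\<^sup>2 + h k w"
        unfolding h_def a_def[symmetric] x_def[symmetric] by simp
    qed
    then have "(\<lambda>m. (\<Sum>k<m. a k) + Mart (g 0) w) \<longlonglongrightarrow> suminf a + Mart (g 0) w"
      by (intro tendsto_add summable_LIMSEQ tendsto_const)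
    moreover have "(\<Sum>k<m. a k) + Mart (g 0) w = Mart (g m) w" for m
      unfolding a_def by (subst sum_lessThan_telescope) simp
    ultimately show ?case by (auto simp: convergent_def)
  qed
qed

text \<open>Polynomial growth of \<open>g\<close> matters here: the ratio behaves like
  \<open>((k + 2) / (k + 1)) powr (e * \<theta>)\<close>, whereas a geometric sequence would leave a
  gap that monotonicity cannot close.\<close>

lemma b_g_ratio: "(\<lambda>k. b (g (Suc k)) / b (g k)) \<longlonglongrightarrow> 1"
proof -
  define \<Gamma> where "\<Gamma> = Gamma (1 - \<theta>)"
  have G: "0 < \<Gamma>" unfolding \<Gamma>_def using theta_less_1 by (intro Gamma_real_pos) auto
  have lim: "(\<lambda>k. b (g k) / real (g k) powr \<theta>) \<longlonglongrightarrow> \<Gamma>"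
    using LIMSEQ_subseq_LIMSEQ[OF b_asymp strict_mono_g] by (simp add: o_def \<Gamma>_def)
  have "(\<lambda>k. (1 + 1 / real (Suc k)) ^ e) \<longlonglongrightarrow> (1 + 0) ^ e"
    by (intro tendsto_intros LIMSEQ_Suc lim_1_over_n)
  then have "(\<lambda>k. ((1 + 1 / real (Suc k)) ^ e) powr \<theta>) \<longlonglongrightarrow> 1 powr \<theta>"
    by (intro tendsto_powr tendsto_const) auto
  moreover have "((1 + 1 / real (Suc k)) ^ e) powr \<theta> = real (g (Suc k)) powr \<theta> / real (g k) powr \<theta>" for k
  proof -
    have "1 + 1 / real (Suc k) = real (Suc (Suc k)) / real (Suc k)" by (simp add: field_simps)
    then show ?thesis by (simp add: g_def power_divide powr_divide)
  qed
  ultimately have "(\<lambda>k. real (g (Suc k)) powr \<theta> / real (g k) powr \<theta>) \<longlonglongrightarrow> 1" by simp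
  from tendsto_mult[OF tendsto_divide[OF LIMSEQ_Suc[OF lim] lim] this] G
  have "(\<lambda>k. (b (g (Suc k)) / real (g (Suc k)) powr \<theta>) / (b (g k) / real (g k) powr \<theta>) *
     (real (g (Suc k)) powr \<theta> / real (g k) powr \<theta>)) \<longlonglongrightarrow> 1" by simp
  moreover have "(b (g (Suc k)) / real (g (Suc k)) powr \<theta>) / (b (g k) / real (g k) powr \<theta>) *
     (real (g (Suc k)) powr \<theta> / real (g k) powr \<theta>) = b (g (Suc k)) / b (g k)" for k
  proof -
    have "0 < real (g k) powr \<theta>" "0 < real (g (Suc k)) powr \<theta>" using g_ge_1[of k] g_ge_1[of "Suc k"] by auto
    then show ?thesis using b_pos[of "g k"] by (simp add: divide_simps)
  qed
  ultimately show ?thesis by (simp only:)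
qed

section \<open>Almost sure convergence\<close>

lemma AE_summable_u: "AE w in M. summable (\<lambda>k. u k w)"
proof -
  interpret prob_space M by (rule prob_space_M)
  obtain T where T: "\<And>n. 1 \<le> n \<Longrightarrow> (\<integral>w. (Y n w)\<^sup>2 \<partial>M) \<le> T" "0 \<le> T"
    using second_moment_bounded by blast
  have int: "integrable M (u k)" for k
    unfolding u_def using integrable_Y[of k] by (cases "k = 0") simp_all
  show ?thesis
  proof (rule AE_summable[OF int u_nonneg])
    show "summable (\<lambda>k. \<integral>w. u k w \<partial>M)"
    proof (rule summable_comparison_test'[where N = 1])
      show "summable (\<lambda>k. (1 + T) * c k + r k)"
        by (intro summable_add summable_mult summable_c summable_r)
      fix k :: nat assume k: "1 \<le> k"
      have "(\<integral>w. u k w \<partial>M) = c k * (\<integral>w. Y k w \<partial>M) + r k"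
        using k integrable_Y[OF k] by (simp add: u_def prob_space)
      also have "\<dots> \<le> c k * (1 + T) + r k"
        using expectation_Y_le[OF k] T(1)[OF k] c_nonneg by (intro add_right_mono mult_left_mono) auto
      finally show "norm (\<integral>w. u k w \<partial>M) \<le> (1 + T) * c k + r k"
        using u_nonneg by (simp add: mult.commute integral_nonneg)
    qed
  qed
qed

text \<open>Along \<open>g\<close>, the decomposition and \<open>Y \<ge> 0\<close> bound the partial
  sums of \<open>v\<close> by the convergent martingale and the sum of \<open>u\<close>; being
  monotone they converge. Then \<open>Y\<close> converges along \<open>g\<close>, and monotonicity
  of \<open>N\<close> extends this to all n.\<close>

lemma AE_limits:
  "AE w in M. summable (\<lambda>k. u k w) \<and> summable (\<lambda>k. v k w) \<and> convergent (\<lambda>n. Y n w)"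
  using AE_summable_u AE_Mart_g_convergent
proof eventually_elim
  case (elim w)
  obtain L where L: "(\<lambda>k. Mart (g k) w) \<longlonglongrightarrow> L" using elim by (auto simp: convergent_def)
  then have "Bseq (\<lambda>k. Mart (g k) w)" by (intro convergent_imp_Bseq) (auto simp: convergent_def)
  then obtain B where B: "\<And>k. \<bar>Mart (g k) w\<bar> \<le> B" by (auto simp: Bseq_def)
  have v: "summable (\<lambda>k. v k w)"
  proof (rule summableI_nonneg_bounded[OF v_nonneg])
    fix n
    \<comment> \<open>The bound is available only at times of the form g n; this inequality carries
      it to every partial sum.\<close>
    have "n \<le> g n" using strict_mono_imp_increasing[OF strict_mono_g] .
    then have "(\<Sum>k<n. v k w) \<le> (\<Sum>k<g n. v k w)" using v_nonneg by (intro sum_mono2) auto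
    also have "\<dots> = (1 + \<alpha>) + Mart (g n) w + (\<Sum>k<g n. u k w) - Y (g n) w"
      using Y_decomposition[OF g_ge_1, of n w] by simp
    also have "\<dots> \<le> (1 + \<alpha>) + B + (\<Sum>k. u k w)"
      using B[of n] Y_nonneg[OF g_ge_1, of n w] sum_le_suminf[OF elim(1), of "{..<g n}"] u_nonneg
      by (auto simp: abs_le_iff)
    finally show "(\<Sum>k<n. v k w) \<le> (1 + \<alpha>) + B + (\<Sum>k. u k w)" .
  qed
  have "(\<lambda>k. (1 + \<alpha>) + Mart (g k) w + (\<Sum>i<g k. u i w) - (\<Sum>i<g k. v i w)) \<longlonglongrightarrow> (1 + \<alpha>) + L + (\<Sum>i. u i w) - (\<Sum>i. v i w)"
    using LIMSEQ_subseq_LIMSEQ[OF summable_LIMSEQ[OF elim(1)] strict_mono_g]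
      LIMSEQ_subseq_LIMSEQ[OF summable_LIMSEQ[OF v] strict_mono_g] L
    by (intro tendsto_intros) (simp_all add: o_def)
  then have "(\<lambda>k. Y (g k) w) \<longlonglongrightarrow> (1 + \<alpha>) + L + (\<Sum>i. u i w) - (\<Sum>i. v i w)"
    using Y_decomposition[OF g_ge_1] by simp
  then have "(\<lambda>n. Y n w) \<longlonglongrightarrow> (1 + \<alpha>) + L + (\<Sum>i. u i w) - (\<Sum>i. v i w)"
    unfolding Y_def
    using N_mono N_pos b_mono b_pos
    by (intro tendsto_ratio_of_subsequence[OF _ _ _ _ strict_mono_g g_ge_1 b_g_ratio]) (auto simp: less_imp_le)
  then show ?case using elim v by (auto simp: convergent_def)
qed

definition Ylim :: "(nat \<Rightarrow> real \<times> real) \<Rightarrow> real" where "Ylim w = lim (\<lambda>n. Y n w)"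

lemma measurable_Y_inf [measurable]: "Ylim \<in> borel_measurable M"
  unfolding Ylim_def by measurable

lemma AE_Y_tendsto: "AE w in M. (\<lambda>n. Y n w) \<longlonglongrightarrow> Ylim w"
  using AE_limits by eventually_elim (simp add: Ylim_def convergent_LIMSEQ_iff)

text \<open>For \<open>u\<close>, Cauchy-Schwarz with the summable weights \<open>a = c + r\<close>
  reduces the square to the bounded second moments of \<open>Y\<close>. For \<open>v\<close>,
  \<open>Y \<ge> 0\<close> bounds the partial sums by the initial value, the martingale and the sum
  of \<open>u\<close>, each bounded in L2. Fatou passes both bounds to the infinite sums.\<close>

lemma integrable_u_v_square:
  "integrable M (\<lambda>w. (\<Sum>k. u k w)\<^sup>2)" "integrable M (\<lambda>w. (\<Sum>k. v k w)\<^sup>2)"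
proof -
  interpret prob_space M by (rule prob_space_M)
  obtain T where T: "\<And>n. 1 \<le> n \<Longrightarrow> (\<integral>w. (Y n w)\<^sup>2 \<partial>M) \<le> T" "0 \<le> T"
    using second_moment_bounded by blast
  define a where "a k = c k + r k" for k
  have a: "0 \<le> a k" for k using c_nonneg r_nonneg by (simp add: a_def)
  have sa: "summable a" unfolding a_def by (intro summable_add summable_c summable_r)
  define S where "S = suminf a"
  have S: "(\<Sum>k=1..<n. a k) \<le> S" for n unfolding S_def using a by (intro sum_le_suminf sa) auto
  have S0: "0 \<le> S" using S[of 0] by simp
  have u_sq: "(\<Sum>k<n. u k w)\<^sup>2 \<le> S * (\<Sum>k=1..<n. a k * (2 + 2 * (Y k w)\<^sup>2))" for n w
  proof -
    have "(\<Sum>k<n. u k w) = (\<Sum>k=1..<n. u k w)"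
      by (rule sum.mono_neutral_right) (auto simp: u_def)
    also have "\<dots> \<le> (\<Sum>k=1..<n. a k * (1 + Y k w))"
    proof (rule sum_mono)
      fix k assume k: "k \<in> {1..<n}"
      then have "0 \<le> c k + r k * Y k w" using c_nonneg[of k] r_nonneg[of k] Y_nonneg[of k w] by simp
      then show "u k w \<le> a k * (1 + Y k w)" using k by (simp add: u_def a_def algebra_simps)
    qed
    finally have "(\<Sum>k<n. u k w)\<^sup>2 \<le> (\<Sum>k=1..<n. a k * (1 + Y k w))\<^sup>2"
      using u_nonneg by (intro power_mono sum_nonneg)
    also have "\<dots> \<le> (\<Sum>k=1..<n. a k) * (\<Sum>k=1..<n. a k * (1 + Y k w)\<^sup>2)"
      by (rule weighted_sum_square_le) (rule a)
    also have "\<dots> \<le> S * (\<Sum>k=1..<n. a k * (2 + 2 * (Y k w)\<^sup>2))"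
    proof (intro mult_mono S S0 sum_mono mult_left_mono a sum_nonneg mult_nonneg_nonneg zero_le_power2)
      show "(1 + Y k w)\<^sup>2 \<le> 2 + 2 * (Y k w)\<^sup>2" for k
        using zero_le_power2[of "1 - Y k w"] by (simp add: power2_eq_square algebra_simps)
    qed auto
    finally show ?thesis .
  qed
  have int_rhs: "integrable M (\<lambda>w. S * (\<Sum>k=1..<n. a k * (2 + 2 * (Y k w)\<^sup>2)))" for n
    using integrable_Y2 by (intro integrable_mult_right integrable_sum integrable_add) auto
  have int_u: "integrable M (\<lambda>w. (\<Sum>k<n. u k w)\<^sup>2)" for n
    using u_sq by (intro Bochner_Integration.integrable_bound[OF int_rhs[of n]]) (auto intro: order_trans[OF _ abs_ge_self])
  have bound_u: "(\<integral>w. (\<Sum>k<n. u k w)\<^sup>2 \<partial>M) \<le> S * (S * (2 + 2 * T))" for n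
  proof -
    have "(\<integral>w. (\<Sum>k<n. u k w)\<^sup>2 \<partial>M) \<le> (\<integral>w. S * (\<Sum>k=1..<n. a k * (2 + 2 * (Y k w)\<^sup>2)) \<partial>M)"
      using u_sq by (intro integral_mono int_u int_rhs)
    also have "\<dots> = S * (\<Sum>k=1..<n. a k * (2 + 2 * (\<integral>w. (Y k w)\<^sup>2 \<partial>M)))"
      using integrable_Y2 by (simp add: Bochner_Integration.integral_sum prob_space)
    also have "\<dots> \<le> S * (\<Sum>k=1..<n. a k * (2 + 2 * T))"
      using T(1) by (intro mult_left_mono sum_mono a S0) auto
    also have "\<dots> \<le> S * (S * (2 + 2 * T))"
      unfolding sum_distrib_right[symmetric] using T(2) by (intro mult_left_mono mult_right_mono S S0) auto
    finally show ?thesis .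
  qed
  show "integrable M (\<lambda>w. (\<Sum>k. u k w)\<^sup>2)"
  proof (rule Fatou_square(1)[where X = "\<lambda>n w. \<Sum>k<n. u k w"])
    show "AE w in M. (\<lambda>n. \<Sum>k<n. u k w) \<longlonglongrightarrow> (\<Sum>k. u k w)"
      using AE_summable_u by eventually_elim (rule summable_LIMSEQ)
  qed (use int_u bound_u in auto)
  define B where "B = 3 * ((1 + \<alpha>)\<^sup>2 + suminf V + S * (S * (2 + 2 * T)))"
  have v_sq: "(\<Sum>k<n. v k w)\<^sup>2 \<le> 3 * ((1 + \<alpha>)\<^sup>2 + (Mart n w - Mart 1 w)\<^sup>2 + (\<Sum>k<n. u k w)\<^sup>2)" if n: "1 \<le> n" for n w
  proof -
    \<comment> \<open>\<open>Mart 1\<close> is an empty sum; it is subtracted so that the bounds on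
      martingale increments apply directly.\<close>
    have "(\<Sum>k<n. v k w) \<le> (1 + \<alpha>) + (Mart n w - Mart 1 w) + (\<Sum>k<n. u k w)"
      using Y_decomposition[OF n, of w] Y_nonneg[OF n, of w] by (simp add: Mart_def)
    then have "(\<Sum>k<n. v k w)\<^sup>2 \<le> ((1 + \<alpha>) + (Mart n w - Mart 1 w) + (\<Sum>k<n. u k w))\<^sup>2"
      using v_nonneg by (intro power_mono sum_nonneg) auto
    also note square_add3_le
    finally show ?thesis .
  qed
  have int_rhs_v: "integrable M (\<lambda>w. 3 * ((1 + \<alpha>)\<^sup>2 + (Mart n w - Mart 1 w)\<^sup>2 + (\<Sum>k<n. u k w)\<^sup>2))" if n: "1 \<le> n" for n
    using integrable_Mart_diff[of 1 n] n int_u[of n] by simp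
  have int_v: "integrable M (\<lambda>w. (\<Sum>k<n. v k w)\<^sup>2)" for n
  proof (cases "n = 0")
    case False
    then have n: "1 \<le> n" by simp
    show ?thesis using v_sq[OF n]
      by (intro Bochner_Integration.integrable_bound[OF int_rhs_v[OF n]]) (auto intro: order_trans[OF _ abs_ge_self])
  qed simp
  have bound_v: "(\<integral>w. (\<Sum>k<n. v k w)\<^sup>2 \<partial>M) \<le> B" for n
  proof (cases "n = 0")
    case True
    have "0 \<le> suminf V" by (intro suminf_nonneg summable_V V_nonneg)
    then show ?thesis using True S0 T(2) by (simp add: B_def)
  next
    case False
    then have n: "1 \<le> n" by simp
    have "(\<integral>w. (\<Sum>k<n. v k w)\<^sup>2 \<partial>M) \<le> (\<integral>w. 3 * ((1 + \<alpha>)\<^sup>2 + (Mart n w - Mart 1 w)\<^sup>2 + (\<Sum>k<n. u k w)\<^sup>2) \<partial>M)"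
      using v_sq[OF n] by (intro integral_mono int_v int_rhs_v n)
    also have "\<dots> = 3 * ((1 + \<alpha>)\<^sup>2 + (\<integral>w. (Mart n w - Mart 1 w)\<^sup>2 \<partial>M) + (\<integral>w. (\<Sum>k<n. u k w)\<^sup>2 \<partial>M))"
      using integrable_Mart_diff[of 1 n] n int_u[of n] by (simp add: prob_space)
    also have "\<dots> \<le> B"
    proof -
      have "(\<integral>w. (Mart n w - Mart 1 w)\<^sup>2 \<partial>M) \<le> (\<Sum>k=1..<n. V k)"
        using n by (intro Mart_diff_second_moment) auto
      also have "\<dots> \<le> suminf V" by (intro sum_le_suminf summable_V V_nonneg) auto
      finally show ?thesis unfolding B_def using bound_u[of n] by (intro mult_left_mono add_mono) auto
    qed
    finally show ?thesis .
  qed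
  show "integrable M (\<lambda>w. (\<Sum>k. v k w)\<^sup>2)"
  proof (rule Fatou_square(1)[where X = "\<lambda>n w. \<Sum>k<n. v k w"])
    show "AE w in M. (\<lambda>n. \<Sum>k<n. v k w) \<longlonglongrightarrow> (\<Sum>k. v k w)"
      using AE_limits by eventually_elim (auto intro: summable_LIMSEQ)
  qed (use int_v bound_v in auto)
qed

lemma integrable_Y_inf2: "integrable M (\<lambda>w. (Ylim w)\<^sup>2)"
proof -
  obtain T where T: "\<And>n. 1 \<le> n \<Longrightarrow> (\<integral>w. (Y n w)\<^sup>2 \<partial>M) \<le> T" "0 \<le> T"
    using second_moment_bounded by blast
  show ?thesis
  proof (rule Fatou_square(1)[where X = "\<lambda>n. Y (Suc n)" and B = T])
    show "AE w in M. (\<lambda>n. Y (Suc n) w) \<longlonglongrightarrow> Ylim w"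
      using AE_Y_tendsto by eventually_elim (rule LIMSEQ_Suc)
  qed (use T integrable_Y2 in auto)
qed

text \<open>Each part of the decomposition converges in L2: the sums of \<open>u\<close> and
  \<open>v\<close> by domination, the martingale because its later increments have second moments
  bounded by tails of the series \<open>V\<close>.\<close>

lemma L2_convergence:
  "(\<lambda>n. \<integral>w. (Y n w - Ylim w)\<^sup>2 \<partial>M) \<longlonglongrightarrow> 0"
  "1 \<le> n \<Longrightarrow> integrable M (\<lambda>w. (Y n w - Ylim w)\<^sup>2)"
proof -
  define U where "U n w = (\<Sum>k<n. u k w) - (\<Sum>k. u k w)" for n w
  define Z where "Z n w = (\<Sum>k. v k w) - (\<Sum>k<n. v k w)" for n w
  \<comment> \<open>The martingale limit is read off from the decomposition, so convergence of
    \<open>Mart\<close> along all n, not only along \<open>g\<close>, follows from that of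
    \<open>Y\<close> and of the sums of \<open>u\<close> and \<open>v\<close>.\<close>
  define Minf where "Minf w = Ylim w - (1 + \<alpha>) - (\<Sum>k. u k w) + (\<Sum>k. v k w)" for w
  have [measurable]: "Minf \<in> borel_measurable M" unfolding Minf_def by measurable
  have [measurable]: "U n \<in> borel_measurable M" "Z n \<in> borel_measurable M" for n
    unfolding U_def Z_def by measurable
  have sv: "AE w in M. summable (\<lambda>k. v k w)" using AE_limits by eventually_elim simp
  note Uconv = L2_suminf_dominated[OF measurable_u u_nonneg AE_summable_u integrable_u_v_square(1), folded U_def]
  note Zconv = L2_suminf_dominated[OF measurable_v v_nonneg sv integrable_u_v_square(2), unfolded power2_commute[of "sum _ _"], folded Z_def]
  have Mart_tendsto: "AE w in M. (\<lambda>n. Mart n w) \<longlonglongrightarrow> Minf w"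
    using AE_limits AE_Y_tendsto
  proof eventually_elim
    case (elim w)
    have "(\<lambda>n. Y n w - (1 + \<alpha>) - (\<Sum>k<n. u k w) + (\<Sum>k<n. v k w)) \<longlonglongrightarrow> Minf w"
      unfolding Minf_def using elim by (intro tendsto_intros summable_LIMSEQ) auto
    moreover have "eventually (\<lambda>n. Y n w - (1 + \<alpha>) - (\<Sum>k<n. u k w) + (\<Sum>k<n. v k w) = Mart n w) sequentially"
      using eventually_ge_at_top[of 1] by eventually_elim (simp add: Y_decomposition)
    ultimately show ?case by (rule Lim_transform_eventually)
  qed
  have M_diff: "integrable M (\<lambda>w. (Minf w - Mart n w)\<^sup>2)" "(\<integral>w. (Minf w - Mart n w)\<^sup>2 \<partial>M) \<le> suminf V - (\<Sum>k<n. V k)"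
    if n: "1 \<le> n" for n
  proof -
    \<comment> \<open>Fatou over m at fixed n turns the uniform bound on later increments into a
      bound on the distance to the limit.\<close>
    have lim: "AE w in M. (\<lambda>m. Mart (m + n) w - Mart n w) \<longlonglongrightarrow> Minf w - Mart n w"
      using Mart_tendsto by eventually_elim (rule tendsto_diff[OF LIMSEQ_ignore_initial_segment tendsto_const])
    have bnd: "(\<integral>w. (Mart (m + n) w - Mart n w)\<^sup>2 \<partial>M) \<le> suminf V - (\<Sum>k<n. V k)" for m
    proof -
      have "(\<Sum>k<n. V k) + (\<Sum>k=n..<m + n. V k) = (\<Sum>k<m + n. V k)"
        by (simp add: lessThan_atLeast0 sum.atLeastLessThan_concat)
      also have "\<dots> \<le> suminf V" by (intro sum_le_suminf summable_V V_nonneg) auto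
      finally show ?thesis using Mart_diff_second_moment[OF n, of "m + n"] by simp
    qed
    show "integrable M (\<lambda>w. (Minf w - Mart n w)\<^sup>2)"
      by (rule Fatou_square(1)[OF _ _ lim integrable_Mart_diff[OF n] bnd]) auto
    show "(\<integral>w. (Minf w - Mart n w)\<^sup>2 \<partial>M) \<le> suminf V - (\<Sum>k<n. V k)"
      by (rule Fatou_square(2)[OF _ _ lim integrable_Mart_diff[OF n] bnd]) auto
  qed
  have sq: "(Y n w - Ylim w)\<^sup>2 \<le> 3 * ((Minf w - Mart n w)\<^sup>2 + (U n w)\<^sup>2 + (Z n w)\<^sup>2)" if n: "1 \<le> n" for n w
  proof -
    have "Y n w - Ylim w = (Mart n w - Minf w) + U n w + Z n w"
      using Y_decomposition[OF n, of w] by (simp add: Minf_def U_def Z_def)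
    then show ?thesis using square_add3_le[of "Mart n w - Minf w" "U n w" "Z n w"] by (simp add: power2_commute)
  qed
  have int_rhs: "integrable M (\<lambda>w. 3 * ((Minf w - Mart n w)\<^sup>2 + (U n w)\<^sup>2 + (Z n w)\<^sup>2))" if n: "1 \<le> n" for n
    using M_diff(1)[OF n] Uconv(2)[of n] Zconv(2)[of n] by simp
  show int: "integrable M (\<lambda>w. (Y n w - Ylim w)\<^sup>2)" if n: "1 \<le> n" for n
    using sq[OF n] by (intro Bochner_Integration.integrable_bound[OF int_rhs[OF n]]) (auto intro: order_trans[OF _ abs_ge_self])
  show "(\<lambda>n. \<integral>w. (Y n w - Ylim w)\<^sup>2 \<partial>M) \<longlonglongrightarrow> 0"
  proof (rule tendsto_sandwich[OF _ _ tendsto_const])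
    show "eventually (\<lambda>n. 0 \<le> (\<integral>w. (Y n w - Ylim w)\<^sup>2 \<partial>M)) sequentially" by simp
    show "eventually (\<lambda>n. (\<integral>w. (Y n w - Ylim w)\<^sup>2 \<partial>M) \<le>
        3 * ((suminf V - (\<Sum>k<n. V k)) + (\<integral>w. (U n w)\<^sup>2 \<partial>M) + (\<integral>w. (Z n w)\<^sup>2 \<partial>M))) sequentially"
      using eventually_ge_at_top[of 1]
    proof eventually_elim
      case (elim n)
      have "(\<integral>w. (Y n w - Ylim w)\<^sup>2 \<partial>M) \<le> (\<integral>w. 3 * ((Minf w - Mart n w)\<^sup>2 + (U n w)\<^sup>2 + (Z n w)\<^sup>2) \<partial>M)"
        using sq[OF elim] by (intro integral_mono int int_rhs elim)
      also have "\<dots> = 3 * ((\<integral>w. (Minf w - Mart n w)\<^sup>2 \<partial>M) + (\<integral>w. (U n w)\<^sup>2 \<partial>M) + (\<integral>w. (Z n w)\<^sup>2 \<partial>M))"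
        using M_diff(1)[OF elim] Uconv(2)[of n] Zconv(2)[of n] by simp
      finally show ?case using M_diff(2)[OF elim] by simp
    qed
    have "(\<lambda>n. 3 * ((suminf V - (\<Sum>k<n. V k)) + (\<integral>w. (U n w)\<^sup>2 \<partial>M) + (\<integral>w. (Z n w)\<^sup>2 \<partial>M))) \<longlonglongrightarrow> 3 * ((suminf V - suminf V) + 0 + 0)"
      by (intro tendsto_intros summable_LIMSEQ summable_V Uconv(1) Zconv(1))
    then show "(\<lambda>n. 3 * ((suminf V - (\<Sum>k<n. V k)) + (\<integral>w. (U n w)\<^sup>2 \<partial>M) + (\<integral>w. (Z n w)\<^sup>2 \<partial>M))) \<longlonglongrightarrow> 0" by simp
  qed
qed

section \<open>Nontriviality and the limit of the root degree\<close>

lemma integrable_Y_inf: "integrable M Ylim"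
proof -
  interpret prob_space M by (rule prob_space_M)
  show ?thesis by (rule square_integrable_imp_integrable[OF measurable_Y_inf integrable_Y_inf2])
qed

text \<open>Convergence in L2 carries the lower bound on the means, \<open>expectation_N_ge\<close>,
  over to the limit; almost sure convergence alone would not.\<close>

lemma expectation_Y_inf_ge: "1 + \<alpha> \<le> (\<integral>w. Ylim w \<partial>M)"
proof -
  interpret prob_space M by (rule prob_space_M)
  have "(\<lambda>n. ((\<integral>w. Y n w \<partial>M) - (\<integral>w. Ylim w \<partial>M))\<^sup>2) \<longlonglongrightarrow> 0"
  proof (rule tendsto_sandwich[OF _ _ tendsto_const L2_convergence(1)])
    show "eventually (\<lambda>n. ((\<integral>w. Y n w \<partial>M) - (\<integral>w. Ylim w \<partial>M))\<^sup>2 \<le> (\<integral>w. (Y n w - Ylim w)\<^sup>2 \<partial>M)) sequentially"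
      using eventually_ge_at_top[of 1]
    proof eventually_elim
      case (elim n)
      have int: "integrable M (\<lambda>w. Y n w - Ylim w)" using integrable_Y[OF elim] integrable_Y_inf by simp
      \<comment> \<open>Nonnegativity of the variance is Jensen's inequality for the square.\<close>
      have "0 \<le> variance (\<lambda>w. Y n w - Ylim w)" by (rule variance_positive)
      also have "\<dots> = (\<integral>w. (Y n w - Ylim w)\<^sup>2 \<partial>M) - (\<integral>w. Y n w - Ylim w \<partial>M)\<^sup>2"
        by (rule variance_eq[OF int L2_convergence(2)[OF elim]])
      finally show ?case using integrable_Y[OF elim] integrable_Y_inf by simp
    qed
  qed simp
  then have "(\<lambda>n. (\<integral>w. Y n w \<partial>M) - (\<integral>w. Ylim w \<partial>M)) \<longlonglongrightarrow> 0"
    using tendsto_real_sqrt[of "\<lambda>n. ((\<integral>w. Y n w \<partial>M) - (\<integral>w. Ylim w \<partial>M))\<^sup>2" 0 sequentially]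
    by (simp add: tendsto_rabs_zero_iff)
  then have "(\<lambda>n. \<integral>w. Y n w \<partial>M) \<longlonglongrightarrow> (\<integral>w. Ylim w \<partial>M)" by (simp add: LIM_zero_iff)
  moreover have "1 + \<alpha> \<le> (\<integral>w. Y n w \<partial>M)" if "1 \<le> n" for n
    using expectation_N_ge[OF that] b_pos[of n] by (simp add: Y_def pos_le_divide_eq)
  ultimately show ?thesis by (intro LIMSEQ_le_const[where X = "\<lambda>n. \<integral>w. Y n w \<partial>M"]) auto
qed

theorem root_degree_limit:
  obtains W where "W \<in> borel_measurable M" "AE w in M. 0 \<le> W w" "0 < measure M {w \<in> space M. 0 < W w}"
    "AE w in M. (\<lambda>n. real (rdeg n w) / real n powr \<theta>) \<longlonglongrightarrow> W w"
    "integrable M (\<lambda>w. (W w)\<^sup>2)"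
    "(\<lambda>n. \<integral>w. (real (rdeg n w) / real n powr \<theta> - W w)\<^sup>2 \<partial>M) \<longlonglongrightarrow> 0"
proof
  interpret prob_space M by (rule prob_space_M)
  define G where "G = Gamma (1 - \<theta>)"
  have G: "0 < G" unfolding G_def using theta_less_1 by (intro Gamma_real_pos) auto
  define s where "s n = b n / real n powr \<theta>" for n
  have s_lim: "s \<longlonglongrightarrow> G" unfolding s_def G_def by (rule b_asymp)
  define z where "z n = \<alpha> * real n powr - \<theta>" for n
  have z_lim: "z \<longlonglongrightarrow> \<alpha> * 0"
    unfolding z_def using theta_pos by (intro tendsto_mult tendsto_const tendsto_neg_powr filterlim_real_sequentially) auto
  \<comment> \<open>Undoes the normalisation: \<open>s\<close> tends to
    \<open>Gamma (1 - \<theta>)\<close>, and \<open>z\<close> is the shift \<alpha> in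
    \<open>N\<close>, negligible on the scale \<open>n powr \<theta>\<close>; hence the witness
    \<open>G * Ylim\<close>.\<close>
  have deg: "real (rdeg n w) / real n powr \<theta> = s n * Y n w - z n" if "1 \<le> n" for n w
  proof -
    have "s n * Y n w = N n w / real n powr \<theta>"
      using b_pos[of n] by (simp add: s_def Y_def)
    then show ?thesis by (simp add: N_def z_def powr_minus_divide add_divide_distrib)
  qed
  show "(\<lambda>w. G * Ylim w) \<in> borel_measurable M" by measurable
  have nonneg: "AE w in M. 0 \<le> Ylim w"
    using AE_Y_tendsto
  proof eventually_elim
    case (elim w)
    then show ?case using Y_nonneg[of _ w] by (intro LIMSEQ_le_const[OF elim]) auto
  qed
  then show "AE w in M. 0 \<le> G * Ylim w" using G by auto
  show "0 < measure M {w \<in> space M. 0 < G * Ylim w}"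
  proof (rule ccontr)
    assume "\<not> 0 < measure M {w \<in> space M. 0 < G * Ylim w}"
    then have "measure M {w \<in> space M. 0 < G * Ylim w} = 0" by (simp add: not_less measure_le_0_iff)
    then have "AE w in M. \<not> 0 < G * Ylim w" by (subst AE_iff_measurable[OF _ refl]) (auto simp: emeasure_eq_measure)
    then have "AE w in M. Ylim w \<le> 0" using G by (auto simp: zero_less_mult_iff)
    then have "(\<integral>w. Ylim w \<partial>M) \<le> (\<integral>w. 0 \<partial>M)" using integrable_Y_inf by (intro integral_mono_AE) auto
    then show False using expectation_Y_inf_ge alpha by simp
  qed
  show "AE w in M. (\<lambda>n. real (rdeg n w) / real n powr \<theta>) \<longlonglongrightarrow> G * Ylim w"
    using AE_Y_tendsto
  proof eventually_elim
    case (elim w)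
    have "(\<lambda>n. s n * Y n w - z n) \<longlonglongrightarrow> G * Ylim w - \<alpha> * 0"
      by (intro tendsto_diff tendsto_mult s_lim z_lim elim)
    moreover have "eventually (\<lambda>n. s n * Y n w - z n = real (rdeg n w) / real n powr \<theta>) sequentially"
      using eventually_ge_at_top[of 1] by eventually_elim (simp add: deg)
    ultimately show ?case by (simp add: Lim_transform_eventually)
  qed
  show "integrable M (\<lambda>w. (G * Ylim w)\<^sup>2)" using integrable_Y_inf2 by (simp add: power_mult_distrib)
  define E where "E = (\<integral>w. (Ylim w)\<^sup>2 \<partial>M)"
  show "(\<lambda>n. \<integral>w. (real (rdeg n w) / real n powr \<theta> - G * Ylim w)\<^sup>2 \<partial>M) \<longlonglongrightarrow> 0"
  proof (rule tendsto_sandwich[OF _ _ tendsto_const])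
    show "eventually (\<lambda>n. 0 \<le> (\<integral>w. (real (rdeg n w) / real n powr \<theta> - G * Ylim w)\<^sup>2 \<partial>M)) sequentially" by simp
    show "eventually (\<lambda>n. (\<integral>w. (real (rdeg n w) / real n powr \<theta> - G * Ylim w)\<^sup>2 \<partial>M)
        \<le> 3 * ((s n)\<^sup>2 * (\<integral>w. (Y n w - Ylim w)\<^sup>2 \<partial>M) + (s n - G)\<^sup>2 * E + (z n)\<^sup>2)) sequentially"
      using eventually_ge_at_top[of 1]
    proof eventually_elim
      case (elim n)
      note int = L2_convergence(2)[OF elim] integrable_Y_inf2
      have sq: "(real (rdeg n w) / real n powr \<theta> - G * Ylim w)\<^sup>2
          \<le> 3 * ((s n)\<^sup>2 * (Y n w - Ylim w)\<^sup>2 + (s n - G)\<^sup>2 * (Ylim w)\<^sup>2 + (z n)\<^sup>2)" for w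
      proof -
        \<comment> \<open>Separates the L2 error of \<open>Y\<close>, the error of the deterministic
          factor \<open>s\<close> and the vanishing shift.\<close>
        have "real (rdeg n w) / real n powr \<theta> - G * Ylim w = s n * (Y n w - Ylim w) + (s n - G) * Ylim w + - z n"
          by (simp add: deg[OF elim] algebra_simps)
        then show ?thesis
          using square_add3_le[of "s n * (Y n w - Ylim w)" "(s n - G) * Ylim w" "- z n"]
          by (simp only: power_mult_distrib power2_minus)
      qed
      have rhs: "integrable M (\<lambda>w. 3 * ((s n)\<^sup>2 * (Y n w - Ylim w)\<^sup>2 + (s n - G)\<^sup>2 * (Ylim w)\<^sup>2 + (z n)\<^sup>2))"
        using int by simp
      have "(\<integral>w. (real (rdeg n w) / real n powr \<theta> - G * Ylim w)\<^sup>2 \<partial>M)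
          \<le> (\<integral>w. 3 * ((s n)\<^sup>2 * (Y n w - Ylim w)\<^sup>2 + (s n - G)\<^sup>2 * (Ylim w)\<^sup>2 + (z n)\<^sup>2) \<partial>M)"
        using sq by (intro integral_mono_AE' rhs) auto
      also have "\<dots> = 3 * ((s n)\<^sup>2 * (\<integral>w. (Y n w - Ylim w)\<^sup>2 \<partial>M) + (s n - G)\<^sup>2 * E + (z n)\<^sup>2)"
        using int by (simp add: E_def prob_space)
      finally show ?case .
    qed
    have "(\<lambda>n. 3 * ((s n)\<^sup>2 * (\<integral>w. (Y n w - Ylim w)\<^sup>2 \<partial>M) + (s n - G)\<^sup>2 * E + (z n)\<^sup>2))
        \<longlonglongrightarrow> 3 * (G\<^sup>2 * 0 + (G - G)\<^sup>2 * E + (\<alpha> * 0)\<^sup>2)"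
      by (intro tendsto_intros s_lim z_lim L2_convergence(1))
    then show "(\<lambda>n. 3 * ((s n)\<^sup>2 * (\<integral>w. (Y n w - Ylim w)\<^sup>2 \<partial>M) + (s n - G)\<^sup>2 * E + (z n)\<^sup>2)) \<longlonglongrightarrow> 0"
      by simp
  qed
qed

end

theorem mainTheorem5:
  fixes \<alpha> \<beta> :: real and \<mu> :: "real measure"
  assumes beta: "0 \<le> \<beta>" "\<beta> < 1"
    and alpha: "\<alpha> > -1"
    and mu_prob: "prob_space \<mu>" and mu_sets: "sets \<mu> = sets borel"
    and mu_nonneg: "measure \<mu> {0..} = 1"
    and delay1: "delay_quantity \<mu> \<beta> \<longlonglongrightarrow> 0"
    and delay2: "summable (\<lambda>n. delay_quantity \<mu> \<beta> n / real n)"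
  defines "f \<equiv> (\<lambda>k. real k + \<alpha>)"
    and "X \<equiv> (\<lambda>x::real. x powr (1 / (1 - \<beta>)))"
    and "\<theta> \<equiv> 1 / (2 + \<alpha>)"
    and "M \<equiv> dat_space \<mu>"
  shows
    "((\<integral>\<^sup>+ x. ennreal (X x powr (1 - \<theta>)) \<partial>\<mu>) < \<infinity> \<longrightarrow>
       (\<exists>W. W \<in> borel_measurable M \<and> (AE \<omega> in M. 0 \<le> W \<omega>)
          \<and> measure M {\<omega> \<in> space M. W \<omega> > 0} > 0
          \<and> (AE \<omega> in M. (\<lambda>n. real (root_deg f \<beta> n \<omega>) / real n powr \<theta>) \<longlonglongrightarrow> W \<omega>)
          \<and> integrable M (\<lambda>\<omega>. (W \<omega>)\<^sup>2)
          \<and> (\<lambda>n. \<integral>\<omega>. (real (root_deg f \<beta> n \<omega>) / real n powr \<theta> - W \<omega>)\<^sup>2 \<partial>M) \<longlonglongrightarrow> 0))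
     \<and> ((\<integral>\<^sup>+ x. ennreal (X x) \<partial>\<mu>) = \<infinity> \<longrightarrow>
       (\<forall>\<epsilon>>0. (\<lambda>n. measure M {\<omega> \<in> space M.
           real (root_deg f \<beta> n \<omega>) \<ge> (1 - \<epsilon>) * (\<integral>x. min (X x) (real n) \<partial>\<mu>)}) \<longlonglongrightarrow> 1))"
proof -
  interpret delayed_attachment \<alpha> \<beta> \<mu>
    by (rule delayed_attachment.intro[OF beta alpha mu_prob mu_sets mu_nonneg])
  have M_eq: "M = dat_space \<mu>" by (simp add: assms)
  have \<theta>_eq: "\<theta> = delayed_attachment.\<theta> \<alpha>" by (simp add: assms \<theta>_def)
  interpret prob_space M unfolding M_eq by (rule prob_space_M)
  have [measurable]: "root_deg f \<beta> n \<in> measurable M (count_space UNIV)" for n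
    unfolding M_eq by (rule measurable_root_deg[OF mu_sets])
  have [measurable]: "rdeg n \<in> measurable M (count_space UNIV)" for n
    unfolding M_eq by (rule measurable_rdeg)
  have AE_eq: "AE \<omega> in M. \<forall>n\<ge>1. root_deg f \<beta> n \<omega> = rdeg n \<omega>"
    unfolding M_eq f_def by (rule AE_root_deg)
  have AE_eq_n: "AE \<omega> in M. root_deg f \<beta> n \<omega> = rdeg n \<omega>" if "1 \<le> n" for n
    by (rule eventually_mono[OF AE_eq]) (use that in auto)
  show ?thesis
  proof (intro conjI impI allI)
    assume "(\<integral>\<^sup>+ x. ennreal (X x powr (1 - \<theta>)) \<partial>\<mu>) < \<infinity>"
    then interpret regular_delays \<alpha> \<beta> \<mu>
      using delay2 by unfold_locales (simp_all add: X_def \<theta>_eq)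
    from root_degree_limit obtain W where
      W [measurable]: "W \<in> borel_measurable M" and props: "AE w in M. 0 \<le> W w" "0 < measure M {w \<in> space M. 0 < W w}"
        "AE w in M. (\<lambda>n. real (rdeg n w) / real n powr \<theta>) \<longlonglongrightarrow> W w"
        "integrable M (\<lambda>w. (W w)\<^sup>2)"
        "(\<lambda>n. \<integral>w. (real (rdeg n w) / real n powr \<theta> - W w)\<^sup>2 \<partial>M) \<longlonglongrightarrow> 0"
      unfolding M_eq \<theta>_eq by blast
    have "AE \<omega> in M. (\<lambda>n. real (root_deg f \<beta> n \<omega>) / real n powr \<theta>) \<longlonglongrightarrow> W \<omega>"
      using props(3) AE_eq
    proof eventually_elim
      case (elim \<omega>)
      show ?case
        by (rule Lim_transform_eventually[OF elim(1)], rule eventually_sequentiallyI[of 1]) (simp add: elim(2))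
    qed
    \<comment> \<open>Tree and recursion are identified almost surely and from n = 1 on, so the two
      sequences of integrals coincide eventually.\<close>
    moreover have "(\<lambda>n. \<integral>\<omega>. (real (root_deg f \<beta> n \<omega>) / real n powr \<theta> - W \<omega>)\<^sup>2 \<partial>M) \<longlonglongrightarrow> 0"
    proof (rule Lim_transform_eventually[OF props(5)], rule eventually_sequentiallyI[of 1])
      fix n :: nat assume "1 \<le> n"
      then show "(\<integral>w. (real (rdeg n w) / real n powr \<theta> - W w)\<^sup>2 \<partial>M)
          = (\<integral>\<omega>. (real (root_deg f \<beta> n \<omega>) / real n powr \<theta> - W \<omega>)\<^sup>2 \<partial>M)"
        using AE_eq_n[of n] by (intro integral_cong_AE) auto
    qed
    ultimately show "\<exists>W. W \<in> borel_measurable M \<and> (AE \<omega> in M. 0 \<le> W \<omega>)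
          \<and> measure M {\<omega> \<in> space M. W \<omega> > 0} > 0
          \<and> (AE \<omega> in M. (\<lambda>n. real (root_deg f \<beta> n \<omega>) / real n powr \<theta>) \<longlonglongrightarrow> W \<omega>)
          \<and> integrable M (\<lambda>\<omega>. (W \<omega>)\<^sup>2)
          \<and> (\<lambda>n. \<integral>\<omega>. (real (root_deg f \<beta> n \<omega>) / real n powr \<theta> - W \<omega>)\<^sup>2 \<partial>M) \<longlonglongrightarrow> 0"
      using W props by blast
  next
    fix \<epsilon> :: real
    assume inf: "(\<integral>\<^sup>+ x. ennreal (X x) \<partial>\<mu>) = \<infinity>" and eps: "0 < \<epsilon>"
    have lim: "(\<lambda>n. measure M {w \<in> space M. (1 - \<epsilon>) * (\<integral>x. min (X x) (real n) \<partial>\<mu>) \<le> real (rdeg n w)}) \<longlonglongrightarrow> 1"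
      using root_degree_lower_bound[OF _ eps] inf unfolding X_def M_eq by simp
    show "(\<lambda>n. measure M {\<omega> \<in> space M.
           real (root_deg f \<beta> n \<omega>) \<ge> (1 - \<epsilon>) * (\<integral>x. min (X x) (real n) \<partial>\<mu>)}) \<longlonglongrightarrow> 1"
    proof (rule Lim_transform_eventually[OF lim], rule eventually_sequentiallyI[of 1])
      fix n :: nat assume "1 \<le> n"
      then show "measure M {w \<in> space M. (1 - \<epsilon>) * (\<integral>x. min (X x) (real n) \<partial>\<mu>) \<le> real (rdeg n w)}
          = measure M {\<omega> \<in> space M. real (root_deg f \<beta> n \<omega>) \<ge> (1 - \<epsilon>) * (\<integral>x. min (X x) (real n) \<partial>\<mu>)}"
        using AE_eq_n[of n] by (intro measure_eq_AE) auto
    qed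
  qed
qed


end
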